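(* Let $d\ge2$ and let $A\in M_d(\mathbb{R})$ be such that there exists $b\in M_{d,1}(\mathbb{R})$ with $(A,b)$ controllable. Then, for $T\ge\mu>0$, $$\mathrm{RC}(A)=\mathrm{RD}(-A),$$ and in particular $\mathrm{RC}(A)=+\infty$ if and only if $\mathrm{RD}(-A)=+\infty$. Moreover, there exists $c>0$ depending on $A$ but not on $T,\mu$ such that if $\mathrm{RC}(A)>c$ or $\mathrm{RD}(A)>c$ then $$\mathrm{RC}(A)=\mathrm{RC}_{\#}(A)=\mathrm{RD}_{\#}(-A)=\mathrm{RD}(-A).$$
   Context: $M_{d,m}(\mathbb{R})$ is the set of real $d\times m$ matrices and $M_d(\mathbb{R})=M_{d,d}(\mathbb{R})$. For $T\ge\mu>0$, $\mathcal{G}(T,\mu)$ is the set of measurable $\alpha:\mathbb{R}\to[0,1]$ with $\int_t^{t+T}\alpha(s)\,ds\ge\mu$ for all $t\in\mathbb{R}$. Fix a norm $|\cdot|$ on $\mathbb{R}^d$. For $A\in M_d(\mathbb{R})$, $b\in M_{d,1}(\mathbb{R})$, $K\in M_{1,d}(\mathbb{R})$, $\alpha\in\mathcal{G}(T,\mu)$, let $x(\cdot;t_0,x_0,A,b,K,\alpha)$ be the solution of $\dot x=(A+\alpha(t)bK)x$ with value $x_0$ at time $t_0$. For $x_0\ne0$ set $\lambda^+(x_0,A,b,K,\alpha)=\limsup_{t\to+\infty}\frac1t\log|x(t;0,x_0,A,b,K,\alpha)|$, $\lambda^-(x_0,A,b,K,\alpha)=\liminf_{t\to+\infty}\frac1t\log|x(t;0,x_0,A,b,K,\alpha)|$,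 and $\Lambda^+(A,b,K,\alpha)=\sup_{x_0\ne0}\lambda^+(x_0,A,b,K,\alpha)$, $\Lambda^-(A,b,K,\alpha)=\inf_{x_0\ne0}\lambda^-(x_0,A,b,K,\alpha)$. Then $\mathrm{rc}(A,b,K)=\inf_{\alpha\in\mathcal{G}(T,\mu)}(-\Lambda^+(A,b,K,\alpha))$, $\mathrm{rd}(A,b,K)=\inf_{\alpha\in\mathcal{G}(T,\mu)}\Lambda^-(A,b,K,\alpha)$ (dependence on $T,\mu$ omitted from the notation). Let $\Pi:\mathbb{R}^d\setminus\{0\}\to\mathbb{RP}^{d-1}$ be the canonical projection. For $\alpha\in\mathcal{G}(T,\mu)$ and $x_0\neq0$, the pair $(\alpha,x_0)$ is $\#$-admissible for $A,b,K$ if there is $\tau>0$ such that both $\alpha$ and $t\mapsto\Pi x(t;0,x_0,A,b,K,\alpha)$ are $\tau$-periodic. Set $\mathrm{rc}_{\#}(A,b,K)=\inf(-\lambda^+(x_0,A,b,K,\alpha))$ and $\mathrm{rd}_{\#}(A,b,K)=\inf\lambda^-(x_0,A,b,K,\alpha)$, the infima being over all $(\alpha,x_0)$ that are $\#$-admissible for $A,b,K$. $\mathrm{RC}(A,b),\mathrm{RD}(A,b),\mathrm{RC}_{\#}(A,b),\mathrm{RD}_{\#}(A,b)$ are the suprema over $K\in M_{1,d}(\mathbb{R})$ of $\mathrm{rc},\mathrm{rd},\mathrm{rc}_{\#},\mathrm{rd}_{\#}$ at $(A,b,K)$, respectively (possibly $+\infty$). These do not depend on $b$ as long as $(A,b)$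 is controllable (all controllable single-input pairs with the same $A$ have the same controllability form); $\mathrm{RC}(A),\mathrm{RD}(A),\mathrm{RC}_{\#}(A),\mathrm{RD}_{\#}(A)$ denote their common values over such $b$. *)

theory Defs
  imports "HOL-Analysis.Analysis"
begin

definition is_norm :: "('a::real_vector \<Rightarrow> real) \<Rightarrow> bool" where
  "is_norm N \<longleftrightarrow>
     (\<forall>x. N x = 0 \<longleftrightarrow> x = 0) \<and>
     (\<forall>c x. N (c *\<^sub>R x) = \<bar>c\<bar> * N x) \<and>
     (\<forall>x y. N (x + y) \<le> N x + N y)"

text \<open>Solutions in the sense of Caratheodory on a set of times \<open>I\<close>, in integral form: for
  \<open>I\<close> an interval containing \<open>t0\<close>, this says that \<open>x\<close> is locally absolutely continuous,
  satisfies \<open>x' = F t (x t)\<close> almost everywhere, and \<open>x t0 = x0\<close>. The interval integral is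
  oriented, so times before \<open>t0\<close> are covered; it is taken over \<^const>\<open>lebesgue\<close> rather than
  \<^const>\<open>lborel\<close> because the signals are only Lebesgue measurable.\<close>

definition solves_from ::
  "(real \<Rightarrow> 'a \<Rightarrow> 'a) \<Rightarrow> real \<Rightarrow> 'a \<Rightarrow> real set \<Rightarrow> (real \<Rightarrow> 'a::euclidean_space) \<Rightarrow> bool" where
  "solves_from F t0 x0 I x \<longleftrightarrow>
     continuous_on I x \<and>
     (\<forall>t\<in>I. interval_lebesgue_integrable lebesgue (ereal t0) (ereal t) (\<lambda>s. F s (x s)) \<and>
            x t = x0 + (LINT s=ereal t0..ereal t|lebesgue. F s (x s)))"

definition controllable :: "real^'d^'d \<Rightarrow> real^1^'d \<Rightarrow> bool" where
  "controllable A b \<longleftrightarrow>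
     (\<forall>x0 x1. \<exists>S>0. \<exists>u :: real \<Rightarrow> real^1. \<exists>x.
        set_integrable lebesgue {0..S} u \<and>
        solves_from (\<lambda>t y. A *v y + b *v u t) 0 x0 {0..S} x \<and>
        x S = x1)"

definition PE :: "real \<Rightarrow> real \<Rightarrow> (real \<Rightarrow> real) set" where
  "PE T \<mu> = {\<alpha>. \<alpha> \<in> borel_measurable lebesgue \<and> (\<forall>t. 0 \<le> \<alpha> t \<and> \<alpha> t \<le> 1) \<and>
                (\<forall>t. (LINT s:{t..t+T}|lebesgue. \<alpha> s) \<ge> \<mu>)}"

text \<open>For measurable \<open>\<alpha>\<close> with values in [0,1] the description below is satisfied by exactly one
  function.\<close>

definition traj ::
  "real \<Rightarrow> real^'d \<Rightarrow> real^'d^'d \<Rightarrow> real^1^'d \<Rightarrow> real^'d^1 \<Rightarrow> (real \<Rightarrow> real) \<Rightarrow> real \<Rightarrow> real^'d" where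
  "traj t0 x0 A b K \<alpha> =
     (THE x. solves_from (\<lambda>t y. (A + \<alpha> t *\<^sub>R (b ** K)) *v y) t0 x0 UNIV x)"

text \<open>All rates are extended reals. The first argument \<open>N\<close> is the norm on the state space.\<close>

definition lambda_plus ::
  "(real^'d \<Rightarrow> real) \<Rightarrow> real^'d \<Rightarrow> real^'d^'d \<Rightarrow> real^1^'d \<Rightarrow> real^'d^1 \<Rightarrow> (real \<Rightarrow> real) \<Rightarrow> ereal" where
  "lambda_plus N x0 A b K \<alpha> = Limsup at_top (\<lambda>t. ereal (1 / t * ln (N (traj 0 x0 A b K \<alpha> t))))"

definition lambda_minus ::
  "(real^'d \<Rightarrow> real) \<Rightarrow> real^'d \<Rightarrow> real^'d^'d \<Rightarrow> real^1^'d \<Rightarrow> real^'d^1 \<Rightarrow> (real \<Rightarrow> real) \<Rightarrow> ereal" where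
  "lambda_minus N x0 A b K \<alpha> = Liminf at_top (\<lambda>t. ereal (1 / t * ln (N (traj 0 x0 A b K \<alpha> t))))"

definition Lambda_plus ::
  "(real^'d \<Rightarrow> real) \<Rightarrow> real^'d^'d \<Rightarrow> real^1^'d \<Rightarrow> real^'d^1 \<Rightarrow> (real \<Rightarrow> real) \<Rightarrow> ereal" where
  "Lambda_plus N A b K \<alpha> = (SUP x0\<in>{x0. x0 \<noteq> 0}. lambda_plus N x0 A b K \<alpha>)"

definition Lambda_minus ::
  "(real^'d \<Rightarrow> real) \<Rightarrow> real^'d^'d \<Rightarrow> real^1^'d \<Rightarrow> real^'d^1 \<Rightarrow> (real \<Rightarrow> real) \<Rightarrow> ereal" where
  "Lambda_minus N A b K \<alpha> = (INF x0\<in>{x0. x0 \<noteq> 0}. lambda_minus N x0 A b K \<alpha>)"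

definition rc ::
  "(real^'d \<Rightarrow> real) \<Rightarrow> real \<Rightarrow> real \<Rightarrow> real^'d^'d \<Rightarrow> real^1^'d \<Rightarrow> real^'d^1 \<Rightarrow> ereal" where
  "rc N T \<mu> A b K = (INF \<alpha>\<in>PE T \<mu>. - Lambda_plus N A b K \<alpha>)"

definition rd ::
  "(real^'d \<Rightarrow> real) \<Rightarrow> real \<Rightarrow> real \<Rightarrow> real^'d^'d \<Rightarrow> real^1^'d \<Rightarrow> real^'d^1 \<Rightarrow> ereal" where
  "rd N T \<mu> A b K = (INF \<alpha>\<in>PE T \<mu>. Lambda_minus N A b K \<alpha>)"

text \<open>A point of real projective space is a line through the origin; a nonzero vector is sent to
  the line it spans.\<close>

definition proj_line :: "real^'d \<Rightarrow> (real^'d) set" where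
  "proj_line x = span {x}"

definition periodic_with :: "real \<Rightarrow> (real \<Rightarrow> 'a) \<Rightarrow> bool" where
  "periodic_with \<tau> f \<longleftrightarrow> (\<forall>t. f (t + \<tau>) = f t)"

definition sharp_admissible ::
  "real \<Rightarrow> real \<Rightarrow> real^'d^'d \<Rightarrow> real^1^'d \<Rightarrow> real^'d^1 \<Rightarrow> ((real \<Rightarrow> real) \<times> (real^'d)) set" where
  "sharp_admissible T \<mu> A b K =
     {(\<alpha>, x0). \<alpha> \<in> PE T \<mu> \<and> x0 \<noteq> 0 \<and>
        (\<exists>\<tau>>0. periodic_with \<tau> \<alpha> \<and> periodic_with \<tau> (\<lambda>t. proj_line (traj 0 x0 A b K \<alpha> t)))}"

definition rc_sharp ::
  "(real^'d \<Rightarrow> real) \<Rightarrow> real \<Rightarrow> real \<Rightarrow> real^'d^'d \<Rightarrow> real^1^'d \<Rightarrow> real^'d^1 \<Rightarrow> ereal" where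
  "rc_sharp N T \<mu> A b K = (INF (\<alpha>, x0)\<in>sharp_admissible T \<mu> A b K. - lambda_plus N x0 A b K \<alpha>)"

definition rd_sharp ::
  "(real^'d \<Rightarrow> real) \<Rightarrow> real \<Rightarrow> real \<Rightarrow> real^'d^'d \<Rightarrow> real^1^'d \<Rightarrow> real^'d^1 \<Rightarrow> ereal" where
  "rd_sharp N T \<mu> A b K = (INF (\<alpha>, x0)\<in>sharp_admissible T \<mu> A b K. lambda_minus N x0 A b K \<alpha>)"

definition RC_pair :: "(real^'d \<Rightarrow> real) \<Rightarrow> real \<Rightarrow> real \<Rightarrow> real^'d^'d \<Rightarrow> real^1^'d \<Rightarrow> ereal" where
  "RC_pair N T \<mu> A b = (SUP K. rc N T \<mu> A b K)"

definition RD_pair :: "(real^'d \<Rightarrow> real) \<Rightarrow> real \<Rightarrow> real \<Rightarrow> real^'d^'d \<Rightarrow> real^1^'d \<Rightarrow> ereal" where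
  "RD_pair N T \<mu> A b = (SUP K. rd N T \<mu> A b K)"

definition RC_sharp_pair :: "(real^'d \<Rightarrow> real) \<Rightarrow> real \<Rightarrow> real \<Rightarrow> real^'d^'d \<Rightarrow> real^1^'d \<Rightarrow> ereal" where
  "RC_sharp_pair N T \<mu> A b = (SUP K. rc_sharp N T \<mu> A b K)"

definition RD_sharp_pair :: "(real^'d \<Rightarrow> real) \<Rightarrow> real \<Rightarrow> real \<Rightarrow> real^'d^'d \<Rightarrow> real^1^'d \<Rightarrow> ereal" where
  "RD_sharp_pair N T \<mu> A b = (SUP K. rd_sharp N T \<mu> A b K)"

text \<open>The common value of \<open>f b\<close> over all \<open>b\<close> with \<open>(A, b)\<close> controllable; meaningful when such a
  \<open>b\<close> exists and \<open>f\<close> takes the same value at all of them.\<close>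

definition common_value :: "real^'d^'d \<Rightarrow> (real^1^'d \<Rightarrow> ereal) \<Rightarrow> ereal" where
  "common_value A f = (THE r. \<forall>b. controllable A b \<longrightarrow> f b = r)"

definition RC :: "(real^'d \<Rightarrow> real) \<Rightarrow> real \<Rightarrow> real \<Rightarrow> real^'d^'d \<Rightarrow> ereal" where
  "RC N T \<mu> A = common_value A (RC_pair N T \<mu> A)"

definition RD :: "(real^'d \<Rightarrow> real) \<Rightarrow> real \<Rightarrow> real \<Rightarrow> real^'d^'d \<Rightarrow> ereal" where
  "RD N T \<mu> A = common_value A (RD_pair N T \<mu> A)"

definition RC_sharp :: "(real^'d \<Rightarrow> real) \<Rightarrow> real \<Rightarrow> real \<Rightarrow> real^'d^'d \<Rightarrow> ereal" where
  "RC_sharp N T \<mu> A = common_value A (RC_sharp_pair N T \<mu> A)"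

definition RD_sharp :: "(real^'d \<Rightarrow> real) \<Rightarrow> real \<Rightarrow> real \<Rightarrow> real^'d^'d \<Rightarrow> ereal" where
  "RD_sharp N T \<mu> A = common_value A (RD_sharp_pair N T \<mu> A)"

end

theory Submission
  imports Defs "HOL-Computational_Algebra.Fundamental_Theorem_Algebra"
begin

text \<open>For each feedback \<open>K\<close> separately, the four numbers \<open>rc A b K\<close>, \<open>rc_sharp A b K\<close>,
  \<open>rd_sharp (-A) b (-K)\<close> and \<open>rd (-A) b (-K)\<close> coincide: all of them are minus the exponential growth
  rate, uniform over the signals, of the transition operators of \<open>A + \<alpha> b K\<close>. If these operators are
  bounded by \<open>C exp (\<rho> t)\<close>, then all four numbers are at least \<open>-\<rho>\<close>; for \<open>rd\<close> this is time reversal.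
  The converse is a theorem of Berger-Wang type. A real eigenvector of the monodromy operator of a
  periodic signal is a sharp-admissible pair, both for the system and for its time reversal, and if
  every such eigenvalue \<open>z\<close> over a period \<open>\<tau>\<close> satisfies \<open>\<bar>z\<bar> \<le> exp (\<rho> \<tau>)\<close>, then the operators grow
  no faster than \<open>exp ((\<rho> + \<epsilon>) t)\<close>.

  On the unobservable subspace of \<open>(K, A)\<close> the flow is \<open>exp (t A)\<close>, whose growth can be read off
  complex eigenvectors. By controllability the system induced on the quotient is irreducible. Let \<open>S\<close>
  be the closed cone generated by the transition operators of signals with values in \<open>[\<mu>/T, 1]\<close>. It
  contains an operator of rank one: elements of minimal rank \<open>r\<close> form a group with bounded condition
  number, which for \<open>r \<ge> 2\<close> is incompatible with perturbations in the rank-one direction \<open>b K\<close>. Composing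
  this operator with a limit direction of fast growing transition operators gives an operator of rank
  one with a nonzero real eigenvalue. The eigenvalue persists under perturbation, by Brouwer's theorem,
  and so fast growth produces periodic signals with large real eigenvalues. When \<open>\<mu> = T\<close>, all signals
  equal 1 almost everywhere and the system is autonomous.\<close>

section \<open>Caratheodory solutions of the linear system\<close>

text \<open>Persistently exciting signals cannot be concatenated freely: a window across a junction
  may carry too little excitation, so their transition operators need not form a semigroup. Pieces
  with values in [\<mu>/T, 1] can be concatenated, and padding by 1 for a time T separates them from
  an arbitrary exciting piece; this is why the semigroup of connecting operators uses these values.
  Real eigenvalues matter because sharp admissibility asks a line to return to itself, whereas a
  nonreal eigenvalue gives a plane that may keep rotating. Operators of rank one are the device that
  makes eigenvalues real. The connecting pieces are fixed before the fast growing piece is selected,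
  so closing a signal up costs a factor independent of its length. Working on the quotient loses
  nothing: an eigenvalue found there is an eigenvalue of the full operator
  (\<open>eigenvalue_lift\<close>), and recombining the quotient with the unobservable part costs
  only a polynomial factor, which \<open>\<epsilon>\<close> absorbs.\<close>

definition signal :: "(real \<Rightarrow> real) \<Rightarrow> bool" where
  "signal \<alpha> \<longleftrightarrow> \<alpha> \<in> borel_measurable lebesgue \<and> (\<forall>t. 0 \<le> \<alpha> t \<and> \<alpha> t \<le> 1)"

definition vf :: "('a::euclidean_space \<Rightarrow>\<^sub>L 'a) \<Rightarrow> ('a \<Rightarrow>\<^sub>L 'a) \<Rightarrow> real \<Rightarrow> 'a \<Rightarrow> 'a" where
  "vf A N a v = A v + a *\<^sub>R N v"

text \<open>Increments over all subintervals replace a distinguished initial time, so that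
  restriction, translation and reversal of time act directly on solutions.\<close>

definition sol_on ::
  "('a::euclidean_space \<Rightarrow>\<^sub>L 'a) \<Rightarrow> ('a \<Rightarrow>\<^sub>L 'a) \<Rightarrow> (real \<Rightarrow> real) \<Rightarrow> real set \<Rightarrow> (real \<Rightarrow> 'a) \<Rightarrow> bool" where
  "sol_on A N \<alpha> S x \<longleftrightarrow> continuous_on S x \<and>
     (\<forall>s t. s \<le> t \<longrightarrow> {s..t} \<subseteq> S \<longrightarrow> ((\<lambda>r. vf A N (\<alpha> r) (x r)) has_integral (x t - x s)) {s..t})"

lemma signalD: "signal \<alpha> \<Longrightarrow> 0 \<le> \<alpha> t" "signal \<alpha> \<Longrightarrow> \<alpha> t \<le> 1"
  by (auto simp: signal_def)

lemma norm_vf_le: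
  assumes "signal \<alpha>"
  shows "norm (vf A N (\<alpha> t) v) \<le> (norm A + norm N) * norm v"
proof -
  have "norm (vf A N (\<alpha> t) v) \<le> norm (A v) + \<alpha> t * norm (N v)"
    unfolding vf_def using norm_triangle_ineq[of "A v" "\<alpha> t *\<^sub>R N v"] signalD[OF assms] by simp
  also have "\<dots> \<le> norm A * norm v + 1 * (norm N * norm v)"
    by (intro add_mono mult_mono norm_blinfun signalD[OF assms]) auto
  finally show ?thesis by (simp add: algebra_simps)
qed

lemma vf_linear:
  "vf A N a (u + v) = vf A N a u + vf A N a v"
  "vf A N a (c *\<^sub>R v) = c *\<^sub>R vf A N a v"
  "vf A N a (u - v) = vf A N a u - vf A N a v"
  by (auto simp: vf_def blinfun.add_right blinfun.scaleR_right blinfun.diff_right algebra_simps)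

lemma vf_absolutely_integrable:
  fixes x :: "real \<Rightarrow> 'a::euclidean_space"
  assumes \<alpha>: "signal \<alpha>" and x: "continuous_on {s..t} x"
  shows "(\<lambda>r. vf A N (\<alpha> r) (x r)) absolutely_integrable_on {s..t}"
proof -
  have Ax: "(\<lambda>r. A (x r)) absolutely_integrable_on {s..t}"
    by (intro absolutely_integrable_continuous_real continuous_intros x)
  have Nx: "(\<lambda>r. N (x r)) absolutely_integrable_on {s..t}"
    by (intro absolutely_integrable_continuous_real continuous_intros x)
  have "(\<lambda>r. \<alpha> r *\<^sub>R N (x r)) absolutely_integrable_on {s..t}"
  proof (rule absolutely_integrable_bounded_measurable_product[where h = "(*\<^sub>R)", OF _ _ _ _ Nx])
    show "bilinear ((*\<^sub>R) :: real \<Rightarrow> 'a \<Rightarrow> 'a)"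
      by (simp add: bilinear_def linear_iff scaleR_add_left scaleR_add_right)
    show "\<alpha> \<in> borel_measurable (lebesgue_on {s..t})"
      using \<alpha> measurable_restrict_space1 unfolding signal_def by blast
    show "bounded (\<alpha> ` {s..t})"
      by (rule boundedI[of _ 1]) (use signalD[OF \<alpha>] in auto)
  qed auto
  from set_integral_add(1)[OF Ax this] show ?thesis
    by (simp add: vf_def)
qed

lemma vf_integrable:
  assumes "signal \<alpha>" "continuous_on {s..t} x"
  shows "(\<lambda>r. vf A N (\<alpha> r) (x r)) integrable_on {s..t}"
  using vf_absolutely_integrable[OF assms] absolutely_integrable_on_def by blast

text \<open>Multiplied by the integrating factor \<open>exp (- L * (t - a))\<close>, the right-hand
  side of the integral inequality becomes nonincreasing.\<close>

lemma gronwall: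
  fixes u :: "real \<Rightarrow> real"
  assumes u: "continuous_on {a..b} u" and "a \<le> b" "0 \<le> L"
    and le: "\<And>t. t \<in> {a..b} \<Longrightarrow> u t \<le> C + L * integral {a..t} u"
  shows "u b \<le> C * exp (L * (b - a))"
proof -
  define \<psi> where "\<psi> t = C + L * integral {a..t} u" for t
  define g where "g t = exp (- L * (t - a)) * \<psi> t" for t
  have \<psi>': "(\<psi> has_real_derivative L * u t) (at t within {a..b})" if "t \<in> {a..b}" for t
    unfolding \<psi>_def
    using DERIV_add[OF DERIV_const[of C] DERIV_cmult[OF integral_has_real_derivative[OF u that], of L]] by simp
  have "g b \<le> g a"
  proof (rule DERIV_nonpos_imp_decreasing_open[OF \<open>a \<le> b\<close>])
    fix t assume t: "a < t" "t < b"
    have "(\<psi> has_real_derivative L * u t) (at t)"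
      using \<psi>'[of t] t at_within_Icc_at[OF t] by simp
    then have "(g has_real_derivative exp (- L * (t - a)) * (L * u t) + (exp (- L * (t - a)) * (- L)) * \<psi> t) (at t)"
      unfolding g_def by (auto intro!: derivative_eq_intros)
    moreover have "L * u t \<le> L * \<psi> t"
      using le[of t] t \<open>0 \<le> L\<close> by (intro mult_left_mono) (auto simp: \<psi>_def)
    then have "exp (- L * (t - a)) * (L * u t - L * \<psi> t) \<le> 0"
      by (intro mult_nonneg_nonpos) auto
    ultimately show "\<exists>y. DERIV g t :> y \<and> y \<le> 0"
      by (auto simp: algebra_simps)
  next
    have "continuous_on {a..b} \<psi>"
      using \<psi>' DERIV_continuous continuous_on_eq_continuous_within by blast
    then show "continuous_on {a..b} g"
      unfolding g_def by (intro continuous_intros)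
  qed
  then have "exp (- L * (b - a)) * \<psi> b \<le> C"
    by (simp add: g_def \<psi>_def)
  then have "exp (L * (b - a)) * (exp (- L * (b - a)) * \<psi> b) \<le> exp (L * (b - a)) * C"
    by (intro mult_left_mono) auto
  then have "\<psi> b \<le> C * exp (L * (b - a))"
    by (metis exp_minus_inverse mult.assoc mult.commute mult_1 mult_minus_left)
  moreover have "u b \<le> \<psi> b"
    using le[of b] \<open>a \<le> b\<close> by (simp add: \<psi>_def)
  ultimately show ?thesis by simp
qed

lemma sol_onD:
  "sol_on A N \<alpha> S x \<Longrightarrow> continuous_on S x"
  "sol_on A N \<alpha> S x \<Longrightarrow> s \<le> t \<Longrightarrow> {s..t} \<subseteq> S \<Longrightarrow>
     ((\<lambda>r. vf A N (\<alpha> r) (x r)) has_integral (x t - x s)) {s..t}"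
  by (auto simp: sol_on_def)

lemma sol_on_subset: "sol_on A N \<alpha> S x \<Longrightarrow> T \<subseteq> S \<Longrightarrow> sol_on A N \<alpha> T x"
  unfolding sol_on_def by (meson continuous_on_subset order_trans)

lemma sol_on_add:
  assumes "sol_on A N \<alpha> S x" "sol_on A N \<alpha> S y"
  shows "sol_on A N \<alpha> S (\<lambda>t. x t + y t)"
  unfolding sol_on_def
proof (intro conjI allI impI)
  show "continuous_on S (\<lambda>t. x t + y t)"
    using assms by (intro continuous_intros) (auto simp: sol_on_def)
  fix s t :: real assume st: "s \<le> t" "{s..t} \<subseteq> S"
  have "(x t - x s) + (y t - y s) = x t + y t - (x s + y s)" by simp
  with has_integral_add[OF sol_onD(2)[OF assms(1) st] sol_onD(2)[OF assms(2) st]]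
  show "((\<lambda>r. vf A N (\<alpha> r) (x r + y r)) has_integral (x t + y t - (x s + y s))) {s..t}"
    by (simp only: vf_linear)
qed

lemma sol_on_scaleR:
  assumes "sol_on A N \<alpha> S x"
  shows "sol_on A N \<alpha> S (\<lambda>t. c *\<^sub>R x t)"
  unfolding sol_on_def
proof (intro conjI allI impI)
  show "continuous_on S (\<lambda>t. c *\<^sub>R x t)"
    using assms by (intro continuous_intros) (auto simp: sol_on_def)
  fix s t :: real assume st: "s \<le> t" "{s..t} \<subseteq> S"
  from has_integral_cmul[OF sol_onD(2)[OF assms(1) st], of c]
  show "((\<lambda>r. vf A N (\<alpha> r) (c *\<^sub>R x r)) has_integral (c *\<^sub>R x t - c *\<^sub>R x s)) {s..t}"
    by (simp only: vf_linear scaleR_diff_right)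
qed

lemma sol_on_diff:
  "sol_on A N \<alpha> S x \<Longrightarrow> sol_on A N \<alpha> S y \<Longrightarrow> sol_on A N \<alpha> S (\<lambda>t. x t - y t)"
  using sol_on_add[of A N \<alpha> S x "\<lambda>t. (-1) *\<^sub>R y t"] sol_on_scaleR[of A N \<alpha> S y "-1"] by simp

lemma sol_on_cong:
  assumes "sol_on A N \<alpha> S x" "negligible Z" "\<And>t. t \<in> S - Z \<Longrightarrow> \<alpha> t = \<beta> t"
  shows "sol_on A N \<beta> S x"
  unfolding sol_on_def
proof (intro conjI allI impI)
  fix s t :: real assume st: "s \<le> t" "{s..t} \<subseteq> S"
  show "((\<lambda>r. vf A N (\<beta> r) (x r)) has_integral (x t - x s)) {s..t}"
    by (rule has_integral_spike[OF assms(2) _ sol_onD(2)[OF assms(1) st]])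
      (use st assms(3) in auto)
qed (use assms(1) in \<open>simp add: sol_on_def\<close>)

lemma sol_on_shift:
  assumes "sol_on A N \<alpha> UNIV x"
  shows "sol_on A N (\<lambda>t. \<alpha> (t + c)) UNIV (\<lambda>t. x (t + c))"
  unfolding sol_on_def
proof (intro conjI allI impI)
  show "continuous_on UNIV (\<lambda>t. x (t + c))"
    by (rule continuous_on_compose2[OF sol_onD(1)[OF assms]]) (auto intro: continuous_intros)
  fix s t :: real assume st: "s \<le> t"
  have "((\<lambda>r. vf A N (\<alpha> r) (x r)) has_integral (x (t + c) - x (s + c))) (cbox (s + c) (t + c))"
    using sol_onD(2)[OF assms, of "s + c" "t + c"] st by (simp add: box_real)
  from has_integral_affinity'[OF this, of 1 c]
  show "((\<lambda>r. vf A N (\<alpha> (r + c)) (x (r + c))) has_integral (x (t + c) - x (s + c))) {s..t}"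
    by (simp add: box_real)
qed

lemma sol_on_reverse:
  assumes "sol_on A N \<alpha> UNIV x"
  shows "sol_on (- A) (- N) (\<lambda>t. \<alpha> (- t)) UNIV (\<lambda>t. x (- t))"
  unfolding sol_on_def
proof (intro conjI allI impI)
  show "continuous_on UNIV (\<lambda>t. x (- t))"
    by (rule continuous_on_compose2[OF sol_onD(1)[OF assms]]) (auto intro: continuous_intros)
  fix s t :: real assume st: "s \<le> t"
  have "((\<lambda>r. vf A N (\<alpha> r) (x r)) has_integral (x (- s) - x (- t))) {- t..- s}"
    by (rule sol_onD(2)[OF assms]) (use st in auto)
  then have "((\<lambda>r. vf A N (\<alpha> (- r)) (x (- r))) has_integral (x (- s) - x (- t))) {s..t}"
    using has_integral_reflect_real[where f = "\<lambda>r. vf A N (\<alpha> r) (x r)" and a = "-t" and b = "-s"] by simp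
  from has_integral_neg[OF this]
  show "((\<lambda>r. vf (- A) (- N) (\<alpha> (- r)) (x (- r))) has_integral (x (- t) - x (- s))) {s..t}"
    by (simp add: vf_def blinfun.minus_left algebra_simps)
qed

lemma signal_shift: "signal \<alpha> \<Longrightarrow> signal (\<lambda>t. \<alpha> (t + c))"
  using measurable_compose[OF lebesgue_affine_measurable[where c = "\<lambda>_::real. 1" and t = c], of \<alpha> borel]
  by (simp add: signal_def add.commute)

lemma signal_reflect: "signal \<alpha> \<Longrightarrow> signal (\<lambda>t. \<alpha> (- t))"
  using measurable_compose[OF lebesgue_affine_measurable[where c = "\<lambda>_::real. -1" and t = 0], of \<alpha> borel]
  by (simp add: signal_def)

section \<open>A priori growth and uniqueness of solutions\<close>

lemma sol_on_growth:
  assumes \<alpha>: "signal \<alpha>" and x: "sol_on A N \<alpha> {s..t} x" and "s \<le> t"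
  shows "norm (x t) \<le> norm (x s) * exp ((norm A + norm N) * (t - s))"
proof (rule gronwall)
  have cx: "continuous_on {s..t} x" using x by (simp add: sol_on_def)
  then show "continuous_on {s..t} (\<lambda>r. norm (x r))" by (intro continuous_intros)
  fix r assume r: "r \<in> {s..t}"
  have cr: "continuous_on {s..r} x" using cx continuous_on_subset r by force
  have "x r - x s = integral {s..r} (\<lambda>r. vf A N (\<alpha> r) (x r))"
    using sol_onD(2)[OF x, of s r] r by (simp add: integral_unique)
  also have "norm \<dots> \<le> integral {s..r} (\<lambda>r. (norm A + norm N) * norm (x r))"
    by (intro integral_norm_bound_integral vf_integrable \<alpha> cr norm_vf_le integrable_continuous_interval continuous_intros)
  finally show "norm (x r) \<le> norm (x s) + (norm A + norm N) * integral {s..r} (\<lambda>r. norm (x r))"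
    using norm_triangle_sub[of "x r" "x s"] by simp
qed (use assms in auto)

text \<open>Times before \<open>s\<close> are reached by reversing the solution. Applied to a
  difference of two solutions, the two-sided estimate gives uniqueness on the whole line.\<close>

lemma sol_on_growth_UNIV:
  assumes \<alpha>: "signal \<alpha>" and x: "sol_on A N \<alpha> UNIV x"
  shows "norm (x t) \<le> norm (x s) * exp ((norm A + norm N) * \<bar>t - s\<bar>)"
proof (cases "s \<le> t")
  case True
  then show ?thesis using sol_on_growth[OF \<alpha> sol_on_subset[OF x]] by auto
next
  case False
  then show ?thesis
    using sol_on_growth[OF signal_reflect[OF \<alpha>] sol_on_subset[OF sol_on_reverse[OF x]], of "-s" "-t"] by auto
qed

lemma sol_on_unique:
  assumes "signal \<alpha>" "sol_on A N \<alpha> UNIV x" "sol_on A N \<alpha> UNIV y" "x s = y s"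
  shows "x = y"
proof
  fix t
  show "x t = y t"
    using sol_on_growth_UNIV[OF assms(1) sol_on_diff[OF assms(2,3)], of t s] assms(4) by simp
qed

lemma sol_on_local_unique:
  assumes "signal \<alpha>" "sol_on A N \<alpha> {s..t} x" "sol_on A N \<alpha> {s..t} y" "x s = y s" "s \<le> t"
  shows "x t = y t"
  using sol_on_growth[OF assms(1) sol_on_diff[OF assms(2,3)]] assms(4,5) by simp

section \<open>Global existence by contraction in a weighted norm\<close>

definition oint :: "(real \<Rightarrow> 'a::euclidean_space) \<Rightarrow> real \<Rightarrow> 'a" where
  "oint f t = integral {0..t} f - integral {t..0} f"

lemma oint_diff:
  assumes int: "\<And>s t. f integrable_on {s..t}" and "s \<le> t"
  shows "oint f t - oint f s = integral {s..t} f"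
proof -
  have c: "integral {a..c} f + integral {c..b} f = integral {a..b} f" if "a \<le> c" "c \<le> b" for a b c
    using Henstock_Kurzweil_Integration.integral_combine[OF that int] .
  \<comment> \<open>Integrals over empty or one-point intervals are 0, so at most one of the two
    terms of \<open>oint\<close> survives.\<close>
  have z: "integral {a..b} f = 0" if "b \<le> a" for a b
    using that by (cases "a = b") auto
  consider "0 \<le> s" | "s \<le> 0" "0 \<le> t" | "t \<le> 0" by linarith
  then show ?thesis
  proof cases
    case 1
    then show ?thesis using c[of 0 s t] z[of 0 s] z[of 0 t] \<open>s \<le> t\<close> by (simp add: oint_def algebra_simps)
  next
    case 2
    then show ?thesis using c[of s 0 t] z[of 0 t] z[of s 0] \<open>s \<le> t\<close> by (simp add: oint_def algebra_simps)
  next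
    case 3
    then show ?thesis using c[of s t 0] z[of s 0] z[of t 0] \<open>s \<le> t\<close> by (simp add: oint_def algebra_simps)
  qed
qed

text \<open>Integrating the weight \<open>exp (M * \<bar>s\<bar>)\<close> reproduces it with a gain
  of 1/M; this gain is the contraction factor of the Picard map in
  \<open>sol_on_exists\<close>.\<close>

lemma oint_bound:
  assumes int: "\<And>s t. f integrable_on {s..t}" and "M > 0" "C \<ge> 0"
    and le: "\<And>s. norm (f s) \<le> C * exp (M * \<bar>s\<bar>)"
  shows "norm (oint f t) \<le> C / M * exp (M * \<bar>t\<bar>)"
proof (cases "0 \<le> t")
  case True
  have I: "((\<lambda>s. C * exp (M * s)) has_integral (C / M * exp (M * t) - C / M * exp (M * 0))) {0..t}"
    by (rule fundamental_theorem_of_calculus[OF True])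
      (use \<open>M > 0\<close> in \<open>auto intro!: derivative_eq_intros simp flip: has_real_derivative_iff_has_vector_derivative\<close>)
  have "norm (integral {0..t} f) \<le> integral {0..t} (\<lambda>s. C * exp (M * s))"
    by (intro integral_norm_bound_integral int has_integral_integrable[OF I])
      (use le abs_of_nonneg in \<open>metis atLeastAtMost_iff\<close>)
  also have "\<dots> \<le> C / M * exp (M * t)"
    using integral_unique[OF I] assms by simp
  finally show ?thesis using True by (cases "t = 0") (auto simp: oint_def)
next
  case False
  then have t: "t \<le> 0" by simp
  have I: "((\<lambda>s. C * exp (- M * s)) has_integral (- C / M * exp (- M * 0) - - C / M * exp (- M * t))) {t..0}"
    by (rule fundamental_theorem_of_calculus[OF t])
      (use \<open>M > 0\<close> in \<open>auto intro!: derivative_eq_intros simp flip: has_real_derivative_iff_has_vector_derivative\<close>)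
  have "norm (integral {t..0} f) \<le> integral {t..0} (\<lambda>s. C * exp (- M * s))"
  proof (intro integral_norm_bound_integral int has_integral_integrable[OF I])
    show "norm (f s) \<le> C * exp (- M * s)" if "s \<in> {t..0}" for s
      using le[of s] that by (simp add: abs_of_nonpos)
  qed
  also have "\<dots> \<le> C / M * exp (- M * t)"
    using integral_unique[OF I] assms by simp
  finally show ?thesis using False by (auto simp: oint_def)
qed

text \<open>In the norm weighted by \<open>exp (- M * \<bar>t\<bar>)\<close> the Picard map
  contracts on the whole line at once, so no local solutions have to be glued. The unknown is the
  bounded continuous function \<open>z\<close> with solution \<open>X z\<close>, which makes the
  type of bounded continuous functions the complete space.\<close>

lemma sol_on_exists:
  fixes A N :: "'a::euclidean_space \<Rightarrow>\<^sub>L 'a"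
  assumes \<alpha>: "signal \<alpha>"
  shows "\<exists>x. sol_on A N \<alpha> UNIV x \<and> x 0 = x0"
proof -
  define L where "L = norm A + norm N"
  \<comment> \<open>The Lipschitz constant of the Picard map is L / M, hence at most 1/2; the
    summand 1 keeps \<open>M\<close> positive when \<open>A\<close> and \<open>N\<close>
    vanish.\<close>
  define M where "M = 2 * (L + 1)"
  have L: "L \<ge> 0" and M: "M > 0" by (auto simp: L_def M_def add_nonneg_pos)
  define X where "X z s = exp (M * \<bar>s\<bar>) *\<^sub>R apply_bcontfun z s" for z :: "real \<Rightarrow>\<^sub>C 'a" and s
  define F where "F z s = vf A N (\<alpha> s) (X z s)" for z s
  define G where "G z t = exp (- M * \<bar>t\<bar>) *\<^sub>R (x0 + oint (F z) t)" for z t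
  have cX: "continuous_on S (X z)" for S z
    unfolding X_def by (intro continuous_intros continuous_on_apply_bcontfun)
  have iF: "F z integrable_on {s..t}" for z s t
    unfolding F_def by (rule vf_integrable[OF \<alpha> cX])
  have lin: "F z s - F y s = F (z - y) s" for z y s
    by (simp add: F_def X_def vf_linear[symmetric] scaleR_diff_right)
  have bF: "norm (F z s) \<le> (L * norm z) * exp (M * \<bar>s\<bar>)" for z s
  proof -
    have "norm (F z s) \<le> L * norm (X z s)"
      unfolding F_def L_def by (rule norm_vf_le[OF \<alpha>])
    also have "norm (X z s) \<le> norm z * exp (M * \<bar>s\<bar>)"
      using norm_bounded[of z s] by (simp add: X_def mult.commute)
    finally show ?thesis using L by (simp add: mult_left_mono mult.assoc)
  qed
  have bo: "norm (oint (F z) t) \<le> (L * norm z) / M * exp (M * \<bar>t\<bar>)" for z t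
    by (rule oint_bound[OF iF M _ bF]) (simp add: L)
  have co: "continuous_on UNIV (oint (F z))" for z
  proof -
    have "isCont (oint (F z)) t" for t
    proof -
      define n where "n = \<bar>t\<bar> + 1"
      have eq: "oint (F z) s = oint (F z) (-n) + integral {-n..s} (F z)" if "s \<in> {-n..n}" for s
        using oint_diff[of "F z" "-n" s] iF that by (simp add: algebra_simps)
      have "continuous_on {-n..n} (\<lambda>s. oint (F z) (-n) + integral {-n..s} (F z))"
        by (intro continuous_intros indefinite_integral_continuous_1 iF)
      then have "continuous_on {-n..n} (oint (F z))"
        using eq by (metis (no_types, lifting) continuous_on_cong)
      then show ?thesis
        by (rule continuous_on_interior) (simp add: n_def interior_atLeastAtMost_real abs_less_iff, linarith)
    qed
    then show ?thesis by (simp add: continuous_at_imp_continuous_on)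
  qed
  have Gb: "G z \<in> bcontfun" for z
  proof (rule bcontfun_normI)
    show "continuous_on UNIV (G z)"
      unfolding G_def by (intro continuous_intros co)
    fix t
    have "norm (x0 + oint (F z) t) \<le> norm x0 + (L * norm z) / M * exp (M * \<bar>t\<bar>)"
      using norm_triangle_ineq[of x0 "oint (F z) t"] bo[of z t] by simp
    then have "norm (G z t) \<le> exp (- M * \<bar>t\<bar>) * (norm x0 + (L * norm z) / M * exp (M * \<bar>t\<bar>))"
      by (simp add: G_def)
    also have "\<dots> = exp (- M * \<bar>t\<bar>) * norm x0 + (L * norm z) / M"
      by (simp add: algebra_simps exp_minus)
    also have "exp (- M * \<bar>t\<bar>) * norm x0 \<le> 1 * norm x0"
      using M by (intro mult_right_mono) auto
    finally show "norm (G z t) \<le> norm x0 + (L * norm z) / M" by simp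
  qed
  define T where "T z = Bcontfun (G z)" for z
  have T: "apply_bcontfun (T z) = G z" for z
    unfolding T_def by (rule Bcontfun_inverse[OF Gb])
  have "\<exists>!z. T z = z"
  proof (rule banach_fix_type[of "1/2"])
    show "\<forall>z y. dist (T z) (T y) \<le> 1/2 * dist z y"
    proof (intro allI)
      fix z y
      have o: "oint (F z) t - oint (F y) t = oint (F (z - y)) t" for t
        unfolding oint_def lin[symmetric]
        by (simp add: Henstock_Kurzweil_Integration.integral_diff[OF iF iF])
      have "norm (T z - T y) \<le> (L * norm (z - y)) / M"
      proof (rule norm_bound)
        fix t
        have "norm (apply_bcontfun (T z - T y) t) = exp (- M * \<bar>t\<bar>) * norm (oint (F (z - y)) t)"
          by (simp add: T G_def minus_bcontfun.rep_eq scaleR_diff_right[symmetric] o)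
        also have "\<dots> \<le> exp (- M * \<bar>t\<bar>) * ((L * norm (z - y)) / M * exp (M * \<bar>t\<bar>))"
          by (intro mult_left_mono bo) auto
        also have "\<dots> = (L * norm (z - y)) / M"
          by (simp add: exp_minus)
        finally show "norm (apply_bcontfun (T z - T y) t) \<le> (L * norm (z - y)) / M" .
      qed
      also have "\<dots> = L / M * norm (z - y)" by simp
      also have "\<dots> \<le> 1/2 * norm (z - y)"
        using L by (intro mult_right_mono) (auto simp: M_def field_simps)
      finally show "dist (T z) (T y) \<le> 1/2 * dist z y" by (simp add: dist_norm)
    qed
  qed auto
  then obtain z where z: "T z = z" by blast
  have X: "X z t = x0 + oint (F z) t" for t
  proof -
    have "X z t = exp (M * \<bar>t\<bar>) *\<^sub>R G z t"
      unfolding X_def using T[of z] z by simp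
    then show ?thesis by (simp add: G_def exp_minus)
  qed
  show ?thesis
  proof (intro exI conjI)
    show "sol_on A N \<alpha> UNIV (X z)"
      unfolding sol_on_def
    proof (intro conjI allI impI cX)
      fix s t :: real assume "s \<le> t"
      then have "X z t - X z s = integral {s..t} (F z)"
        using oint_diff[of "F z" s t] iF by (simp add: X)
      then show "((\<lambda>r. vf A N (\<alpha> r) (X z r)) has_integral (X z t - X z s)) {s..t}"
        using iF[of z s t] by (simp add: F_def[abs_def] integrable_integral)
    qed
    show "X z 0 = x0" by (simp add: X oint_def)
  qed
qed

section \<open>Transition operators and their cocycle property\<close>

definition flow :: "('a::euclidean_space \<Rightarrow>\<^sub>L 'a) \<Rightarrow> ('a \<Rightarrow>\<^sub>L 'a) \<Rightarrow> (real \<Rightarrow> real) \<Rightarrow> real \<Rightarrow> 'a \<Rightarrow>\<^sub>L 'a" where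
  "flow A N \<alpha> t = Blinfun (\<lambda>x0. (THE x. sol_on A N \<alpha> UNIV x \<and> x 0 = x0) t)"

lemma sol_flow:
  assumes \<alpha>: "signal \<alpha>"
  shows "sol_on A N \<alpha> UNIV (\<lambda>t. flow A N \<alpha> t x0)" "flow A N \<alpha> 0 x0 = x0"
proof -
  define X where "X x0 = (THE x. sol_on A N \<alpha> UNIV x \<and> x 0 = x0)" for x0
  have X: "sol_on A N \<alpha> UNIV (X x0) \<and> X x0 0 = x0" for x0
  proof -
    obtain x where "sol_on A N \<alpha> UNIV x" "x 0 = x0" using sol_on_exists[OF \<alpha>] by metis
    then have "\<exists>!x. sol_on A N \<alpha> UNIV x \<and> x 0 = x0"
      by (intro ex1I[of _ x]) (auto intro: sol_on_unique[OF \<alpha>, where s = 0])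
    from theI'[OF this] show ?thesis by (simp add: X_def)
  qed
  have "bounded_linear (\<lambda>x0. X x0 t)" for t
  proof (rule bounded_linear_intro)
    fix u v :: 'a and c :: real
    have "X (u + v) = (\<lambda>t. X u t + X v t)"
      by (rule sol_on_unique[OF \<alpha>, where s = 0]) (use X in \<open>auto intro!: sol_on_add\<close>)
    then show "X (u + v) t = X u t + X v t" by simp
    have "X (c *\<^sub>R u) = (\<lambda>t. c *\<^sub>R X u t)"
      by (rule sol_on_unique[OF \<alpha>, where s = 0]) (use X in \<open>auto intro!: sol_on_scaleR\<close>)
    then show "X (c *\<^sub>R u) t = c *\<^sub>R X u t" by simp
    show "norm (X u t) \<le> norm u * exp ((norm A + norm N) * \<bar>t - 0\<bar>)"
      using sol_on_growth_UNIV[OF \<alpha>, of A N "X u" t 0] X by simp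
  qed
  then have "flow A N \<alpha> t x0 = X x0 t" for t x0
    unfolding flow_def X_def[symmetric] by (simp add: bounded_linear_Blinfun_apply)
  with X show "sol_on A N \<alpha> UNIV (\<lambda>t. flow A N \<alpha> t x0)" "flow A N \<alpha> 0 x0 = x0" by simp_all
qed

lemma flow_eqI:
  assumes "signal \<alpha>" "sol_on A N \<alpha> UNIV x" "x 0 = x0"
  shows "x t = flow A N \<alpha> t x0"
  using sol_on_unique[OF assms(1,2) sol_flow(1)[OF assms(1)], of 0 x0] sol_flow(2)[OF assms(1)] assms(3)
  by (metis (no_types, lifting))

lemma flow_0: "signal \<alpha> \<Longrightarrow> flow A N \<alpha> 0 = id_blinfun"
  by (auto intro!: blinfun_eqI simp: sol_flow)

text \<open>After time \<open>s\<close> the solution restarts under the translated signal, and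
  uniqueness identifies the two. The translate on the left factor is why later bounds must be
  uniform over a translation invariant class of signals.\<close>

lemma flow_add:
  assumes \<alpha>: "signal \<alpha>"
  shows "flow A N \<alpha> (s + t) = flow A N (\<lambda>r. \<alpha> (r + s)) t o\<^sub>L flow A N \<alpha> s"
proof (rule blinfun_eqI)
  fix x0
  show "flow A N \<alpha> (s + t) x0 = (flow A N (\<lambda>r. \<alpha> (r + s)) t o\<^sub>L flow A N \<alpha> s) x0"
  proof -
    have "sol_on A N (\<lambda>r. \<alpha> (r + s)) UNIV (\<lambda>t. flow A N \<alpha> (t + s) x0)"
      by (rule sol_on_shift[OF sol_flow(1)[OF \<alpha>]])
    from flow_eqI[OF signal_shift[OF \<alpha>] this, of _ t] show ?thesis
      by (simp add: add.commute)
  qed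
qed

text \<open>Local uniqueness on [0, t]. This is what permits cutting and gluing signals and passing
  to Borel versions.\<close>

lemma flow_cong:
  assumes \<alpha>: "signal \<alpha>" and \<beta>: "signal \<beta>" and Z: "negligible Z" and "0 \<le> t"
    and eq: "\<And>r. r \<in> {0..t} - Z \<Longrightarrow> \<alpha> r = \<beta> r"
  shows "flow A N \<alpha> t = flow A N \<beta> t"
proof (rule blinfun_eqI)
  fix x0
  have "sol_on A N \<beta> {0..t} (\<lambda>t. flow A N \<alpha> t x0)"
    by (rule sol_on_cong[OF sol_on_subset[OF sol_flow(1)[OF \<alpha>]] Z eq]) auto
  then show "flow A N \<alpha> t x0 = flow A N \<beta> t x0"
    by (rule sol_on_local_unique[OF \<beta> _ sol_on_subset[OF sol_flow(1)[OF \<beta>]]])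
      (use \<open>0 \<le> t\<close> in \<open>auto simp: sol_flow \<alpha> \<beta>\<close>)
qed

text \<open>The source of the duality between convergence for \<open>A\<close> and divergence for
  \<open>- A\<close>: reversal changes the sign of both generators and reflects the signal.\<close>

lemma flow_reverse:
  assumes \<alpha>: "signal \<alpha>"
  shows "flow (- A) (- N) (\<lambda>r. \<alpha> (- r)) t = flow A N \<alpha> (- t)"
proof (rule blinfun_eqI)
  fix x0
  show "flow (- A) (- N) (\<lambda>r. \<alpha> (- r)) t x0 = flow A N \<alpha> (- t) x0"
    using flow_eqI[OF signal_reflect[OF \<alpha>] sol_on_reverse[OF sol_flow(1)[OF \<alpha>]], of A N x0]
    by (simp add: sol_flow[OF \<alpha>])
qed

lemma norm_flow_le:
  assumes "signal \<alpha>"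
  shows "norm (flow A N \<alpha> t) \<le> exp ((norm A + norm N) * \<bar>t\<bar>)"
  using sol_on_growth_UNIV[OF assms sol_flow(1)[OF assms], where t = t and s = 0]
  by (intro norm_blinfun_bound) (auto simp: sol_flow[OF assms] mult.commute)

lemma flow_inverse:
  assumes \<alpha>: "signal \<alpha>"
  shows "flow A N (\<lambda>r. \<alpha> (r + t)) (- t) o\<^sub>L flow A N \<alpha> t = id_blinfun"
  using flow_add[OF \<alpha>, of A N t "- t"] flow_0[OF \<alpha>, of A N] by simp

lemma flow_nonzero:
  assumes "signal \<alpha>" "x \<noteq> 0"
  shows "flow A N \<alpha> t x \<noteq> 0"
  using flow_inverse[OF assms(1), of A N t] assms(2)
  by (metis blinfun.zero_right blinfun_apply_blinfun_compose blinfun_apply_id_blinfun id_apply)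

lemma flow_ode:
  assumes c: "0 \<le> c" "c \<le> 1"
  shows "((\<lambda>t. flow A N (\<lambda>_. c) t x) has_vector_derivative (A + c *\<^sub>R N) (flow A N (\<lambda>_. c) t x)) (at t)"
proof -
  let ?x = "\<lambda>t. flow A N (\<lambda>_. c) t x"
  have s: "signal (\<lambda>_. c)" using c by (simp add: signal_def)
  note x = sol_flow(1)[OF s, of A N x]
  let ?f = "\<lambda>r. (A + c *\<^sub>R N) (?x r)"
  have cf: "continuous_on S ?f" for S
    by (intro continuous_intros continuous_on_subset[OF sol_onD(1)[OF x]]) auto
  have eq: "?x (t - 1) + integral {t - 1..r} ?f = ?x r" if "r \<in> {t - 1..t + 1}" for r
    using integral_unique[OF sol_onD(2)[OF x, of "t - 1" r]] that
    by (simp add: vf_def blinfun.add_left blinfun.scaleR_left)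
  have "((\<lambda>r. ?x (t - 1) + integral {t - 1..r} ?f) has_vector_derivative 0 + ?f t) (at t within {t - 1..t + 1})"
    by (intro has_vector_derivative_add has_vector_derivative_const integral_has_vector_derivative cf) auto
  then have "(?x has_vector_derivative 0 + ?f t) (at t within {t - 1..t + 1})"
    by (rule has_vector_derivative_transform[rotated 2]) (use eq in auto)
  then show ?thesis by (simp add: at_within_Icc_at)
qed

lemma flow_constI:
  fixes A N :: "'a::euclidean_space \<Rightarrow>\<^sub>L 'a"
  assumes c: "0 \<le> c" "c \<le> 1" and x: "\<And>t. (x has_vector_derivative (A + c *\<^sub>R N) (x t)) (at t)"
  shows "x t = flow A N (\<lambda>_. c) t (x 0)"
proof (rule flow_eqI)
  show "sol_on A N (\<lambda>_. c) UNIV x"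
    unfolding sol_on_def
  proof (intro conjI allI impI)
    show "continuous_on UNIV x"
      using x has_vector_derivative_continuous continuous_at_imp_continuous_on by blast
    fix s t :: real assume "s \<le> t"
    have "((\<lambda>r. (A + c *\<^sub>R N) (x r)) has_integral (x t - x s)) {s..t}"
      by (rule fundamental_theorem_of_calculus[OF \<open>s \<le> t\<close>]) (use x has_vector_derivative_at_within in blast)
    then show "((\<lambda>r. vf A N c (x r)) has_integral (x t - x s)) {s..t}"
      by (simp add: vf_def blinfun.add_left blinfun.scaleR_left)
  qed
qed (use c in \<open>auto simp: signal_def\<close>)

section \<open>Groups of operators of minimal rank\<close>

lemma linear_blinfun: "linear (blinfun_apply X)"
  by (simp add: blinfun.bounded_linear_right bounded_linear.linear)

lemma subspace_range: "subspace (range (blinfun_apply X))"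
  using linear_subspace_image[OF linear_blinfun subspace_UNIV] by blast

lemma linear_surj_on_subspace_imp_inj_on:
  fixes f :: "'a::euclidean_space \<Rightarrow> 'a"
  assumes f: "linear f" and E: "subspace E" and surj: "f ` E = E"
  shows "inj_on f E"
proof -
  obtain B where B: "B \<subseteq> E" "independent B" "E \<subseteq> span B" "card B = dim E"
    using basis_exists by blast
  have fB: "finite B" using B(2) independent_imp_finite by blast
  have sB: "span B = E" using B E by (simp add: span_minimal subset_antisym)
  have sub: "f ` B \<subseteq> E" using B(1) surj by blast
  have sp: "E \<subseteq> span (f ` B)"
    using linear_span_image[OF f, of B] sB surj by simp
  have le: "card (f ` B) \<le> dim E"
    using card_image_le[OF fB, of f] B(4) by simp
  have ind: "independent (f ` B)"
    by (rule card_le_dim_spanning[OF sub sp _ le]) (use fB in simp)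
  have "card (f ` B) = card B"
    using dim_eq_card_independent[OF ind] B(4) sub sp E
    by (metis dim_span span_minimal subset_antisym)
  then have "inj_on f B" by (rule eq_card_imp_inj_on[OF fB])
  then have "inj_on f (span B)"
    using linear_inj_on_span_independent_image[OF f ind] by blast
  then show ?thesis by (simp add: sB)
qed

text \<open>\<open>P\<close> is the identity minus a projection onto \<open>V\<close>, so it models
  the quotient map by \<open>V\<close> without leaving the space.\<close>

lemma subspace_projection_exists:
  fixes V :: "'a::euclidean_space set"
  assumes "subspace V"
  obtains P :: "'a \<Rightarrow>\<^sub>L 'a" where "\<And>x. P x = 0 \<longleftrightarrow> x \<in> V" "P o\<^sub>L P = P"
proof -
  obtain g where g: "range g \<subseteq> V" "linear g" "\<And>v. v \<in> V \<Longrightarrow> g v = (v::'a)"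
    using linear_exists_left_inverse_on[OF linear_id assms] by auto
  define P where "P = Blinfun (\<lambda>x. x - g x)"
  have "bounded_linear (\<lambda>x. x - g x)"
    using g(2) by (simp add: bounded_linear_sub linear_conv_bounded_linear)
  then have P: "P x = x - g x" for x
    by (simp add: P_def bounded_linear_Blinfun_apply)
  show ?thesis
  proof
    show "P x = 0 \<longleftrightarrow> x \<in> V" for x
      using g(1,3) by (metis P rangeI right_minus_eq subset_iff)
    have "g (x - g x) = 0" for x
      using g by (metis linear_diff rangeI right_minus_eq subset_iff)
    then show "P o\<^sub>L P = P"
      by (auto intro!: blinfun_eqI simp: P)
  qed
qed

lemma DERIV_zero_of_quadratic_bound:
  fixes f :: "real \<Rightarrow> real"
  assumes "\<delta> > 0" and le: "\<And>h. \<bar>h\<bar> < \<delta> \<Longrightarrow> \<bar>f (s + h) - f s\<bar> \<le> K * h\<^sup>2"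
  shows "DERIV f s :> 0"
  unfolding DERIV_def
proof (rule Lim_null_comparison)
  show "\<forall>\<^sub>F h in at 0. norm ((f (s + h) - f s) / h) \<le> \<bar>K\<bar> * \<bar>h\<bar>"
    unfolding eventually_at
  proof (intro exI conjI ballI impI)
    fix h :: real assume h: "h \<noteq> 0 \<and> dist h 0 < \<delta>"
    then have "\<bar>f (s + h) - f s\<bar> \<le> K * h\<^sup>2" by (intro le) simp
    also have "\<dots> \<le> \<bar>K\<bar> * h\<^sup>2" by (intro mult_right_mono) auto
    finally show "norm ((f (s + h) - f s) / h) \<le> \<bar>K\<bar> * \<bar>h\<bar>"
      using h by (simp add: field_simps power2_eq_square abs_mult)
  qed (use \<open>\<delta> > 0\<close> in auto)
  show "((\<lambda>h. \<bar>K\<bar> * \<bar>h\<bar>) \<longlongrightarrow> 0) (at 0)"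
    by (rule tendsto_eq_intros | simp)+
qed

text \<open>Minimality turns the condition that the square of \<open>M\<close> is nonzero into the
  statement that \<open>M\<close> maps its range onto itself; the range is then a complement of the
  kernel.\<close>

locale minimal_rank =
  fixes S :: "('a::euclidean_space \<Rightarrow>\<^sub>L 'a) set" and M :: "'a \<Rightarrow>\<^sub>L 'a"
  assumes comp: "X \<in> S \<Longrightarrow> Y \<in> S \<Longrightarrow> X o\<^sub>L Y \<in> S"
    and scale: "X \<in> S \<Longrightarrow> c *\<^sub>R X \<in> S"
    and closed: "closed S"
    and M: "M \<in> S" "M o\<^sub>L M \<noteq> 0"
    and rank_min: "X \<in> S \<Longrightarrow> X \<noteq> 0 \<Longrightarrow> dim (range (blinfun_apply M)) \<le> dim (range (blinfun_apply X))"
begin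

definition E where "E = range (blinfun_apply M)"

text \<open>Inclusions suffice, since minimal rank turns them into equality with the range and the
  kernel of \<open>M\<close>. On \<open>E\<close> these elements act invertibly, and
  \<open>D_inverse\<close> shows that they act as a group.\<close>

definition D where "D = {X \<in> S. X \<noteq> 0 \<and> range (blinfun_apply X) \<subseteq> E \<and> (\<forall>x. M x = 0 \<longrightarrow> X x = 0)}"

lemma subspace_E: "subspace E"
  unfolding E_def by (rule subspace_range)

lemma range_eq_E:
  assumes "X \<in> S" "X \<noteq> 0" "range (blinfun_apply X) \<subseteq> E"
  shows "range (blinfun_apply X) = E"
  by (rule subspace_dim_equal[OF subspace_range subspace_E assms(3)])
    (use rank_min[OF assms(1,2)] in \<open>simp add: E_def\<close>)

lemma M_image_E: "blinfun_apply M ` E = E"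
proof -
  have "range (blinfun_apply (M o\<^sub>L M)) = E"
    by (rule range_eq_E) (use M comp in \<open>auto simp: E_def\<close>)
  then show ?thesis by (auto simp: E_def image_def)
qed

lemma D_image_E:
  assumes X: "X \<in> D"
  shows "blinfun_apply X ` E = E"
proof -
  have "range (blinfun_apply X) \<subseteq> blinfun_apply X ` E"
  proof
    fix y assume "y \<in> range (blinfun_apply X)"
    then obtain x where y: "y = X x" by blast
    have "M x \<in> blinfun_apply M ` E" unfolding M_image_E by (simp add: E_def)
    then obtain e where e: "e \<in> E" "M x = M e" by blast
    then have "M (x - e) = 0" by (simp add: blinfun.diff_right)
    then have "X (x - e) = 0" using X by (auto simp: D_def)
    then have "X x = X e" by (simp add: blinfun.diff_right)
    then show "y \<in> blinfun_apply X ` E" using e y by blast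
  qed
  moreover have "range (blinfun_apply X) = E"
    using X by (intro range_eq_E) (auto simp: D_def)
  ultimately show ?thesis by blast
qed

lemma D_inj: "X \<in> D \<Longrightarrow> inj_on (blinfun_apply X) E"
  by (rule linear_surj_on_subspace_imp_inj_on[OF linear_blinfun subspace_E D_image_E])

lemma D_nonzero: "X \<in> D \<Longrightarrow> x \<in> E \<Longrightarrow> x \<noteq> 0 \<Longrightarrow> X x \<noteq> 0"
  using D_inj subspace_0[OF subspace_E] by (metis blinfun.zero_right inj_onD)

lemma D_comp: assumes "X \<in> D" "Y \<in> D" shows "X o\<^sub>L Y \<in> D"
proof -
  obtain x where x: "Y x \<noteq> 0" using assms(2) unfolding D_def by (metis (mono_tags, lifting) blinfun.zero_left blinfun_eqI mem_Collect_eq)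
  have "Y x \<in> E" using assms(2) by (auto simp: D_def)
  then have "X (Y x) \<noteq> 0" using D_nonzero[OF assms(1)] x by blast
  then have "(X o\<^sub>L Y) x \<noteq> 0" by simp
  then have "X o\<^sub>L Y \<noteq> 0" by (metis blinfun.zero_left)
  then show ?thesis using assms comp by (auto simp: D_def)
qed

lemma D_scale: "X \<in> D \<Longrightarrow> c \<noteq> 0 \<Longrightarrow> c *\<^sub>R X \<in> D"
  using scale subspace_scale[OF subspace_E]
  by (auto simp: D_def blinfun.scaleR_left image_subset_iff)

lemma M_in_D: "M \<in> D"
  using M by (auto simp: D_def E_def)

lemma D_limit:
  assumes X: "\<And>n. X n \<in> D" "X \<longlonglongrightarrow> Z" and Z: "Z \<noteq> 0"
  shows "Z \<in> D"
proof -
  have lim: "(\<lambda>n. X n x) \<longlonglongrightarrow> Z x" for x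
    using X(2) by (intro tendsto_intros)
  have "Z \<in> S" using closed_sequentially[OF closed _ X(2)] X(1) by (auto simp: D_def)
  moreover have "Z x \<in> E" for x
    using closed_sequentially[OF closed_subspace[OF subspace_E] _ lim[of x]] X(1) by (auto simp: D_def)
  moreover have "Z x = 0" if "M x = 0" for x
    using lim[of x] X(1) that LIMSEQ_unique[OF _ tendsto_const] by (auto simp: D_def)
  ultimately show ?thesis using Z by (auto simp: D_def)
qed

text \<open>Compactness: the elements of norm 1 in \<open>D\<close> form a closed set because a
  limit of norm 1 is nonzero, and no element of \<open>D\<close> kills a unit vector of
  \<open>E\<close>. The minimum \<open>m\<close> over both spheres bounds all condition numbers at
  once.\<close>

lemma D_lower_bound:
  obtains m where "m > 0" "\<And>X y. X \<in> D \<Longrightarrow> y \<in> E \<Longrightarrow> m * norm X * norm y \<le> norm (X y)"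
proof -
  define C where "C = {X \<in> D. norm X = 1} \<times> {y \<in> E. norm y = 1}"
  have "closed {X \<in> D. norm X = 1}"
    unfolding closed_sequential_limits
  proof (intro allI impI, elim conjE)
    fix X Z assume X: "\<forall>n. X n \<in> {X \<in> D. norm X = 1}" "X \<longlonglongrightarrow> Z"
    from tendsto_norm[OF X(2)] X(1) have "norm Z = 1"
      using LIMSEQ_unique[of "\<lambda>n. 1::real"] by auto
    moreover then have "Z \<noteq> 0" by auto
    ultimately show "Z \<in> {X \<in> D. norm X = 1}"
      using D_limit[of X Z] X by auto
  qed
  moreover have "bounded {X \<in> D. norm X = 1}"
    by (rule boundedI[of _ 1]) auto
  ultimately have c1: "compact {X \<in> D. norm X = 1}" by (simp add: compact_eq_bounded_closed)
  have "compact (E \<inter> sphere 0 1)"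
    using closed_subspace[OF subspace_E] by (simp add: closed_Int_compact)
  then have c2: "compact {y \<in> E. norm y = 1}"
    by (simp add: sphere_def Int_def)
  have cC: "compact C" unfolding C_def by (rule compact_Times[OF c1 c2])
  have cont: "continuous_on C (\<lambda>p. norm (blinfun_apply (fst p) (snd p)))"
    by (intro continuous_intros)
  have "\<exists>m>0. \<forall>p\<in>C. m \<le> norm (blinfun_apply (fst p) (snd p))"
  proof (cases "C = {}")
    case False
    from continuous_attains_inf[OF cC False cont] obtain p where p: "p \<in> C"
      "\<forall>q\<in>C. norm (blinfun_apply (fst p) (snd p)) \<le> norm (blinfun_apply (fst q) (snd q))" by blast
    then have "snd p \<noteq> 0" "fst p \<in> D" "snd p \<in> E" by (auto simp: C_def)
    then have "norm (blinfun_apply (fst p) (snd p)) > 0" using D_nonzero by simp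
    with p show ?thesis by blast
  qed (auto intro: exI[of _ 1])
  then obtain m where m: "m > 0" "\<And>X y. (X, y) \<in> C \<Longrightarrow> m \<le> norm (X y)"
    by fastforce
  show ?thesis
  proof (rule that[OF m(1)])
    fix X y assume X: "X \<in> D" and y: "y \<in> E"
    show "m * norm X * norm y \<le> norm (X y)"
    proof (cases "y = 0")
      case False
      have X0: "X \<noteq> 0" using X by (simp add: D_def)
      have "((1 / norm X) *\<^sub>R X, (1 / norm y) *\<^sub>R y) \<in> C"
        using X0 False D_scale[OF X, of "1 / norm X"] subspace_scale[OF subspace_E y]
        by (auto simp: C_def)
      from m(2)[OF this] show ?thesis
        using X0 False by (simp add: blinfun.scaleR_left blinfun.scaleR_right field_simps)
    qed auto
  qed
qed

text \<open>The inverse is found among limits of normalised powers. If two powers of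
  \<open>X\<close> have nearly the same direction \<open>Z\<close>, the power that leads from one to
  the other acts nearly as a scalar on the range of \<open>Z\<close>, which is
  \<open>E\<close>.\<close>

lemma D_inverse:
  assumes X: "X \<in> D"
  obtains X' where "X' \<in> D" "\<And>x. x \<in> E \<Longrightarrow> X' (X x) = x"
proof -
  \<comment> \<open>\<open>pw n\<close> is the power with exponent n + 1, whence the shift by 2 in
    \<open>pw_add\<close>.\<close>
  define pw where "pw n = ((\<lambda>Y. X o\<^sub>L Y) ^^ n) X" for n
  have pw: "pw n \<in> D" for n
    by (induction n) (auto simp: pw_def X intro: D_comp)
  have pw_add: "pw a o\<^sub>L (X o\<^sub>L pw b) = pw (a + b + 2)" for a b
  proof (induction a)
    case (Suc a)
    have "pw (Suc a) o\<^sub>L (X o\<^sub>L pw b) = X o\<^sub>L (pw a o\<^sub>L (X o\<^sub>L pw b))"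
      by (auto intro!: blinfun_eqI simp: pw_def)
    also have "\<dots> = pw (Suc a + b + 2)" by (simp only: Suc) (simp add: pw_def)
    finally show ?case .
  qed (simp add: pw_def)
  define u where "u n = (1 / norm (pw n)) *\<^sub>R pw n" for n
  have pw0: "norm (pw n) > 0" for n using pw[of n] by (simp add: D_def)
  have uD: "u n \<in> D" for n unfolding u_def using pw0[of n] by (intro D_scale pw) auto
  have un: "norm (u n) = 1" for n using pw0[of n] by (simp add: u_def)
  have bdd: "bounded (range (\<lambda>n. u (f n)))" for f by (rule boundedI[of _ 1]) (auto simp: un)
  have lim_D: "L \<in> D" if "(\<lambda>n. u (f n)) \<longlonglongrightarrow> L" for f L
  proof (rule D_limit[OF uD that])
    from tendsto_norm[OF that] have "norm L = 1" using LIMSEQ_unique[of "\<lambda>n. 1::real"] by (auto simp: un)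
    then show "L \<noteq> 0" by auto
  qed
  obtain Z r where r: "strict_mono (r :: nat \<Rightarrow> nat)" and Z: "(\<lambda>n. u (r n)) \<longlonglongrightarrow> Z"
    using bounded_imp_convergent_subsequence[OF bdd[of id]] by (auto simp: o_def)
  \<comment> \<open>Two steps of the strictly increasing \<open>r\<close> raise its value by at
    least 2, so the natural subtraction is exact and \<open>pw (k n)\<close>, \<open>X\<close> and
    \<open>pw (r (2 * n))\<close> compose to \<open>pw (r (2 * n + 2))\<close>.\<close>
  define k where "k n = r (2 * n + 2) - r (2 * n) - 2" for n
  have gap: "k n + r (2 * n) + 2 = r (2 * n + 2)" for n
    using strict_monoD[OF r, of "2 * n" "2 * n + 1"] strict_monoD[OF r, of "2 * n + 1" "2 * n + 2"]
    by (simp add: k_def)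
  obtain W q where q: "strict_mono (q :: nat \<Rightarrow> nat)" and W: "(\<lambda>n. u (k (q n))) \<longlonglongrightarrow> W"
    using bounded_imp_convergent_subsequence[OF bdd[of k]] by (auto simp: o_def)
  have sub: "(\<lambda>n. u (r (f n))) \<longlonglongrightarrow> Z" if "strict_mono f" for f
    using LIMSEQ_subseq_LIMSEQ[OF Z that] by (simp add: o_def)
  have q1: "(\<lambda>n. u (r (2 * q n))) \<longlonglongrightarrow> Z"
    by (rule sub) (use q in \<open>simp add: strict_mono_def\<close>)
  have q2: "(\<lambda>n. u (r (2 * q n + 2))) \<longlonglongrightarrow> Z"
    by (rule sub) (use q in \<open>simp add: strict_mono_def\<close>)
  define Y where "Y n = u (k (q n)) o\<^sub>L (X o\<^sub>L u (r (2 * q n)))" for n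
  have Ylim: "Y \<longlonglongrightarrow> (W o\<^sub>L (X o\<^sub>L Z))"
    unfolding Y_def by (intro tendsto_intros W q1)
  have Yeq: "Y n = norm (Y n) *\<^sub>R u (r (2 * q n + 2))" for n
  proof -
    define c where "c = norm (pw (r (2 * q n + 2))) / (norm (pw (k (q n))) * norm (pw (r (2 * q n))))"
    have "c > 0" using pw0 by (simp add: c_def)
    have "Y n = c *\<^sub>R u (r (2 * q n + 2))"
      using pw_add[of "k (q n)" "r (2 * q n)"] gap[of "q n"] pw0[of "r (2 * q n + 2)"]
      by (simp add: Y_def u_def c_def bounded_bilinear.scaleR_left[OF bounded_bilinear_blinfun_compose]
          bounded_bilinear.scaleR_right[OF bounded_bilinear_blinfun_compose])
    with \<open>c > 0\<close> un show ?thesis by simp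
  qed
  define a where "a = norm (W o\<^sub>L (X o\<^sub>L Z))"
  have "(\<lambda>n. norm (Y n) *\<^sub>R u (r (2 * q n + 2))) \<longlonglongrightarrow> a *\<^sub>R Z"
    unfolding a_def by (intro tendsto_intros Ylim q2)
  \<comment> \<open>Both sides are limits of \<open>Y\<close>. As \<open>Z\<close> maps
    \<open>E\<close> onto \<open>E\<close>, this says that \<open>W\<close> after \<open>X\<close>
    is the scalar \<open>a\<close> on \<open>E\<close>.\<close>
  then have eq: "W o\<^sub>L (X o\<^sub>L Z) = a *\<^sub>R Z"
    using LIMSEQ_unique[OF Ylim] Yeq by simp
  have ZD: "Z \<in> D" by (rule lim_D[OF Z])
  have WD: "W \<in> D" by (rule lim_D[OF W])
  have "W o\<^sub>L (X o\<^sub>L Z) \<in> D" by (intro D_comp ZD WD X)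
  then have a: "a > 0" by (simp add: a_def D_def)
  show ?thesis
  proof
    show "(1 / a) *\<^sub>R W \<in> D" using a WD by (intro D_scale) auto
    fix x assume "x \<in> E"
    then obtain z where z: "x = Z z" using D_image_E[OF ZD] by blast
    have "W (X (Z z)) = a *\<^sub>R Z z"
      using arg_cong[OF eq, of "\<lambda>f. blinfun_apply f z"] by (simp add: blinfun.scaleR_left)
    then show "((1 / a) *\<^sub>R W) (X x) = x" using a z by (simp add: blinfun.scaleR_left)
  qed
qed

text \<open>The ratio \<open>R x y\<close> is invariant under the group \<open>D\<close>. If \<open>D\<close> contains \<open>I + \<sigma> u w\<^sup>T\<close> up to
  \<open>O(\<sigma>\<^sup>2)\<close>, then for \<open>w y = 0\<close> the function \<open>s \<mapsto> R (x + s u) y\<close> has zero derivative, although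
  it grows linearly.\<close>

lemma rank_le_one:
  assumes w: "bounded_linear w" and u: "u \<in> E" "u \<noteq> 0" and x1: "x1 \<in> E" "w x1 \<noteq> (0::real)"
    and \<sigma>0: "\<sigma>0 > 0" and C: "C \<ge> 0"
    and Z: "\<And>\<sigma>. \<sigma> \<noteq> 0 \<Longrightarrow> \<bar>\<sigma>\<bar> < \<sigma>0 \<Longrightarrow>
      \<exists>Z\<in>D. \<forall>x\<in>E. norm (Z x - x - (\<sigma> * w x) *\<^sub>R u) \<le> C * \<sigma>\<^sup>2 * norm x"
  shows "dim E \<le> 1"
proof (rule ccontr)
  assume dimE: "\<not> dim E \<le> 1"
  interpret w: bounded_linear w by (rule w)
  define x0 where "x0 = (1 / w x1) *\<^sub>R x1"
  have x0: "x0 \<in> E" "w x0 = 1"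
    using x1 subspace_scale[OF subspace_E] by (auto simp: x0_def w.scaleR)
  have "\<not> E \<subseteq> span {x0}"
    using dimE dim_le_card[of E "{x0}"] by auto
  then obtain e where e: "e \<in> E" "e \<notin> span {x0}" by blast
  define y0 where "y0 = e - w e *\<^sub>R x0"
  have y0: "y0 \<in> E" "w y0 = 0" "y0 \<noteq> 0"
    using e x0 subspace_diff[OF subspace_E] subspace_scale[OF subspace_E] span_scale[OF span_base[of x0 "{x0}"], of "w e"]
    by (auto simp: y0_def w.diff w.scaleR)
  obtain m where m: "m > 0" "\<And>X y. X \<in> D \<Longrightarrow> y \<in> E \<Longrightarrow> m * norm X * norm y \<le> norm (X y)"
    using D_lower_bound by blast
  have Xpos: "norm X > 0" if "X \<in> D" for X using that by (simp add: D_def)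
  have Xypos: "norm (X y) > 0" if "X \<in> D" "y \<in> E" "y \<noteq> 0" for X y
    using D_nonzero[OF that] by simp
  have ratio: "norm (X x) / norm (X y) \<le> norm x / (m * norm y)" if "X \<in> D" "y \<in> E" "y \<noteq> 0" for X x y
  proof -
    have "norm (X x) / norm (X y) \<le> (norm X * norm x) / (m * norm X * norm y)"
      using m(1) m(2)[OF that(1,2)] Xpos[OF that(1)] that(3)
      by (intro frac_le norm_blinfun) auto
    then show ?thesis using Xpos[OF that(1)] by simp
  qed
  define R where "R x y = (SUP X\<in>D. norm (blinfun_apply X x) / norm (blinfun_apply X y))" for x y
  have R_ge: "norm (X x) / norm (X y) \<le> R x y" if "X \<in> D" "y \<in> E" "y \<noteq> 0" for X x y
    unfolding R_def
    by (rule cSUP_upper[OF that(1)]) (auto intro!: bdd_aboveI2[where M = "norm x / (m * norm y)"] ratio that)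
  have R_leI: "R x y \<le> c" if "\<And>X. X \<in> D \<Longrightarrow> norm (X x) / norm (X y) \<le> c" for x y c
    unfolding R_def by (rule cSUP_least) (use M_in_D that in auto)
  have R_inv: "R (Z x) (Z y) = R x y" if Z: "Z \<in> D" and x: "x \<in> E" and y: "y \<in> E" "y \<noteq> 0" for Z x y
  proof (rule antisym)
    have Zy: "Z y \<in> E" "Z y \<noteq> 0" using D_nonzero[OF Z y] Z by (auto simp: D_def)
    show "R (Z x) (Z y) \<le> R x y"
      by (rule R_leI) (use R_ge[OF D_comp[OF _ Z] y] in auto)
    obtain Z' where Z': "Z' \<in> D" "\<And>x. x \<in> E \<Longrightarrow> Z' (Z x) = x" using D_inverse[OF Z] by blast
    show "R x y \<le> R (Z x) (Z y)"
      by (rule R_leI) (use R_ge[OF D_comp[OF _ Z'(1)] Zy, of _ "Z x"] Z'(2) x y in auto)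
  qed
  have R_num: "R x y \<le> R x' y + norm (x - x') / (m * norm y)" if y: "y \<in> E" "y \<noteq> 0" for x x' y
  proof (rule R_leI)
    fix X assume X: "X \<in> D"
    have "norm (X x) \<le> norm (X x') + norm (X (x - x'))"
      using norm_triangle_sub[of "X x" "X x'"] by (simp add: blinfun.diff_right)
    then have "norm (X x) / norm (X y) \<le> norm (X x') / norm (X y) + norm (X (x - x')) / norm (X y)"
      using Xypos[OF X y] by (simp add: divide_right_mono flip: add_divide_distrib)
    with R_ge[OF X y, of x'] ratio[OF X y, of "x - x'"]
    show "norm (X x) / norm (X y) \<le> R x' y + norm (x - x') / (m * norm y)" by linarith
  qed
  have R_den: "R x y' \<le> R x y + norm x / (m * norm y) * (norm (y - y') / (m * norm y'))"
    if y: "y \<in> E" "y \<noteq> 0" and y': "y' \<in> E" "y' \<noteq> 0" for x y y'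
  proof (rule R_leI)
    fix X assume X: "X \<in> D"
    let ?a = "norm (X x)" and ?b = "norm (X y)" and ?c = "norm (X y')"
    have pos: "?b > 0" "?c > 0" using Xypos X y y' by auto
    have "?b - ?c \<le> norm (X (y - y'))"
      using norm_triangle_ineq2[of "X y" "X y'"] by (simp add: blinfun.diff_right)
    then have "(?b - ?c) / ?c \<le> norm (X (y - y')) / ?c"
      using pos by (simp add: divide_right_mono)
    also have "\<dots> \<le> norm (y - y') / (m * norm y')" by (rule ratio[OF X y'])
    finally have *: "(?b - ?c) / ?c \<le> norm (y - y') / (m * norm y')" .
    have "?a / ?c = ?a / ?b + ?a / ?b * ((?b - ?c) / ?c)"
      using pos by (simp add: field_simps)
    also have "?a / ?b * ((?b - ?c) / ?c) \<le> ?a / ?b * (norm (y - y') / (m * norm y'))"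
      using * by (intro mult_left_mono) auto
    also have "\<dots> \<le> norm x / (m * norm y) * (norm (y - y') / (m * norm y'))"
      using m(1) by (intro mult_right_mono ratio[OF X y]) auto
    finally show "?a / ?c \<le> R x y + norm x / (m * norm y) * (norm (y - y') / (m * norm y'))"
      using R_ge[OF X y, of x] by linarith
  qed
  define f where "f s = R (x0 + s *\<^sub>R u) y0" for s
  have xs: "x0 + s *\<^sub>R u \<in> E" for s
    using x0 u subspace_add[OF subspace_E] subspace_scale[OF subspace_E] by blast
  have deriv: "DERIV f s :> 0" if \<theta>: "1 + s * w u > 0" for s
  proof -
    define \<theta> where "\<theta> = 1 + s * w u"
    have \<theta>_pos: "\<theta> > 0" using \<theta> by (simp add: \<theta>_def)
    define B where "B = norm x0 + (\<bar>s\<bar> + 1) * norm u"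
    define K where "K = 2 * C * B / (m * norm y0) + B / (m * norm y0) * (2 * C / m)"
    \<comment> \<open>The three bounds give, in turn, the uniform size \<open>B\<close> of the
      vectors involved, the existence of \<open>Z\<close> for the step \<open>\<sigma>\<close>, and
      \<open>C * \<sigma>\<^sup>2 \<le> 1 / 2\<close>, by which \<open>Z\<close> keeps at least half
      the length of \<open>y0\<close>.\<close>
    define \<delta> where "\<delta> = min 1 (min (\<sigma>0 * \<theta>) (\<theta> / sqrt (2 * (C + 1))))"
    have "\<delta> > 0" using \<sigma>0 \<theta>_pos C by (simp add: \<delta>_def)
    moreover have "\<bar>f (s + h) - f s\<bar> \<le> K / \<theta>\<^sup>2 * h\<^sup>2" if h: "\<bar>h\<bar> < \<delta>" for h
    proof (cases "h = 0")
      case False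
      \<comment> \<open>Because \<open>w\<close> equals \<open>\<theta>\<close> at
        \<open>x0 + s *\<^sub>R u\<close>, the step h / \<theta> carries this point to
        \<open>x0 + (s + h) *\<^sub>R u\<close> up to second order, while \<open>y0\<close> in the
        kernel of \<open>w\<close> moves only at second order.\<close>
      define \<sigma> where "\<sigma> = h / \<theta>"
      have s1: "\<sigma> \<noteq> 0" "\<bar>\<sigma>\<bar> < \<sigma>0" "\<sigma> * \<theta> = h" "\<bar>h\<bar> \<le> 1"
        using h False \<theta>_pos by (auto simp: \<sigma>_def \<delta>_def field_simps)
      have "\<bar>\<sigma>\<bar> \<le> 1 / sqrt (2 * (C + 1))"
        using h \<theta>_pos by (auto simp: \<sigma>_def \<delta>_def field_simps)
      then have "\<sigma>\<^sup>2 \<le> (1 / sqrt (2 * (C + 1)))\<^sup>2"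
        by (metis abs_ge_zero power2_abs power_mono)
      also have "\<dots> = 1 / (2 * (C + 1))" using C by (simp add: power_divide)
      finally have "C * \<sigma>\<^sup>2 \<le> C * (1 / (2 * (C + 1)))" using C by (rule mult_left_mono)
      also have "\<dots> \<le> 1 / 2" using C by (simp add: field_simps)
      finally have s2: "C * \<sigma>\<^sup>2 \<le> 1 / 2" .
      obtain Z where Z: "Z \<in> D" "\<And>x. x \<in> E \<Longrightarrow> norm (Z x - x - (\<sigma> * w x) *\<^sub>R u) \<le> C * \<sigma>\<^sup>2 * norm x"
        using Z[OF s1(1,2)] by blast
      let ?x = "x0 + s *\<^sub>R u" and ?x' = "x0 + (s + h) *\<^sub>R u"
      have "w ?x = \<theta>" by (simp add: w.add w.scaleR x0 \<theta>_def)
      then have "Z ?x - ?x - (\<sigma> * w ?x) *\<^sub>R u = Z ?x - ?x'"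
        using s1(3) by (simp add: algebra_simps)
      then have e1: "norm (Z ?x - ?x') \<le> C * \<sigma>\<^sup>2 * norm ?x"
        using Z(2)[OF xs[of s]] by (simp only:)
      have e2: "norm (Z y0 - y0) \<le> C * \<sigma>\<^sup>2 * norm y0" using Z(2)[OF y0(1)] y0(2) by simp
      have Zy: "Z y0 \<in> E" "Z y0 \<noteq> 0" using D_nonzero[OF Z(1) y0(1,3)] Z(1) by (auto simp: D_def)
      have "C * \<sigma>\<^sup>2 * norm y0 \<le> 1 / 2 * norm y0" using s2 by (rule mult_right_mono) auto
      then have Zy2: "norm (Z y0) \<ge> norm y0 / 2"
        using e2 norm_triangle_ineq2[of y0 "Z y0"] by (simp add: norm_minus_commute)
      have "norm ?x \<le> norm x0 + \<bar>s\<bar> * norm u"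
        using norm_triangle_ineq[of x0 "s *\<^sub>R u"] by simp
      then have nx: "norm ?x \<le> B" unfolding B_def using norm_ge_zero[of u] by (simp add: distrib_right del: norm_ge_zero)
      have "norm ?x' \<le> norm x0 + \<bar>s + h\<bar> * norm u"
        using norm_triangle_ineq[of x0 "(s + h) *\<^sub>R u"] by simp
      also have "\<dots> \<le> B" unfolding B_def
        using s1(4) by (intro add_left_mono mult_right_mono) auto
      finally have nx': "norm ?x' \<le> B" .
      have B0: "B \<ge> 0" using nx norm_ge_zero order_trans by blast
      have fs: "f s = R (Z ?x) (Z y0)"
        unfolding f_def by (rule R_inv[OF Z(1) xs y0(1,3), symmetric])
      have my: "m * norm (Z y0) \<ge> m * (norm y0 / 2)" using m(1) Zy2 by simp
      have my0: "m * (norm y0 / 2) > 0" using m(1) y0(3) by simp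
      have e1': "norm (Z ?x - ?x') \<le> C * \<sigma>\<^sup>2 * B"
        using e1 mult_left_mono[OF nx, of "C * \<sigma>\<^sup>2"] C by simp
      have b1: "norm (Z ?x - ?x') / (m * norm (Z y0)) \<le> (C * \<sigma>\<^sup>2 * B) / (m * (norm y0 / 2))"
        using e1' my my0 order_trans[OF norm_ge_zero e1'] by (intro frac_le) auto
      have b2: "norm ?x' / (m * norm y) * (norm (Z y0 - y0) / (m * norm y')) \<le>
          B / (m * norm y0) * ((C * \<sigma>\<^sup>2 * norm y0) / (m * (norm y0 / 2)))"
        if "y = y0 \<and> y' = Z y0 \<or> y = Z y0 \<and> y' = y0" for y y'
      proof -
        have "norm ?x' / (m * norm y0) * (norm (Z y0 - y0) / (m * norm (Z y0))) \<le>
          B / (m * norm y0) * ((C * \<sigma>\<^sup>2 * norm y0) / (m * (norm y0 / 2)))"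
          using nx' e2 my my0 m(1) y0(3) C B0
          by (intro mult_mono frac_le divide_right_mono) auto
        with that show ?thesis by (auto simp: mult_ac)
      qed
      have eqK: "(C * \<sigma>\<^sup>2 * B) / (m * (norm y0 / 2)) + B / (m * norm y0) * ((C * \<sigma>\<^sup>2 * norm y0) / (m * (norm y0 / 2)))
          = K / \<theta>\<^sup>2 * h\<^sup>2"
      proof -
        have 1: "K / \<theta>\<^sup>2 * h\<^sup>2 = K * \<sigma>\<^sup>2" by (simp add: \<sigma>_def power_divide)
        have 2: "(C * \<sigma>\<^sup>2 * B) / (m * (norm y0 / 2)) = 2 * C * B / (m * norm y0) * \<sigma>\<^sup>2" by simp
        have 3: "(C * \<sigma>\<^sup>2 * norm y0) / (m * (norm y0 / 2)) = 2 * C / m * \<sigma>\<^sup>2"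
          using y0(3) by simp
        show ?thesis unfolding 1 2 3 unfolding K_def by (simp add: distrib_right mult.assoc)
      qed
      have fsh: "f (s + h) = R ?x' y0" by (simp add: f_def)
      have comm: "norm (?x' - Z ?x) = norm (Z ?x - ?x')" "norm (y0 - Z y0) = norm (Z y0 - y0)"
        by (simp_all add: norm_minus_commute)
      have "f s \<le> f (s + h) + K / \<theta>\<^sup>2 * h\<^sup>2"
        using R_num[OF Zy, of "Z ?x" ?x'] R_den[OF y0(1,3) Zy, of ?x'] b1 b2[of y0 "Z y0", OF disjI1[OF conjI[OF refl refl]]] eqK
        unfolding fs fsh comm by linarith
      moreover have "f (s + h) \<le> f s + K / \<theta>\<^sup>2 * h\<^sup>2"
        using R_num[OF Zy, of ?x' "Z ?x"] R_den[OF Zy y0(1,3), of ?x'] b1 b2[of "Z y0" y0, OF disjI2[OF conjI[OF refl refl]]] eqK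
        unfolding fs fsh comm by linarith
      ultimately show ?thesis by linarith
    qed simp
    ultimately show ?thesis by (rule DERIV_zero_of_quadratic_bound)
  qed
  \<comment> \<open>With this sign \<open>p * w u\<close> is nonnegative, so \<open>\<theta>\<close>
    stays at least 1 along the whole ray and the derivative of \<open>g\<close> vanishes for all
    \<open>t \<ge> 0\<close>.\<close>
  define p :: real where "p = (if w u \<ge> 0 then 1 else -1)"
  define g where "g t = f (p * t)" for t
  have g': "DERIV g t :> 0" if "t \<ge> 0" for t
  proof -
    have "1 + (p * t) * w u > 0"
      using that mult_nonneg_nonpos[of t "w u"] by (auto simp: p_def intro: add_pos_nonneg)
    have "((\<lambda>t. p * t) has_real_derivative p) (at t)" by (auto intro!: derivative_eq_intros)
    from DERIV_chain2[where g = "\<lambda>t. p * t", OF deriv[OF \<open>1 + (p * t) * w u > 0\<close>] this]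
    show ?thesis unfolding g_def by simp
  qed
  have const: "g t = g 0" if "t > 0" for t
    by (rule DERIV_isconst2[OF that]) (use that in \<open>auto intro!: continuous_at_imp_continuous_on DERIV_isCont g'\<close>)
  \<comment> \<open>The single member \<open>M\<close> of the supremum already grows linearly, by
    the bounded condition number.\<close>
  have lower: "g t \<ge> m * (t * norm u - norm x0) / norm y0" if "t > 0" for t
  proof -
    let ?x = "x0 + (p * t) *\<^sub>R u"
    have "\<bar>p * t\<bar> = t" using that by (simp add: p_def)
    then have "t * norm u - norm x0 \<le> norm ?x"
      using norm_triangle_ineq2[of "(p * t) *\<^sub>R u" "- x0"] by (auto simp: add.commute)
    then have "m * (t * norm u - norm x0) / norm y0 \<le> m * norm ?x / norm y0"
      using m(1) by (simp add: divide_right_mono)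
    also have "\<dots> = (m * norm M * norm ?x) / (norm M * norm y0)"
      using Xpos[OF M_in_D] by simp
    also have "\<dots> \<le> norm (M ?x) / norm (M y0)"
      using m(2)[OF M_in_D xs] Xypos[OF M_in_D y0(1,3)] by (intro frac_le norm_blinfun) auto
    also have "\<dots> \<le> g t" unfolding g_def f_def by (rule R_ge[OF M_in_D y0(1,3)])
    finally show ?thesis .
  qed
  define t where "t = (\<bar>g 0\<bar> * norm y0 / m + norm x0 + 1) / norm u"
  have t: "t > 0" using u(2) m(1) by (simp add: t_def add_nonneg_pos)
  have "m * (t * norm u - norm x0) / norm y0 = \<bar>g 0\<bar> + m / norm y0"
    using u(2) m(1) y0(3) by (simp add: t_def field_simps)
  moreover have "m / norm y0 > 0" using m(1) y0(3) by simp
  ultimately have "g 0 < m * (t * norm u - norm x0) / norm y0" using abs_ge_self[of "g 0"] by linarith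
  then show False using lower[OF t] const[OF t] by linarith
qed

end

section \<open>Rank-one limits of irreducible semigroups\<close>

lemma blinfun_nonzeroE:
  fixes X :: "'a::euclidean_space \<Rightarrow>\<^sub>L 'b::real_normed_vector"
  assumes "X \<noteq> 0"
  obtains x where "X x \<noteq> 0"
  using assms by (metis blinfun.zero_left blinfun_eqI)

text \<open>The projection \<open>P\<close> encodes the quotient by the \<open>H\<close>-invariant subspace \<open>ker P\<close>. The curves \<open>F i\<close> are
  the flows of two constant signals, whose generators \<open>B i\<close> differ by a multiple of \<open>b k\<^sup>T\<close>.\<close>

locale irreducible_system =
  fixes H :: "('a::euclidean_space \<Rightarrow>\<^sub>L 'a) set" and P :: "'a \<Rightarrow>\<^sub>L 'a"
    and F :: "bool \<Rightarrow> real \<Rightarrow> 'a \<Rightarrow>\<^sub>L 'a" and B :: "bool \<Rightarrow> 'a \<Rightarrow>\<^sub>L 'a" and C :: real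
    and b k :: 'a and \<delta> :: "bool \<Rightarrow> real"
  assumes H_comp: "g \<in> H \<Longrightarrow> h \<in> H \<Longrightarrow> g o\<^sub>L h \<in> H"
    and H_id: "id_blinfun \<in> H"
    and PP: "P o\<^sub>L P = P" and P0: "P \<noteq> 0"
    and PH: "h \<in> H \<Longrightarrow> P (h (P x)) = P (h x)"
    and H_inj: "h \<in> H \<Longrightarrow> P x \<noteq> 0 \<Longrightarrow> P (h x) \<noteq> 0"
    and irr: "P y \<noteq> 0 \<Longrightarrow> X \<noteq> 0 \<Longrightarrow> \<exists>h\<in>H. blinfun_apply (X :: 'a \<Rightarrow>\<^sub>L 'a) (h y) \<noteq> 0"
    and irr_k: "P y \<noteq> 0 \<Longrightarrow> \<exists>h\<in>H. k \<bullet> blinfun_apply h y \<noteq> 0"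
    and F_H: "0 \<le> t \<Longrightarrow> F i t \<in> H"
    and taylor: "0 \<le> t \<Longrightarrow> t \<le> 1 \<Longrightarrow> norm (F i t x - x - t *\<^sub>R B i x) \<le> C * t\<^sup>2 * norm x"
    and C0: "C \<ge> 0"
    and B_diff: "B (\<not> i) x - B i x = (\<delta> i * (k \<bullet> x)) *\<^sub>R b"
    and \<delta>: "\<delta> i \<noteq> 0" "\<delta> (\<not> i) = - \<delta> i"
    and cyc: "X \<noteq> 0 \<Longrightarrow> \<eta> > 0 \<Longrightarrow> \<exists>t. 0 < t \<and> t < \<eta> \<and> blinfun_apply (X :: 'a \<Rightarrow>\<^sub>L 'a) (F False t b) \<noteq> 0"
begin

text \<open>Compression by \<open>P\<close> on both sides represents the induced operator on the
  quotient; free scalars and the closure admit limits of normalised operators.\<close>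

definition S where "S = closure {c *\<^sub>R (P o\<^sub>L h o\<^sub>L P) | c h. h \<in> H}"

lemma P_idem: "P (P x) = P x"
  using PP by (metis blinfun_apply_blinfun_compose)

lemma S_seq:
  assumes "X \<in> S"
  obtains c h where "\<And>n. h n \<in> H" "(\<lambda>n::nat. c n *\<^sub>R (P o\<^sub>L h n o\<^sub>L P)) \<longlonglongrightarrow> X"
proof -
  from assms obtain f where f: "\<And>n::nat. f n \<in> {c *\<^sub>R (P o\<^sub>L h o\<^sub>L P) | c h. h \<in> H}" "f \<longlonglongrightarrow> X"
    unfolding S_def closure_sequential by blast
  from f(1) have "\<forall>n. \<exists>c h. h \<in> H \<and> f n = c *\<^sub>R (P o\<^sub>L h o\<^sub>L P)" by blast
  then obtain c h where ch: "\<And>n. h n \<in> H" "\<And>n. f n = c n *\<^sub>R (P o\<^sub>L h n o\<^sub>L P)" by metis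
  then have "f = (\<lambda>n. c n *\<^sub>R (P o\<^sub>L h n o\<^sub>L P))" by blast
  with that[OF ch(1)] f(2) show ?thesis by simp
qed

lemma S_limit: "(\<And>n::nat. h n \<in> H) \<Longrightarrow> (\<lambda>n. c n *\<^sub>R (P o\<^sub>L h n o\<^sub>L P)) \<longlonglongrightarrow> X \<Longrightarrow> X \<in> S"
  unfolding S_def closure_sequential by (intro exI[of _ "\<lambda>n. c n *\<^sub>R (P o\<^sub>L h n o\<^sub>L P)"]) blast

lemma S_base: "h \<in> H \<Longrightarrow> P o\<^sub>L h o\<^sub>L P \<in> S"
  using S_limit[of "\<lambda>_. h" "\<lambda>_. 1"] by simp

lemma S_scale: assumes "X \<in> S" shows "c *\<^sub>R X \<in> S"
proof -
  obtain d h where h: "\<And>n. h n \<in> H" "(\<lambda>n::nat. d n *\<^sub>R (P o\<^sub>L h n o\<^sub>L P)) \<longlonglongrightarrow> X" using S_seq[OF assms] by blast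
  show ?thesis
    by (rule S_limit[of h "\<lambda>n. c * d n", OF h(1)]) (use tendsto_scaleR[OF tendsto_const h(2), of c] in simp)
qed

lemma S_comp: assumes "X \<in> S" "Y \<in> S" shows "X o\<^sub>L Y \<in> S"
proof -
  obtain c g where g: "\<And>n. g n \<in> H" "(\<lambda>n::nat. c n *\<^sub>R (P o\<^sub>L g n o\<^sub>L P)) \<longlonglongrightarrow> X" using S_seq[OF assms(1)] by blast
  obtain d h where h: "\<And>n. h n \<in> H" "(\<lambda>n::nat. d n *\<^sub>R (P o\<^sub>L h n o\<^sub>L P)) \<longlonglongrightarrow> Y" using S_seq[OF assms(2)] by blast
  have "(c n *\<^sub>R (P o\<^sub>L g n o\<^sub>L P)) o\<^sub>L (d n *\<^sub>R (P o\<^sub>L h n o\<^sub>L P)) = (c n * d n) *\<^sub>R (P o\<^sub>L (g n o\<^sub>L h n) o\<^sub>L P)" for n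
    by (auto intro!: blinfun_eqI simp: blinfun.scaleR_left blinfun.scaleR_right P_idem PH[OF g(1)])
  moreover have "(\<lambda>n. (c n *\<^sub>R (P o\<^sub>L g n o\<^sub>L P)) o\<^sub>L (d n *\<^sub>R (P o\<^sub>L h n o\<^sub>L P))) \<longlonglongrightarrow> (X o\<^sub>L Y)"
    by (intro tendsto_intros g h)
  ultimately show ?thesis
    using S_limit[of "\<lambda>n. g n o\<^sub>L h n" "\<lambda>n. c n * d n"] H_comp g(1) h(1) by simp
qed

lemma closed_S: "closed S" by (simp add: S_def)

lemma S_P: assumes "X \<in> S" shows "P (X x) = X x" "X (P x) = X x"
proof -
  obtain c g where g: "\<And>n. g n \<in> H" "(\<lambda>n::nat. c n *\<^sub>R (P o\<^sub>L g n o\<^sub>L P)) \<longlonglongrightarrow> X" using S_seq[OF assms(1)] by blast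
  let ?f = "\<lambda>n. c n *\<^sub>R (P o\<^sub>L g n o\<^sub>L P)"
  have 1: "(\<lambda>n. ?f n y) \<longlonglongrightarrow> X y" for y by (intro tendsto_intros g)
  have "(\<lambda>n. P (?f n x)) \<longlonglongrightarrow> P (X x)" by (intro tendsto_intros 1)
  moreover have "P (?f n x) = ?f n x" for n by (simp add: blinfun.scaleR_left blinfun.scaleR_right P_idem)
  ultimately have "(\<lambda>n. ?f n x) \<longlonglongrightarrow> P (X x)" by (simp only:)
  from LIMSEQ_unique[OF this 1] show "P (X x) = X x" .
  have "?f n (P x) = ?f n x" for n by (simp add: blinfun.scaleR_left P_idem)
  with 1[of "P x"] have "(\<lambda>n. ?f n x) \<longlonglongrightarrow> X (P x)" by (simp only:)
  from LIMSEQ_unique[OF this 1] show "X (P x) = X x" .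
qed

text \<open>A nonzero element \<open>M0\<close> of least rank may square to zero. Irreducibility
  supplies \<open>h\<close> that carries some image vector of \<open>M0\<close> out of its kernel,
  and composing \<open>M0\<close> with the compression of \<open>h\<close> gives a nonzero square
  without raising the rank.\<close>

lemma minimal_element:
  obtains M where "minimal_rank S M"
proof -
  let ?rk = "\<lambda>X :: 'a \<Rightarrow>\<^sub>L 'a. dim (range (blinfun_apply X))"
  have "P o\<^sub>L id_blinfun o\<^sub>L P = P" by (rule blinfun_eqI) (simp add: P_idem)
  then have "P \<in> S" using S_base[OF H_id] by simp
  with P0 have "\<exists>X. X \<in> S \<and> X \<noteq> 0" by blast
  from ex_has_least_nat[of "\<lambda>X. X \<in> S \<and> X \<noteq> 0", OF someI_ex[OF this], of ?rk]
  obtain M0 where M0: "M0 \<in> S" "M0 \<noteq> 0" "\<And>X. X \<in> S \<Longrightarrow> X \<noteq> 0 \<Longrightarrow> ?rk M0 \<le> ?rk X"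
    by blast
  obtain u where u: "M0 u \<noteq> 0" using blinfun_nonzeroE[OF M0(2)] .
  have "P (M0 u) \<noteq> 0" using u S_P[OF M0(1)] by simp
  from irr[OF this M0(2)] obtain h where h: "h \<in> H" "M0 (h (M0 u)) \<noteq> 0" by blast
  define M where "M = (P o\<^sub>L h o\<^sub>L P) o\<^sub>L M0"
  have "P (M0 (h (M0 u))) \<noteq> 0" using h S_P[OF M0(1)] by simp
  from H_inj[OF h(1) this] have "(M o\<^sub>L M) u \<noteq> 0"
    by (simp add: M_def S_P[OF M0(1)])
  then have MM: "M o\<^sub>L M \<noteq> 0" by (metis blinfun.zero_left)
  have MS: "M \<in> S" unfolding M_def by (intro S_comp S_base h M0)
  have "?rk M \<le> ?rk M0"
  proof -
    have "range (blinfun_apply M) = blinfun_apply (P o\<^sub>L h o\<^sub>L P) ` range (blinfun_apply M0)"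
      by (auto simp: M_def)
    then show ?thesis
      using dim_image_le[of "blinfun_apply (P o\<^sub>L h o\<^sub>L P)" "range (blinfun_apply M0)"]
      by (simp add: linear_blinfun)
  qed
  then have "minimal_rank S M"
    by unfold_locales (use MM MS M0(3) in \<open>auto intro: S_comp S_scale closed_S order_trans\<close>)
  then show ?thesis by (rule that)
qed

theorem rank_one_element:
  obtains X where "X \<in> S" "X \<noteq> 0" "dim (range (blinfun_apply X)) \<le> 1"
proof -
  obtain M where "minimal_rank S M" using minimal_element .
  then interpret M: minimal_rank S M .
  obtain M' where M': "M' \<in> M.D" "\<And>x. x \<in> M.E \<Longrightarrow> M' (M x) = x" using M.D_inverse[OF M.M_in_D] by blast
  \<comment> \<open>The unit of the group: a member of \<open>M.D\<close> that restricts to the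
    identity on \<open>E\<close>.\<close>
  define e where "e = M' o\<^sub>L M"
  have eD: "e \<in> M.D" unfolding e_def by (intro M.D_comp M' M.M_in_D)
  then have eS: "e \<in> S" by (simp add: M.D_def)
  have eE: "e x = x" if "x \<in> M.E" for x using M'(2)[OF that] by (simp add: e_def)
  have e_range: "e x \<in> M.E" for x using eD by (auto simp: M.D_def)
  have M0: "M \<noteq> 0" using M.M_in_D by (simp add: M.D_def)
  obtain x' where "M x' \<noteq> 0" using blinfun_nonzeroE[OF M0] .
  then obtain x where x: "x \<in> M.E" "x \<noteq> 0" unfolding M.E_def by blast
  have "P x = x" using S_P(1)[OF eS, of x] eE[OF x(1)] by simp
  then have Px: "P x \<noteq> 0" using x by simp
  obtain g' where g': "g' \<in> H" "k \<bullet> g' x \<noteq> 0" using irr_k[OF Px] by blast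
  define y where "y = g' x"
  have Py: "P y \<noteq> 0" unfolding y_def by (rule H_inj[OF g'(1) Px])
  have e0: "e \<noteq> 0" using eD by (simp add: M.D_def)
  obtain g2 where g2: "g2 \<in> H" "e (g2 y) \<noteq> 0" using irr[OF Py e0] by blast
  \<comment> \<open>One \<open>g\<close> has to serve both \<open>b\<close> and \<open>g' x\<close>.
    The condition at \<open>y = g' x\<close> persists for all small times \<open>t\<close>, and
    \<open>cyc\<close> meets the condition at \<open>b\<close> at some such time; \<open>g\<close>
    is \<open>g2\<close> after the flow for that time.\<close>
  have cont: "\<exists>\<eta>>0. \<forall>t. 0 < t \<longrightarrow> t < \<eta> \<longrightarrow> e (g2 (F False t y)) \<noteq> 0"
  proof -
    have "((\<lambda>t. F False t y) \<longlongrightarrow> y) (at_right 0)"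
    proof (rule tendstoI, unfold eventually_at_right_field)
      fix r :: real assume "r > 0"
      define K where "K = norm (B False y) + C * norm y + 1"
      have K: "K > 0" using C0 by (simp add: K_def add_nonneg_pos)
      show "\<exists>c>0. \<forall>t>0. t < c \<longrightarrow> dist (F False t y) y < r"
      proof (intro exI conjI allI impI)
        show "min 1 (r / K) > 0" using K \<open>r > 0\<close> by simp
        fix t :: real assume t: "0 < t" "t < min 1 (r / K)"
        have "norm (F False t y - y) \<le> norm (F False t y - y - t *\<^sub>R B False y) + norm (t *\<^sub>R B False y)"
          by (metis diff_add_cancel norm_triangle_ineq)
        also have "\<dots> \<le> C * t\<^sup>2 * norm y + t * norm (B False y)"
          using taylor[of t False y] t by simp
        also have "C * t\<^sup>2 * norm y \<le> C * t * norm y"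
          using t C0 by (intro mult_right_mono mult_left_mono) (auto simp: power2_eq_square)
        finally have "norm (F False t y - y) \<le> t * (K - 1)" by (simp add: K_def algebra_simps)
        also have "\<dots> < t * K" using t by simp
        also have "\<dots> < r" using t K by (simp add: pos_less_divide_eq)
        finally show "dist (F False t y) y < r" by (simp add: dist_norm)
      qed
    qed
    then have "((\<lambda>t. e (g2 (F False t y))) \<longlongrightarrow> e (g2 y)) (at_right 0)"
      by (intro tendsto_intros)
    from tendsto_imp_eventually_ne[OF this g2(2)] show ?thesis
      unfolding eventually_at_right_field by auto
  qed
  then obtain \<eta> where \<eta>: "\<eta> > 0" "\<And>t. 0 < t \<Longrightarrow> t < \<eta> \<Longrightarrow> e (g2 (F False t y)) \<noteq> 0" by blast
  have "(e o\<^sub>L g2) y \<noteq> 0" using g2 by simp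
  then have "e o\<^sub>L g2 \<noteq> 0" by (metis blinfun.zero_left)
  from cyc[OF this \<eta>(1)] obtain t0 where t0: "0 < t0" "t0 < \<eta>" "e (g2 (F False t0 b)) \<noteq> 0" by auto
  define g where "g = g2 o\<^sub>L F False t0"
  have g: "g \<in> H" "e (g b) \<noteq> 0" "e (g (g' x)) \<noteq> 0"
    using H_comp[OF g2(1) F_H] t0 \<eta>(2)[OF t0(1,2)] by (auto simp: g_def y_def)
  have sandwich: "X o\<^sub>L h o\<^sub>L e \<in> S" if "X \<in> S" "h \<in> H" for X h
  proof -
    have "X o\<^sub>L (P o\<^sub>L h o\<^sub>L P) o\<^sub>L e \<in> S" by (intro S_comp S_base that eS)
    moreover have "X o\<^sub>L (P o\<^sub>L h o\<^sub>L P) o\<^sub>L e = X o\<^sub>L h o\<^sub>L e"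
      by (auto intro!: blinfun_eqI simp: S_P[OF eS] S_P[OF that(1)])
    ultimately show ?thesis by simp
  qed
  have sandwich_D: "X o\<^sub>L h o\<^sub>L e \<in> M.D" if "X \<in> M.D" "h \<in> H" "(X o\<^sub>L h o\<^sub>L e) z \<noteq> 0" for X h z
  proof -
    have "X o\<^sub>L h o\<^sub>L e \<noteq> 0" using that(3) by (metis blinfun.zero_left)
    then show ?thesis
      using sandwich[of X h] that(1,2) eD by (auto simp: M.D_def)
  qed
  define X0 where "X0 = e o\<^sub>L (g o\<^sub>L g') o\<^sub>L e"
  have X0: "X0 \<in> M.D" unfolding X0_def
    by (rule sandwich_D[OF eD H_comp[OF g(1) g'(1)], of x]) (use g eE[OF x(1)] in simp)
  obtain X' where X': "X' \<in> M.D" "\<And>z. z \<in> M.E \<Longrightarrow> X' (X0 z) = z" using M.D_inverse[OF X0] by blast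
  \<comment> \<open>Composing with the inverse of \<open>X0\<close> normalises the sandwich:
    \<open>G\<close> after \<open>g'\<close> is the identity on \<open>E\<close>, so
    \<open>Y i 0\<close> is the identity there.\<close>
  define Q where "Q = X' o\<^sub>L e"
  have QD: "Q \<in> M.D" unfolding Q_def by (intro M.D_comp X' eD)
  define G where "G = Q o\<^sub>L g"
  have Gg': "G (g' z) = z" if "z \<in> M.E" for z
    using X'(2)[OF that] eE[OF that] by (simp add: G_def Q_def X0_def)
  define u where "u = G b"
  have u: "u \<in> M.E" "u \<noteq> 0"
    using M.D_nonzero[OF X'(1) e_range g(2)] QD by (auto simp: u_def G_def Q_def M.D_def)
  define w where "w z = k \<bullet> g' z" for z
  have w: "bounded_linear w"
    unfolding w_def by (intro bounded_linear_inner_right_comp blinfun.bounded_linear_right)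
  interpret w: bounded_linear w by (rule w)
  obtain Kw where Kw: "Kw > 0" "\<And>z. \<bar>w z\<bar> \<le> norm z * Kw" using w.pos_bounded by auto
  define Y where "Y i t = Q o\<^sub>L (g o\<^sub>L (F i t o\<^sub>L g')) o\<^sub>L e" for i t
  have Yz: "Y i t z = G (F i t (g' z))" if "z \<in> M.E" for i t z
    using eE[OF that] by (simp add: Y_def G_def)
  define C1 where "C1 = norm G * (C * norm g')"
  have C1: "C1 \<ge> 0" using C0 by (simp add: C1_def)
  have est: "norm (Y i t z - z - t *\<^sub>R G (B i (g' z))) \<le> C1 * t\<^sup>2 * norm z"
    if t: "0 \<le> t" "t \<le> 1" and z: "z \<in> M.E" for i t z
  proof -
    have "Y i t z - z - t *\<^sub>R G (B i (g' z)) = G (F i t (g' z) - g' z - t *\<^sub>R B i (g' z))"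
      by (simp add: Yz[OF z] blinfun.diff_right blinfun.scaleR_right Gg'[OF z])
    also have "norm \<dots> \<le> norm G * (C * t\<^sup>2 * norm (g' z))"
      by (rule order_trans[OF norm_blinfun mult_left_mono[OF taylor[OF t]]]) simp
    also have "\<dots> \<le> norm G * (C * t\<^sup>2 * (norm g' * norm z))"
      using C0 by (intro mult_left_mono norm_blinfun) auto
    finally show ?thesis by (simp add: C1_def mult_ac)
  qed
  define L where "L = norm G * ((norm (B False) + norm (B True)) * norm g') + C1"
  have L: "L \<ge> 0" using C1 by (simp add: L_def)
  have est1: "norm (Y i t z - z) \<le> L * t * norm z" if t: "0 \<le> t" "t \<le> 1" and z: "z \<in> M.E" for i t z
  proof -
    have "norm (Y i t z - z) \<le> norm (Y i t z - z - t *\<^sub>R G (B i (g' z))) + norm (t *\<^sub>R G (B i (g' z)))"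
      by (metis diff_add_cancel norm_triangle_ineq)
    also have "norm (t *\<^sub>R G (B i (g' z))) \<le> t * (norm G * ((norm (B False) + norm (B True)) * (norm g' * norm z)))"
    proof -
      have "norm (G (B i (g' z))) \<le> norm G * (norm (B i) * (norm g' * norm z))"
        by (meson mult_left_mono norm_blinfun norm_ge_zero order_trans)
      also have "\<dots> \<le> norm G * ((norm (B False) + norm (B True)) * (norm g' * norm z))"
        by (intro mult_left_mono mult_right_mono) (cases i; auto)+
      finally show ?thesis using t by (simp add: mult_left_mono)
    qed
    also have "norm (Y i t z - z - t *\<^sub>R G (B i (g' z))) \<le> C1 * t * norm z"
      using est[OF t z, of i] t C1
      by (elim order_trans) (intro mult_right_mono mult_left_mono, auto simp: power2_eq_square mult_left_le)
    finally show ?thesis by (simp add: L_def algebra_simps)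
  qed
  \<comment> \<open>Up to this time \<open>Y i t\<close> differs from the identity on
    \<open>E\<close> by at most 1/2, hence is nonzero and lies in the group.\<close>
  define \<tau> where "\<tau> = min 1 (1 / (2 * (L + 1)))"
  have \<tau>: "\<tau> > 0" using L by (simp add: \<tau>_def)
  have small: "L * t \<le> 1 / 2" "t \<le> 1" if "t \<le> \<tau>" "0 \<le> t" for t
  proof -
    have "L * t \<le> L * (1 / (2 * (L + 1)))" using that L by (intro mult_left_mono) (auto simp: \<tau>_def)
    also have "\<dots> \<le> 1 / 2" using L by (simp add: field_simps)
    finally show "L * t \<le> 1 / 2" .
    show "t \<le> 1" using that by (simp add: \<tau>_def)
  qed
  have half: "norm z \<le> 2 * norm (Y i t z)" if t: "0 \<le> t" "t \<le> \<tau>" and z: "z \<in> M.E" for i t z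
  proof -
    have "norm (Y i t z - z) \<le> 1 / 2 * norm z"
      using est1[OF t(1) small(2)[OF t(2,1)] z, of i] mult_right_mono[OF small(1)[OF t(2,1)], of "norm z"] by simp
    then show ?thesis using norm_triangle_ineq2[of z "Y i t z"] by (simp add: norm_minus_commute)
  qed
  have YD: "Y i t \<in> M.D" if t: "0 \<le> t" "t \<le> \<tau>" for i t
    unfolding Y_def
    by (rule sandwich_D[OF QD, of _ x]) (use half[OF t x(1), of i] x(2) in \<open>auto intro!: H_comp F_H g g' t simp: Y_def\<close>)
  define C2 where "C2 i = \<bar>\<delta> i\<bar> * (2 * L * Kw) * norm u + 4 * C1" for i
  \<comment> \<open>The element is \<open>Y (\<not> i) t\<close> after the inverse of
    \<open>Y i t\<close>. Both factors are expanded at the preimage \<open>v\<close> of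
    \<open>z\<close>; replacing \<open>w v\<close> by \<open>w z\<close> costs second order only,
    since \<open>v - z\<close> is of first order in \<open>t\<close>.\<close>
  have step: "\<exists>Z\<in>M.D. \<forall>z\<in>M.E. norm (Z z - z - (t * \<delta> i * w z) *\<^sub>R u) \<le> C2 i * t\<^sup>2 * norm z"
    if t: "0 \<le> t" "t \<le> \<tau>" for i t
  proof -
    obtain Y' where Y': "Y' \<in> M.D" "\<And>z. z \<in> M.E \<Longrightarrow> Y' (Y i t z) = z" using M.D_inverse[OF YD[OF t]] by blast
    show ?thesis
    proof (intro bexI[of _ "Y (\<not> i) t o\<^sub>L Y'"] ballI M.D_comp YD t Y')
      fix z assume z: "z \<in> M.E"
      define v where "v = Y' z"
      have v: "v \<in> M.E" "Y i t v = z"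
      proof -
        show "v \<in> M.E" using Y'(1) by (auto simp: v_def M.D_def)
        obtain z' where "z' \<in> M.E" "z = Y i t z'" using M.D_image_E[OF YD[OF t, of i]] z by blast
        then show "Y i t v = z" using Y'(2) by (simp add: v_def)
      qed
      note t1 = t(1) small(2)[OF t(2,1)]
      have nv: "norm v \<le> 2 * norm z" using half[OF t v(1), of i] v(2) by simp
      have "norm (z - v) \<le> L * t * norm v" using est1[OF t1 v(1), of i] v(2) by simp
      also have "\<dots> \<le> L * t * (2 * norm z)" using nv L t by (intro mult_left_mono) auto
      finally have vz: "norm (v - z) \<le> 2 * L * t * norm z" by (simp add: norm_minus_commute mult_ac)
      have "G (B (\<not> i) (g' v)) - G (B i (g' v)) = (\<delta> i * w v) *\<^sub>R u"
        by (simp add: blinfun.diff_right[symmetric] B_diff blinfun.scaleR_right w_def u_def)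
      then have "(Y (\<not> i) t o\<^sub>L Y') z - z - (t * \<delta> i * w z) *\<^sub>R u =
          (Y (\<not> i) t v - v - t *\<^sub>R G (B (\<not> i) (g' v))) - (Y i t v - v - t *\<^sub>R G (B i (g' v)))
          + (t * \<delta> i * w (v - z)) *\<^sub>R u"
        using v(2) by (simp add: v_def[symmetric] w.diff algebra_simps flip: scaleR_add_right scaleR_diff_right scaleR_scaleR)
      also have "norm \<dots> \<le> C1 * t\<^sup>2 * norm v + C1 * t\<^sup>2 * norm v + \<bar>t * \<delta> i * w (v - z)\<bar> * norm u"
        by (intro norm_triangle_le add_mono norm_triangle_le_diff est t1 v(1)) auto
      also have "\<dots> \<le> C1 * t\<^sup>2 * (2 * norm z) + C1 * t\<^sup>2 * (2 * norm z) + (t * \<bar>\<delta> i\<bar> * (2 * L * t * norm z * Kw)) * norm u"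
      proof (intro add_mono mult_right_mono mult_left_mono nv)
        have "\<bar>w (v - z)\<bar> \<le> 2 * L * t * norm z * Kw"
          by (rule order_trans[OF Kw(2) mult_right_mono[OF vz]]) (use Kw(1) in simp)
        then show "\<bar>t * \<delta> i * w (v - z)\<bar> \<le> t * \<bar>\<delta> i\<bar> * (2 * L * t * norm z * Kw)"
          using t by (simp add: abs_mult mult_left_mono mult.assoc)
      qed (use C1 in auto)
      also have "\<dots> = C2 i * t\<^sup>2 * norm z"
        by (simp add: C2_def power2_eq_square algebra_simps)
      finally show "norm ((Y (\<not> i) t o\<^sub>L Y') z - z - (t * \<delta> i * w z) *\<^sub>R u) \<le> C2 i * t\<^sup>2 * norm z" .
    qed
  qed
  define d where "d = \<bar>\<delta> True\<bar>"
  have d: "d > 0" using \<delta>(1)[of True] by (simp add: d_def)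
  have dd: "\<bar>\<delta> i\<bar> = d" for i using \<delta>(2)[of True] by (cases i) (auto simp: d_def)
  have "dim M.E \<le> 1"
  proof (rule M.rank_le_one[OF w u x(1)])
    show "w x \<noteq> 0" using g'(2) by (simp add: w_def)
    show "0 < d * \<tau>" using d \<tau> by simp
    show "0 \<le> C2 True / d\<^sup>2" using L C1 Kw by (simp add: C2_def)
    fix \<sigma> :: real assume \<sigma>: "\<sigma> \<noteq> 0" "\<bar>\<sigma>\<bar> < d * \<tau>"
    \<comment> \<open>Exchanging the two generators changes the sign of \<open>\<delta>\<close>, so
      positive times reach both signs of \<open>\<sigma>\<close>.\<close>
    obtain i where i: "\<sigma> = (\<bar>\<sigma>\<bar> / d) * \<delta> i"
    proof -
      have "\<delta> True = d \<and> \<delta> False = - d \<or> \<delta> True = - d \<and> \<delta> False = d"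
        using \<delta>(2)[of True] by (auto simp: d_def abs_if)
      then have "\<exists>i. \<sigma> = (\<bar>\<sigma>\<bar> / d) * \<delta> i" using d by (auto simp: abs_if intro: exI[of _ True] exI[of _ False])
      then show ?thesis using that by blast
    qed
    have "\<bar>\<sigma>\<bar> / d \<le> \<tau>" using \<sigma> d by (simp add: field_simps)
    from step[OF _ this, of i] d obtain Z where Z: "Z \<in> M.D"
      "\<And>z. z \<in> M.E \<Longrightarrow> norm (Z z - z - ((\<bar>\<sigma>\<bar> / d) * \<delta> i * w z) *\<^sub>R u) \<le> C2 i * (\<bar>\<sigma>\<bar> / d)\<^sup>2 * norm z" by auto
    have C2: "C2 i = C2 True" by (simp add: C2_def dd)
    show "\<exists>Z\<in>M.D. \<forall>z\<in>M.E. norm (Z z - z - (\<sigma> * w z) *\<^sub>R u) \<le> C2 True / d\<^sup>2 * \<sigma>\<^sup>2 * norm z"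
    proof (intro bexI[of _ Z] ballI Z(1))
      fix z assume "z \<in> M.E"
      from Z(2)[OF this, folded i, unfolded C2]
      show "norm (Z z - z - (\<sigma> * w z) *\<^sub>R u) \<le> C2 True / d\<^sup>2 * \<sigma>\<^sup>2 * norm z"
        by (simp add: power_divide)
    qed
  qed
  then show ?thesis using that[OF M.M(1) M0] by (simp add: M.E_def)
qed

end

section \<open>Growth of the flow of a single operator\<close>

lemma in_span_imageE:
  fixes f :: "nat \<Rightarrow> 'a::real_vector"
  assumes "x \<in> span (f ` {..<n})"
  obtains c where "x = (\<Sum>k<n. c k *\<^sub>R f k)"
proof -
  have "\<exists>c. x = (\<Sum>k<n. c k *\<^sub>R f k)"
    using assms
  proof (induction n arbitrary: x)
    case (Suc n)
    then obtain a where "x - a *\<^sub>R f n \<in> span (f ` {..<n})"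
      by (auto simp: lessThan_Suc span_insert)
    from Suc.IH[OF this] obtain c where c: "x - a *\<^sub>R f n = (\<Sum>k<n. c k *\<^sub>R f k)" by blast
    have "x = (\<Sum>k<Suc n. (c(n := a)) k *\<^sub>R f k)"
      using c by (simp add: algebra_simps)
    then show ?case by blast
  qed simp
  with that show ?thesis by blast
qed

lemma sum_in_span_image: "(\<Sum>k\<in>A. c k *\<^sub>R f (g k)) \<in> span (f ` B)" if "g ` A \<subseteq> B"
  using that by (intro span_sum span_scale span_base) auto

text \<open>A complex eigenvector \<open>x + i y\<close> for the eigenvalue \<open>a + i b\<close>, in real terms.\<close>

lemma invariant_subspace_eigenvector:
  fixes B :: "'a::euclidean_space \<Rightarrow>\<^sub>L 'a"
  assumes V: "subspace V" "\<And>v. v \<in> V \<Longrightarrow> B v \<in> V" and x1: "x1 \<in> V" "x1 \<noteq> 0"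
  obtains a b x y where "x \<in> V" "y \<in> V" "x \<noteq> 0"
    "B x = a *\<^sub>R x - b *\<^sub>R y" "B y = b *\<^sub>R x + a *\<^sub>R y"
proof -
  define pw where "pw k = (blinfun_apply B ^^ k) x1" for k
  have pwS: "pw (Suc k) = B (pw k)" for k by (simp add: pw_def)
  have pwV: "pw k \<in> V" for k
    by (induction k) (simp_all add: pwS V x1, simp add: pw_def x1)
  have "\<exists>n. pw n \<in> span (pw ` {..<n})"
  proof (rule ccontr)
    assume "\<not> ?thesis"
    then have nin: "pw n \<notin> span (pw ` {..<n})" for n by blast
    have "independent (pw ` {..<n}) \<and> card (pw ` {..<n}) = n" for n
    proof (induction n)
      case (Suc n)
      then show ?case
        using nin[of n] span_base[of "pw n" "pw ` {..<n}"] by (auto simp: lessThan_Suc independent_insert)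
    qed (simp add: independent_empty)
    from this[of "DIM('a) + 1"] show False using independent_bound by fastforce
  qed
  \<comment> \<open>With the least such \<open>n\<close> the relation \<open>c\<close> is the
    minimal polynomial \<open>p\<close> of \<open>B\<close> relative to \<open>x1\<close>.\<close>
  define n where "n = (LEAST n. pw n \<in> span (pw ` {..<n}))"
  have n: "pw n \<in> span (pw ` {..<n})" unfolding n_def by (rule LeastI_ex) fact
  have n_min: "pw m \<notin> span (pw ` {..<m})" if "m < n" for m
    using not_less_Least[of m] that unfolding n_def by blast
  have n0: "n > 0" using n x1 by (cases n) (auto simp: pw_def)
  obtain c where c: "pw n = (\<Sum>k<n. c k *\<^sub>R pw k)" using in_span_imageE[OF n] .
  define p where "p = monom 1 n - (\<Sum>k<n. monom (complex_of_real (c k)) k)"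
  have poly_p: "poly p z = z ^ n - (\<Sum>k<n. of_real (c k) * z ^ k)" for z
    by (simp add: p_def poly_sum poly_monom)
  have "coeff p n = 1"
    by (simp add: p_def coeff_sum)
  then have "degree p \<ge> n" by (intro le_degree) simp
  then have "\<not> (\<exists>a l. a \<noteq> 0 \<and> l = 0 \<and> p = pCons a l)" using n0 by auto
  then obtain z where z: "poly p z = 0" using fundamental_theorem_of_algebra_alt by blast
  \<comment> \<open>Horner's scheme: \<open>r 0\<close>, ..., \<open>r (n - 1)\<close> are the
    coefficients, from the top, of the quotient of \<open>p\<close> by the linear factor of its root
    \<open>z\<close>, and \<open>r n\<close> is the value of \<open>p\<close> at \<open>z\<close>.
    Applying this quotient to \<open>B\<close> and \<open>x1\<close> gives x + i y.\<close>
  define r where "r = rec_nat 1 (\<lambda>m rm. z * rm - complex_of_real (c (n - 1 - m)))"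
  have r0: "r 0 = 1" and rS: "r (Suc m) = z * r m - of_real (c (n - 1 - m))" for m
    by (simp_all add: r_def)
  have r_eq: "r m = z ^ m - (\<Sum>l<m. of_real (c (n - 1 - l)) * z ^ (m - 1 - l))" for m
  proof (induction m)
    case (Suc m)
    have "z * (\<Sum>l<m. of_real (c (n - 1 - l)) * z ^ (m - 1 - l)) = (\<Sum>l<m. of_real (c (n - 1 - l)) * z ^ (m - l))"
      unfolding sum_distrib_left
    proof (rule sum.cong)
      fix l assume "l \<in> {..<m}"
      then have "m - l = Suc (m - 1 - l)" by auto
      then show "z * (of_real (c (n - 1 - l)) * z ^ (m - 1 - l)) = of_real (c (n - 1 - l)) * z ^ (m - l)"
        by simp
    qed simp
    then have "z * r m = z ^ Suc m - (\<Sum>l<m. of_real (c (n - 1 - l)) * z ^ (m - l))"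
      by (subst Suc) (simp add: right_diff_distrib)
    then show ?case by (simp add: rS)
  qed (simp add: r0)
  have rn: "r n = 0"
  proof -
    have "(\<Sum>l<n. of_real (c (n - 1 - l)) * z ^ (n - 1 - l)) = (\<Sum>k<n. of_real (c k) * z ^ k)"
      using sum.nat_diff_reindex[of "\<lambda>k. of_real (c k) * z ^ k" n] by simp
    then show ?thesis using z by (simp add: r_eq poly_p)
  qed
  have shift: "B (\<Sum>m<n. f m *\<^sub>R pw (n - 1 - m)) = f 0 *\<^sub>R pw n + (\<Sum>m<n. f (Suc m) *\<^sub>R pw (n - 1 - m))"
    if "f n = 0" for f :: "nat \<Rightarrow> real"
  proof -
    have "B (\<Sum>m<n. f m *\<^sub>R pw (n - 1 - m)) = (\<Sum>m<n. f m *\<^sub>R pw (n - m))"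
      unfolding blinfun.sum_right blinfun.scaleR_right
    proof (rule sum.cong)
      fix m assume "m \<in> {..<n}"
      then have "n - m = Suc (n - 1 - m)" by auto
      then show "f m *\<^sub>R B (pw (n - 1 - m)) = f m *\<^sub>R pw (n - m)" by (simp add: pwS)
    qed simp
    also have "\<dots> = (\<Sum>m<Suc n. f m *\<^sub>R pw (n - m))" using that by simp
    also have "\<dots> = f 0 *\<^sub>R pw n + (\<Sum>m<n. f (Suc m) *\<^sub>R pw (n - Suc m))"
      by (subst sum.lessThan_Suc_shift) simp
    finally show ?thesis by simp
  qed
  define x where "x = (\<Sum>m<n. Re (r m) *\<^sub>R pw (n - 1 - m))"
  define y where "y = (\<Sum>m<n. Im (r m) *\<^sub>R pw (n - 1 - m))"
  have pwn: "pw n = (\<Sum>m<n. c (n - 1 - m) *\<^sub>R pw (n - 1 - m))"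
    using sum.nat_diff_reindex[of "\<lambda>k. c k *\<^sub>R pw k" n] c by simp
  have "B x = pw n + (\<Sum>m<n. Re (r (Suc m)) *\<^sub>R pw (n - 1 - m))"
    unfolding x_def using shift[of "\<lambda>m. Re (r m)"] rn r0 by simp
  also have "\<dots> = (\<Sum>m<n. Re (z * r m) *\<^sub>R pw (n - 1 - m))"
  proof -
    have "c (n - 1 - m) *\<^sub>R v + Re (r (Suc m)) *\<^sub>R v = Re (z * r m) *\<^sub>R v" for m and v :: 'a
      by (simp add: rS scaleR_add_left[symmetric])
    then show ?thesis by (subst pwn) (simp only: sum.distrib[symmetric])
  qed
  also have "\<dots> = Re z *\<^sub>R x - Im z *\<^sub>R y"
    by (simp add: x_def y_def scaleR_sum_right sum_subtractf scaleR_diff_left)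
  finally have Bx: "B x = Re z *\<^sub>R x - Im z *\<^sub>R y" .
  have "B y = (\<Sum>m<n. Im (r (Suc m)) *\<^sub>R pw (n - 1 - m))"
    unfolding y_def using shift[of "\<lambda>m. Im (r m)"] rn r0 by simp
  also have "\<dots> = (\<Sum>m<n. Im (z * r m) *\<^sub>R pw (n - 1 - m))" by (simp add: rS)
  also have "\<dots> = Im z *\<^sub>R x + Re z *\<^sub>R y"
    by (simp add: x_def y_def scaleR_sum_right sum.distrib scaleR_add_left add.commute)
  finally have By: "B y = Im z *\<^sub>R x + Re z *\<^sub>R y" .
  \<comment> \<open>The leading coefficient \<open>r 0\<close> is the real number 1, so
    \<open>x\<close> contains \<open>pw (n - 1)\<close> plus lower powers; its vanishing would
    contradict the choice of \<open>n\<close>.\<close>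
  have "x \<noteq> 0"
  proof
    assume "x = 0"
    obtain n' where n': "n = Suc n'" using n0 by (cases n) auto
    have "x = pw n' + (\<Sum>m<n'. Re (r (Suc m)) *\<^sub>R pw (n' - Suc m))"
      unfolding x_def n' by (subst sum.lessThan_Suc_shift) (simp add: r0)
    then have "pw n' = (\<Sum>m<n'. (- Re (r (Suc m))) *\<^sub>R pw (n' - Suc m))"
      using \<open>x = 0\<close> by (simp add: eq_neg_iff_add_eq_0 sum_negf)
    also have "\<dots> \<in> span (pw ` {..<n'})" by (rule sum_in_span_image) auto
    finally show False using n_min[of n'] n' by simp
  qed
  moreover have "x \<in> V" "y \<in> V"
    unfolding x_def y_def by (intro subspace_sum subspace_scale V pwV)+
  ultimately show ?thesis using that Bx By by blast
qed

section \<open>Exponential growth from spectral data\<close>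

lemma energy_bound:
  fixes \<phi> :: "real \<Rightarrow> real"
  assumes d: "\<And>t. (\<phi> has_real_derivative \<phi>' t) (at t)"
    and le: "\<And>t. t \<ge> 0 \<Longrightarrow> \<phi>' t \<le> (2 * \<kappa> - \<epsilon>) * \<phi> t + D * exp (2 * \<kappa> * t)"
    and "\<epsilon> > 0" "D \<ge> 0" "\<phi> 0 \<ge> 0" "t \<ge> 0"
  shows "\<phi> t \<le> exp (2 * \<kappa> * t) * (\<phi> 0 + D / \<epsilon>)"
proof -
  let ?c = "2 * \<kappa> - \<epsilon>"
  \<comment> \<open>The forcing has rate 2 \<kappa>, which exceeds the homogeneous rate by
    \<open>\<epsilon>\<close>; subtracting its primitive, with factor D / \<epsilon>, leaves a
    nonincreasing function.\<close>
  define h where "h t = exp (- ?c * t) * \<phi> t - D / \<epsilon> * exp (\<epsilon> * t)" for t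
  have "h t \<le> h 0"
  proof (rule DERIV_nonpos_imp_nonincreasing[OF \<open>t \<ge> 0\<close>])
    fix s :: real assume s: "0 \<le> s" "s \<le> t"
    define e where "e = exp (- ?c * s)"
    have "DERIV h s :> e * \<phi>' s + (e * (- ?c)) * \<phi> s - D / \<epsilon> * (exp (\<epsilon> * s) * \<epsilon>)"
      unfolding h_def e_def by (auto intro!: derivative_eq_intros d)
    moreover have "e * \<phi>' s \<le> e * (?c * \<phi> s + D * exp (2 * \<kappa> * s))"
      by (intro mult_left_mono le s) (simp add: e_def)
    moreover have "e * exp (2 * \<kappa> * s) = exp (\<epsilon> * s)"
      by (simp add: e_def exp_add[symmetric] algebra_simps)
    then have "e * (?c * \<phi> s + D * exp (2 * \<kappa> * s)) = e * ?c * \<phi> s + D * exp (\<epsilon> * s)"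
      by (simp only: distrib_left mult.assoc mult.left_commute[of _ D])
    moreover have "D / \<epsilon> * (exp (\<epsilon> * s) * \<epsilon>) = D * exp (\<epsilon> * s)" using \<open>\<epsilon> > 0\<close> by simp
    moreover have "(e * (- ?c)) * \<phi> s = - (e * ?c * \<phi> s)" by (simp only: mult_minus_left mult_minus_right)
    ultimately show "\<exists>y. DERIV h s :> y \<and> y \<le> 0"
      by (intro exI conjI) (assumption, linarith)
  qed
  also have "h 0 \<le> \<phi> 0" using assms by (simp add: h_def)
  finally have "exp (- ?c * t) * \<phi> t \<le> \<phi> 0 + D / \<epsilon> * exp (\<epsilon> * t)" by (simp add: h_def)
  also have "\<dots> \<le> (\<phi> 0 + D / \<epsilon>) * exp (\<epsilon> * t)"
    using assms mult_left_mono[of 1 "exp (\<epsilon> * t)" "\<phi> 0"] by (simp add: distrib_right)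
  finally have "exp (?c * t) * (exp (- ?c * t) * \<phi> t) \<le> exp (?c * t) * ((\<phi> 0 + D / \<epsilon>) * exp (\<epsilon> * t))"
    by (intro mult_left_mono) auto
  moreover have "exp (?c * t) * (exp (- ?c * t) * \<phi> t) = \<phi> t"
  proof -
    have "exp (?c * t) * exp (- ?c * t) = 1" by (simp add: exp_add[symmetric] algebra_simps)
    then show ?thesis by (simp only: mult.assoc[symmetric] mult_1)
  qed
  moreover have "exp (?c * t) * ((\<phi> 0 + D / \<epsilon>) * exp (\<epsilon> * t)) = exp (2 * \<kappa> * t) * (\<phi> 0 + D / \<epsilon>)"
  proof -
    have "exp (?c * t) * exp (\<epsilon> * t) = exp (2 * \<kappa> * t)" by (simp add: exp_add[symmetric] algebra_simps)
    then show ?thesis by (simp only: mult.commute[of _ "exp (\<epsilon> * t)"] mult.assoc[symmetric])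
  qed
  ultimately show ?thesis by (simp only:)
qed

lemma two_inner_le: "\<epsilon> > 0 \<Longrightarrow> 2 * (u \<bullet> v) \<le> \<epsilon> * (u \<bullet> u) + (v \<bullet> v) / \<epsilon>" for u v :: "'a::real_inner"
proof -
  assume "\<epsilon> > 0"
  have "0 \<le> (\<epsilon> *\<^sub>R u - v) \<bullet> (\<epsilon> *\<^sub>R u - v)" by simp
  also have "\<dots> = \<epsilon> * (\<epsilon> * (u \<bullet> u)) - 2 * \<epsilon> * (u \<bullet> v) + v \<bullet> v"
    by (simp add: inner_diff inner_commute)
  finally show ?thesis using \<open>\<epsilon> > 0\<close> by (simp add: field_simps)
qed

text \<open>The exponential exp (t B), obtained as a flow without excitation so that the calculus of
  \<open>flow\<close> applies to it.\<close>

definition expflow :: "('a::euclidean_space \<Rightarrow>\<^sub>L 'a) \<Rightarrow> real \<Rightarrow> 'a \<Rightarrow>\<^sub>L 'a" where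
  "expflow B = flow B 0 (\<lambda>_. 0)"

lemma expflow_deriv: "((\<lambda>t. expflow B t x) has_vector_derivative B (expflow B t x)) (at t)"
  using flow_ode[of 0 B 0 x t] by (simp add: expflow_def)

lemma expflow_0 [simp]: "expflow B 0 = id_blinfun"
  by (simp add: expflow_def flow_0 signal_def)

lemma expflow_eqI:
  fixes B :: "'a::euclidean_space \<Rightarrow>\<^sub>L 'a"
  assumes "\<And>t. (x has_vector_derivative B (x t)) (at t)"
  shows "x t = expflow B t (x 0)"
  using flow_constI[of 0 x B 0 t] assms by (simp add: expflow_def)

lemma flow_const: "0 \<le> c \<Longrightarrow> c \<le> 1 \<Longrightarrow> flow A N (\<lambda>_. c) t = expflow (A + c *\<^sub>R N) t"
proof (rule blinfun_eqI)
  fix x assume "0 \<le> c" "c \<le> 1"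
  then show "flow A N (\<lambda>_. c) t x = expflow (A + c *\<^sub>R N) t x"
    using expflow_eqI[of "\<lambda>t. flow A N (\<lambda>_. c) t x" "A + c *\<^sub>R N" t] flow_ode[of c A N x] flow_0[of "\<lambda>_. c" A N]
    by (simp add: signal_def)
qed

lemma expflow_commute:
  fixes B T :: "'a::euclidean_space \<Rightarrow>\<^sub>L 'a"
  assumes "\<And>v. B (T v) = T (B v)"
  shows "expflow B t (T v) = T (expflow B t v)"
proof -
  have "((\<lambda>t. T (expflow B t v)) has_vector_derivative B (T (expflow B t v))) (at t)" for t
    unfolding assms by (rule bounded_linear.has_vector_derivative[OF blinfun.bounded_linear_right expflow_deriv])
  from expflow_eqI[OF this, of t] show ?thesis by simp
qed

lemma expflow_inner_deriv:
  "((\<lambda>t. expflow B t v \<bullet> expflow B t v) has_real_derivative 2 * (expflow B t v \<bullet> B (expflow B t v))) (at t)"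
  using bounded_bilinear.has_vector_derivative[OF bounded_bilinear_inner expflow_deriv[of B v t] expflow_deriv[of B v t]]
  by (simp add: has_real_derivative_iff_has_vector_derivative inner_commute)

text \<open>Induction on the dimension takes the place of a Jordan form. The operator
  \<open>T\<close> annihilates the eigenvector and commutes with \<open>B\<close>, so its image is a
  smaller invariant subspace; the flow there enters an energy estimate as a forcing term of known
  growth.\<close>

lemma expflow_growth:
  fixes B :: "'a::euclidean_space \<Rightarrow>\<^sub>L 'a"
  assumes V: "subspace V" "\<And>v. v \<in> V \<Longrightarrow> B v \<in> V"
    and spec: "\<And>a b x y. x \<in> V \<Longrightarrow> y \<in> V \<Longrightarrow> x \<noteq> 0 \<Longrightarrow> B x = a *\<^sub>R x - b *\<^sub>R y \<Longrightarrow>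
      B y = b *\<^sub>R x + a *\<^sub>R y \<Longrightarrow> a \<le> \<rho>"
    and \<epsilon>: "\<epsilon> > 0"
  shows "\<exists>C\<ge>0. \<forall>v\<in>V. \<forall>t\<ge>0. norm (expflow B t v) \<le> C * exp ((\<rho> + \<epsilon>) * t) * norm v"
  using V spec
proof (induction "dim V" arbitrary: V rule: less_induct)
  case less
  note V = less.prems(1,2) and spec = less.prems(3)
  show ?case
  proof (cases "V \<subseteq> {0}")
    case True
    then show ?thesis by (intro exI[of _ 0]) (auto simp: blinfun.zero_right)
  next
    case False
    then obtain x1 where x1: "x1 \<in> V" "x1 \<noteq> 0" by blast
    obtain a b x y where xy: "x \<in> V" "y \<in> V" "x \<noteq> 0" "B x = a *\<^sub>R x - b *\<^sub>R y" "B y = b *\<^sub>R x + a *\<^sub>R y"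
      by (rule invariant_subspace_eigenvector[OF V x1])
    have a: "a \<le> \<rho>" by (rule spec[OF xy])
    define B1 where "B1 = B - a *\<^sub>R id_blinfun"
    have B1: "B1 v = B v - a *\<^sub>R v" for v by (simp add: B1_def blinfun.diff_left blinfun.scaleR_left)
    define T where "T = (if b = 0 then B1 else (B1 o\<^sub>L B1) + b\<^sup>2 *\<^sub>R id_blinfun)"
    have T: "T v = (if b = 0 then B1 v else B1 (B1 v) + b\<^sup>2 *\<^sub>R v)" for v
      by (simp add: T_def blinfun.add_left blinfun.scaleR_left)
    have com1: "B (B1 v) = B1 (B v)" for v by (simp add: B1 blinfun.diff_right blinfun.scaleR_right)
    have com: "B (T v) = T (B v)" for v
      by (simp add: T com1 blinfun.add_right blinfun.scaleR_right)
    have B1x: "B1 x = - b *\<^sub>R y" "B1 y = b *\<^sub>R x" by (simp_all add: B1 xy)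
    have Tx: "T x = 0" by (simp add: T B1x blinfun.scaleR_right blinfun.minus_right power2_eq_square)
    have linT: "linear (blinfun_apply T)" by (rule linear_blinfun)
    have B1V: "B1 v \<in> V" if "v \<in> V" for v
      unfolding B1 by (intro subspace_diff subspace_scale V that)
    have TV: "T v \<in> V" if "v \<in> V" for v
      unfolding T using that by (auto intro: subspace_add subspace_scale V B1V)
    define U where "U = blinfun_apply T ` V"
    have U: "subspace U" unfolding U_def by (rule linear_subspace_image[OF linT V(1)])
    have UV: "U \<subseteq> V" using TV by (auto simp: U_def)
    have UB: "B u \<in> U" if "u \<in> U" for u
      using that V(2) com by (auto simp: U_def)
    have "dim U < dim V"
    proof (rule ccontr)
      assume "\<not> dim U < dim V"
      then have "U = V" by (intro subspace_dim_equal U V UV) auto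
      then have "inj_on (blinfun_apply T) V"
        using linear_surj_on_subspace_imp_inj_on[OF linT V(1)] by (simp add: U_def)
      then show False
        using xy Tx subspace_0[OF V(1)] by (metis blinfun.zero_right inj_onD)
    qed
    have "\<exists>C\<ge>0. \<forall>u\<in>U. \<forall>t\<ge>0. norm (expflow B t u) \<le> C * exp ((\<rho> + \<epsilon>) * t) * norm u"
      by (rule less.hyps[OF \<open>dim U < dim V\<close> U UB]) (use spec UV in blast)+
    then obtain C where
      C: "C \<ge> 0" "\<And>u t. u \<in> U \<Longrightarrow> t \<ge> 0 \<Longrightarrow> norm (expflow B t u) \<le> C * exp ((\<rho> + \<epsilon>) * t) * norm u"
      by blast
    define \<kappa> where "\<kappa> = \<rho> + \<epsilon>"
    define D where "D v = (C * norm (T v))\<^sup>2 / \<epsilon>" for v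
    have D0: "D v \<ge> 0" for v using \<epsilon> by (simp add: D_def)
    have G: "(expflow B t (T v) \<bullet> expflow B t (T v)) / \<epsilon> \<le> D v * exp (2 * \<kappa> * t)" if "v \<in> V" "t \<ge> 0" for v t
    proof -
      have "(norm (expflow B t (T v)))\<^sup>2 \<le> (C * exp (\<kappa> * t) * norm (T v))\<^sup>2"
        using C(2)[of "T v" t] that by (intro power_mono) (auto simp: U_def \<kappa>_def)
      also have "\<dots> = (C * norm (T v))\<^sup>2 * exp (2 * \<kappa> * t)"
        by (simp add: power_mult_distrib exp_double[symmetric] mult_ac flip: exp_double)
      finally show ?thesis using \<epsilon> by (simp add: D_def power2_norm_eq_inner divide_right_mono)
    qed
    \<comment> \<open>For \<open>b \<noteq> 0\<close> write Y1 for the image of Y under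
      \<open>B - a\<close>. Then Y' = a Y + Y1, and Y1' = a Y1 - b^2 Y plus the forcing; the weight
      b^2 cancels the mixed products of Y and Y1 in the derivative.\<close>
    define \<phi> where "\<phi> v t = (if b = 0 then expflow B t v \<bullet> expflow B t v
      else expflow B t (B1 v) \<bullet> expflow B t (B1 v) + b\<^sup>2 * (expflow B t v \<bullet> expflow B t v))" for v t
    define \<beta> where "\<beta> = (if b = 0 then 1 else b\<^sup>2)"
    have \<beta>: "\<beta> > 0" by (simp add: \<beta>_def)
    have \<phi>_ge: "\<beta> * (norm (expflow B t v))\<^sup>2 \<le> \<phi> v t" for v t
      by (simp add: \<phi>_def \<beta>_def power2_norm_eq_inner)
    have bound: "\<phi> v t \<le> exp (2 * \<kappa> * t) * (\<phi> v 0 + D v / \<epsilon>)" if v: "v \<in> V" and t: "t \<ge> 0" for v t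
    proof -
      let ?Y = "\<lambda>t. expflow B t v" and ?Y1 = "\<lambda>t. expflow B t (B1 v)" and ?G = "\<lambda>t. expflow B t (T v)"
      define \<phi>' where "\<phi>' t = (if b = 0 then 2 * (?Y t \<bullet> B (?Y t))
        else 2 * (?Y1 t \<bullet> B (?Y1 t)) + b\<^sup>2 * (2 * (?Y t \<bullet> B (?Y t))))" for t
      have Y1: "?Y1 t = B1 (?Y t)" for t by (rule expflow_commute[OF com1])
      have GT: "?G t = T (?Y t)" for t by (rule expflow_commute[OF com])
      have BY: "B (?Y t) = a *\<^sub>R ?Y t + ?Y1 t" for t by (simp only: Y1) (simp add: B1)
      have BY1: "B (?Y1 t) = a *\<^sub>R ?Y1 t - b\<^sup>2 *\<^sub>R ?Y t + ?G t" if "b \<noteq> 0" for t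
      proof -
        have "?G t = B1 (?Y1 t) + b\<^sup>2 *\<^sub>R ?Y t" using that by (simp only: GT Y1) (simp add: T)
        then show ?thesis by (simp add: B1)
      qed
      show ?thesis
      proof (rule energy_bound[OF _ _ \<epsilon> D0 _ t])
        show "(\<phi> v has_real_derivative \<phi>' t) (at t)" for t
          unfolding \<phi>_def \<phi>'_def
          by (auto intro!: derivative_eq_intros expflow_inner_deriv)
        show "0 \<le> \<phi> v 0" using \<phi>_ge[where t = 0 and v = v] \<beta> by (meson order_trans mult_nonneg_nonneg less_imp_le zero_le_power2)
        fix t :: real assume t: "t \<ge> 0"
        have \<phi>0: "0 \<le> \<phi> v t" using \<phi>_ge[where t = t and v = v] \<beta> by (meson order_trans mult_nonneg_nonneg less_imp_le zero_le_power2)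
        have "\<phi>' t \<le> 2 * a * \<phi> v t + (\<epsilon> * \<phi> v t + (?G t \<bullet> ?G t) / \<epsilon>)"
        proof (cases "b = 0")
          case True
          have "\<phi>' t = 2 * a * (?Y t \<bullet> ?Y t) + 2 * (?Y t \<bullet> ?G t)"
            using True by (simp add: \<phi>'_def BY GT T Y1 inner_add_right algebra_simps)
          then show ?thesis using two_inner_le[OF \<epsilon>, of "?Y t" "?G t"] True by (simp add: \<phi>_def)
        next
          case False
          have "\<phi>' t = 2 * a * \<phi> v t + 2 * (?Y1 t \<bullet> ?G t)"
            using False by (simp add: \<phi>'_def \<phi>_def BY BY1 inner_add_right inner_diff_right inner_commute algebra_simps)
          moreover have "\<epsilon> * (?Y1 t \<bullet> ?Y1 t) \<le> \<epsilon> * \<phi> v t"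
            using False \<epsilon> by (intro mult_left_mono) (auto simp: \<phi>_def)
          ultimately show ?thesis using two_inner_le[OF \<epsilon>, of "?Y1 t" "?G t"] by linarith
        qed
        also have "2 * a * \<phi> v t \<le> 2 * \<rho> * \<phi> v t" using a \<phi>0 by (simp add: mult_right_mono)
        finally show "\<phi>' t \<le> (2 * \<kappa> - \<epsilon>) * \<phi> v t + D v * exp (2 * \<kappa> * t)"
          using G[OF v t] by (simp add: \<kappa>_def algebra_simps)
      qed
    qed
    define Q where "Q = ((norm B1)\<^sup>2 + b\<^sup>2 + 1 + (C * norm T)\<^sup>2 / \<epsilon>\<^sup>2) / \<beta>"
    have Q: "Q \<ge> 0" using \<beta> by (simp add: Q_def)
    have "norm (expflow B t v) \<le> sqrt Q * exp ((\<rho> + \<epsilon>) * t) * norm v" if v: "v \<in> V" and t: "t \<ge> 0" for v t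
    proof -
      have B1v: "B1 v \<bullet> B1 v \<le> (norm B1)\<^sup>2 * (norm v)\<^sup>2"
        using power_mono[OF norm_blinfun[of B1 v], of 2] by (simp add: power2_norm_eq_inner power_mult_distrib)
      have "\<phi> v 0 \<le> ((norm B1)\<^sup>2 + b\<^sup>2 + 1) * (norm v)\<^sup>2"
        using B1v inner_ge_zero[of v] by (auto simp: \<phi>_def power2_norm_eq_inner distrib_right simp del: inner_ge_zero)
      moreover have "D v / \<epsilon> \<le> (C * norm T)\<^sup>2 / \<epsilon>\<^sup>2 * (norm v)\<^sup>2"
      proof -
        have "(C * norm (T v))\<^sup>2 \<le> (C * (norm T * norm v))\<^sup>2"
          using C(1) by (intro power_mono mult_left_mono norm_blinfun) auto
        then show ?thesis using \<epsilon> by (simp add: D_def power2_eq_square divide_right_mono mult_ac)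
      qed
      ultimately have "\<phi> v 0 + D v / \<epsilon> \<le> \<beta> * Q * (norm v)\<^sup>2"
        using \<beta> by (simp add: Q_def distrib_right)
      then have "\<beta> * (norm (expflow B t v))\<^sup>2 \<le> exp (2 * \<kappa> * t) * (\<beta> * Q * (norm v)\<^sup>2)"
        using \<phi>_ge[where t = t and v = v] bound[OF v t] by (meson exp_ge_zero mult_left_mono order_trans)
      then have "(norm (expflow B t v))\<^sup>2 \<le> exp (2 * \<kappa> * t) * (Q * (norm v)\<^sup>2)"
        using \<beta> by (simp add: mult.assoc mult.left_commute[of _ \<beta>])
      also have "\<dots> = (sqrt Q * exp ((\<rho> + \<epsilon>) * t) * norm v)\<^sup>2"
      proof -
        have "exp (2 * \<kappa> * t) = (exp ((\<rho> + \<epsilon>) * t))\<^sup>2"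
          by (simp only: \<kappa>_def mult.assoc exp_double)
        then show ?thesis using Q by (simp add: power_mult_distrib)
      qed
      finally show ?thesis by (rule power2_le_imp_le) (simp add: Q)
    qed
    then show ?thesis using Q by (intro exI[of _ "sqrt Q"]) auto
  qed
qed

lemma expflow_eigenvector:
  fixes B :: "'a::euclidean_space \<Rightarrow>\<^sub>L 'a"
  assumes "B x = a *\<^sub>R x - b *\<^sub>R y" "B y = b *\<^sub>R x + a *\<^sub>R y"
  shows "expflow B t x = exp (a * t) *\<^sub>R (cos (b * t) *\<^sub>R x - sin (b * t) *\<^sub>R y)"
proof -
  let ?f = "\<lambda>t. exp (a * t) *\<^sub>R (cos (b * t) *\<^sub>R x - sin (b * t) *\<^sub>R y)"
  have "(?f has_vector_derivative B (?f t)) (at t)" for t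
  proof -
    have "(?f has_vector_derivative (exp (a * t) *\<^sub>R ((- sin (b * t) * b) *\<^sub>R x - (cos (b * t) * b) *\<^sub>R y)
      + (exp (a * t) * a) *\<^sub>R (cos (b * t) *\<^sub>R x - sin (b * t) *\<^sub>R y))) (at t)"
      by (intro has_vector_derivative_scaleR has_vector_derivative_diff has_vector_derivative_scaleR[where f' = 0 and g = "\<lambda>_. x", simplified])
        (auto intro!: derivative_eq_intros)
    also have "exp (a * t) *\<^sub>R ((- sin (b * t) * b) *\<^sub>R x - (cos (b * t) * b) *\<^sub>R y)
      + (exp (a * t) * a) *\<^sub>R (cos (b * t) *\<^sub>R x - sin (b * t) *\<^sub>R y) = B (?f t)"
      by (simp add: blinfun.scaleR_right blinfun.diff_right assms algebra_simps)
    finally show ?thesis .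
  qed
  from expflow_eqI[OF this, of t] show ?thesis by simp
qed

text \<open>The map sending x to \<open>X x\<close> divided by \<open>p \<bullet> X x\<close> is
  nearly the constant \<open>p\<close> on a small ball around \<open>p\<close>, so Brouwer gives a
  fixed point there; it is an eigenvector with eigenvalue \<open>p \<bullet> X x\<close>.\<close>

lemma rank_one_perturbation:
  fixes N0 :: "'a::euclidean_space \<Rightarrow>\<^sub>L 'a"
  assumes N0: "\<And>x. N0 x = (g \<bullet> x) *\<^sub>R p" and p: "norm p = 1" and gp: "g \<bullet> p \<noteq> 0"
  shows "\<exists>\<eta>>0. \<forall>X. norm (X - N0) < \<eta> \<longrightarrow> (\<exists>x z. x \<noteq> 0 \<and> X x = z *\<^sub>R x \<and> \<bar>z\<bar> \<ge> \<bar>g \<bullet> p\<bar> / 4)"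
proof -
  define \<nu> where "\<nu> = \<bar>g \<bullet> p\<bar>"
  have \<nu>: "\<nu> > 0" using gp by (simp add: \<nu>_def)
  define r where "r = min (1/2) (\<nu> / (2 * (norm g + 1)))"
  have r: "r > 0" "r \<le> 1/2"
    using \<nu> by (simp add: r_def add_nonneg_pos) (simp only: r_def min.cobounded1)
  have "r \<le> \<nu> / (2 * (norm g + 1))" by (simp only: r_def min.cobounded2)
  moreover have "2 * (norm g + 1) > 0" by (simp add: add_nonneg_pos)
  ultimately have "r * (2 * (norm g + 1)) \<le> \<nu>" by (simp only: pos_le_divide_eq)
  then have gr: "norm g * r \<le> \<nu> / 2" using r(1) by (simp add: algebra_simps)
  \<comment> \<open>The radius \<open>r\<close> keeps \<open>\<bar>g \<bullet> x\<bar>\<close> above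
    \<nu> / 2 on the ball. As vectors there have norm at most 3/2, the factor 1/12 makes the
    perturbation at most r \<nu> / 8.\<close>
  define \<eta> where "\<eta> = \<nu> * r / 12"
  have \<eta>: "\<eta> > 0" using \<nu> r by (simp add: \<eta>_def)
  show ?thesis
  proof (intro exI[of _ \<eta>] conjI allI impI \<eta>)
    fix X assume X: "norm (X - N0) < \<eta>"
    have est: "\<bar>p \<bullet> X x\<bar> \<ge> \<nu> / 4" "norm (X x - (p \<bullet> X x) *\<^sub>R p) \<le> r * (\<nu> / 4)" if x: "x \<in> cball p r" for x
    proof -
      have xp: "norm (x - p) \<le> r" using x by (simp add: dist_norm norm_minus_commute)
      then have "norm x \<le> 3 / 2" using norm_triangle_sub[of x p] p r by simp
      then have d: "norm ((X - N0) x) \<le> \<eta> * (3 / 2)"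
        using norm_blinfun[of "X - N0" x] X
        by (smt (verit) mult_mono norm_ge_zero)
      then have pd: "\<bar>p \<bullet> (X - N0) x\<bar> \<le> \<eta> * (3 / 2)"
        using Cauchy_Schwarz_ineq2[of p "(X - N0) x"] p by simp
      have pX: "p \<bullet> X x = g \<bullet> x + p \<bullet> (X - N0) x"
        using p by (simp add: blinfun.diff_left N0 inner_diff_right dot_square_norm)
      have "\<bar>g \<bullet> (x - p)\<bar> \<le> \<nu> / 2"
        using Cauchy_Schwarz_ineq2[of g "x - p"] mult_left_mono[OF xp, of "norm g"] gr by simp
      then have "\<bar>g \<bullet> x\<bar> \<ge> \<nu> / 2" unfolding \<nu>_def inner_diff_right by linarith
      moreover have e: "\<eta> * (3 / 2) = r * (\<nu> / 8)" by (simp add: \<eta>_def)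
      moreover have "r * (\<nu> / 8) \<le> 1 / 2 * (\<nu> / 8)" using r \<nu> by (intro mult_right_mono) auto
      ultimately show "\<bar>p \<bullet> X x\<bar> \<ge> \<nu> / 4" using pd pX \<nu> by linarith
      have "X x - (p \<bullet> X x) *\<^sub>R p = (X - N0) x - (p \<bullet> (X - N0) x) *\<^sub>R p"
        using pX by (simp add: blinfun.diff_left N0 algebra_simps)
      also have "norm \<dots> \<le> norm ((X - N0) x) + \<bar>p \<bullet> (X - N0) x\<bar>"
        using norm_triangle_ineq4[of "(X - N0) x" "(p \<bullet> (X - N0) x) *\<^sub>R p"] p by simp
      also have "\<dots> \<le> r * (\<nu> / 4)" using d pd e by simp
      finally show "norm (X x - (p \<bullet> X x) *\<^sub>R p) \<le> r * (\<nu> / 4)" .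
    qed
    define f where "f x = (1 / (p \<bullet> X x)) *\<^sub>R X x" for x
    have nz: "p \<bullet> X x \<noteq> 0" if "x \<in> cball p r" for x using est(1)[OF that] \<nu> by auto
    have "f \<in> cball p r \<rightarrow> cball p r"
    proof (rule Pi_I)
      fix x assume x: "x \<in> cball p r"
      have "f x - p = (1 / (p \<bullet> X x)) *\<^sub>R (X x - (p \<bullet> X x) *\<^sub>R p)"
        using nz[OF x] by (simp add: f_def scaleR_diff_right)
      then have "norm (f x - p) = norm (X x - (p \<bullet> X x) *\<^sub>R p) / \<bar>p \<bullet> X x\<bar>" by simp
      also have "\<dots> \<le> (r * (\<nu> / 4)) / (\<nu> / 4)"
        using est[OF x] \<nu> r by (intro frac_le) auto
      finally show "f x \<in> cball p r" using \<nu> by (simp add: dist_norm norm_minus_commute)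
    qed
    moreover have "continuous_on (cball p r) f"
      unfolding f_def using nz by (intro continuous_intros) auto
    ultimately obtain x where x: "x \<in> cball p r" "f x = x"
      using brouwer_ball[OF r(1)] by blast
    have "x \<noteq> 0" using x(1) p r by (auto simp: dist_norm)
    moreover have "X x = (p \<bullet> X x) *\<^sub>R x"
      using arg_cong[OF x(2), of "\<lambda>v. (p \<bullet> X x) *\<^sub>R v"] nz[OF x(1)] by (simp add: f_def)
    ultimately show "\<exists>x z. x \<noteq> 0 \<and> X x = z *\<^sub>R x \<and> \<bar>z\<bar> \<ge> \<bar>g \<bullet> p\<bar> / 4"
      using est(1)[OF x(1)] by (auto simp: \<nu>_def)
  qed
qed

section \<open>Persistently exciting signals\<close>

lemma signal_integrable: "signal \<alpha> \<Longrightarrow> \<alpha> integrable_on {s..t}"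
  using vf_integrable[of \<alpha> s t "\<lambda>_. 1::real" 0 id_blinfun] by (simp add: vf_def)

lemma signal_absolutely_integrable: "signal \<alpha> \<Longrightarrow> \<alpha> absolutely_integrable_on {s..t}"
  using vf_absolutely_integrable[of \<alpha> s t "\<lambda>_. 1::real" 0 id_blinfun] by (simp add: vf_def)

lemma PE_iff: "\<alpha> \<in> PE T \<mu> \<longleftrightarrow> signal \<alpha> \<and> (\<forall>t. \<mu> \<le> integral {t..t + T} \<alpha>)"
proof -
  have "(LINT s:{t..t + T}|lebesgue. \<alpha> s) = integral {t..t + T} \<alpha>" if "signal \<alpha>" for t
    by (rule set_lebesgue_integral_eq_integral(2)[OF signal_absolutely_integrable[OF that]])
  then show ?thesis unfolding PE_def signal_def by auto
qed

lemma PE_signal: "\<alpha> \<in> PE T \<mu> \<Longrightarrow> signal \<alpha>"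
  by (simp add: PE_iff)

lemma integral_shift_signal:
  assumes "signal \<alpha>"
  shows "integral {s..t} (\<lambda>r. \<alpha> (r + c)) = integral {s + c..t + c} \<alpha>"
proof -
  have "(\<alpha> has_integral integral {s + c..t + c} \<alpha>) (cbox (s + c) (t + c))"
    using signal_integrable[OF assms] by (simp add: integrable_integral box_real)
  from has_integral_affinity'[OF this, of 1 c] show ?thesis
    by (simp add: box_real integral_unique)
qed

lemma PE_shift: "\<alpha> \<in> PE T \<mu> \<Longrightarrow> (\<lambda>r. \<alpha> (r + c)) \<in> PE T \<mu>"
  unfolding PE_iff
proof (intro conjI allI signal_shift)
  fix t assume \<alpha>: "signal \<alpha> \<and> (\<forall>t. \<mu> \<le> integral {t..t + T} \<alpha>)"
  then have "\<mu> \<le> integral {t + c..t + c + T} \<alpha>" by blast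
  then show "\<mu> \<le> integral {t..t + T} (\<lambda>r. \<alpha> (r + c))"
    using integral_shift_signal[of \<alpha> t "t + T" c] \<alpha> by (simp add: algebra_simps)
qed auto

lemma PE_reflect:
  assumes "\<alpha> \<in> PE T \<mu>"
  shows "(\<lambda>r. \<alpha> (- r)) \<in> PE T \<mu>"
  unfolding PE_iff
proof (intro conjI allI signal_reflect PE_signal[OF assms])
  fix t
  have "integral {- (t + T)..- t} \<alpha> = integral {t..t + T} (\<lambda>r. \<alpha> (- r))"
    using Henstock_Kurzweil_Integration.integral_reflect_real[where f = "\<lambda>r. \<alpha> (- r)" and a = t and b = "t + T"] by simp
  moreover have "\<mu> \<le> integral {- (t + T)..- (t + T) + T} \<alpha>" using assms by (simp only: PE_iff)
  ultimately show "\<mu> \<le> integral {t..t + T} (\<lambda>r. \<alpha> (- r))" by simp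
qed

lemma borel_signal: "\<alpha> \<in> borel_measurable borel \<Longrightarrow> (\<And>t. 0 \<le> \<alpha> t \<and> \<alpha> t \<le> 1) \<Longrightarrow> signal \<alpha>"
  by (simp add: signal_def measurable_completion)

text \<open>Borel functions compose without further argument with the map folding the line onto one
  period. The clamp to [0, 1] changes values only on the exceptional null set.\<close>

lemma signal_borel_version:
  assumes "signal \<alpha>"
  obtains \<beta> Z where "\<beta> \<in> borel_measurable borel" "\<And>t. 0 \<le> \<beta> t \<and> \<beta> t \<le> 1"
    "negligible Z" "\<And>t. t \<notin> Z \<Longrightarrow> \<alpha> t = \<beta> t"
proof -
  have "\<alpha> \<in> borel_measurable (completion lborel)" using assms by (simp add: signal_def)
  from completion_ex_borel_measurable_real[OF this]
  obtain g where g: "g \<in> borel_measurable lborel" "AE x in lborel. \<alpha> x = g x" by blast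
  from g(2) obtain Z where Z: "{x \<in> space lborel. \<not> \<alpha> x = g x} \<subseteq> Z" "emeasure lborel Z = 0" "Z \<in> sets lborel"
    by (rule AE_E)
  have nZ: "negligible Z"
    using Z(2,3) by (simp add: negligible_iff_null_sets null_setsI null_sets_completionI)
  show ?thesis
  proof
    show "(\<lambda>t. max 0 (min 1 (g t))) \<in> borel_measurable borel" using g(1) by measurable
    show "negligible Z" by (rule nZ)
    show "\<alpha> t = max 0 (min 1 (g t))" if "t \<notin> Z" for t
    proof -
      have "\<alpha> t = g t" using that Z(1) by auto
      then show ?thesis using signalD[OF assms, of t] by auto
    qed
  qed auto
qed

section \<open>Concatenation and periodic extension of signals\<close>

definition then_signal :: "real \<Rightarrow> (real \<Rightarrow> real) \<Rightarrow> (real \<Rightarrow> real) \<Rightarrow> real \<Rightarrow> real" where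
  "then_signal s \<alpha> \<beta> r = (if r < s then \<alpha> r else \<beta> (r - s))"

lemma borel_then_signal:
  "\<alpha> \<in> borel_measurable borel \<Longrightarrow> \<beta> \<in> borel_measurable borel \<Longrightarrow> then_signal s \<alpha> \<beta> \<in> borel_measurable borel"
  unfolding then_signal_def[abs_def]
  by (rule measurable_If) (auto intro: measurable_compose[where g = \<beta>])

lemma flow_then_signal:
  assumes "signal \<alpha>" "signal \<beta>" "signal (then_signal s \<alpha> \<beta>)" "0 \<le> s" "0 \<le> t"
  shows "flow A N (then_signal s \<alpha> \<beta>) (s + t) = flow A N \<beta> t o\<^sub>L flow A N \<alpha> s"
proof -
  have 1: "flow A N (then_signal s \<alpha> \<beta>) s = flow A N \<alpha> s"
    by (rule flow_cong[OF assms(3,1) negligible_sing[of s] assms(4)]) (auto simp: then_signal_def)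
  have 2: "flow A N (\<lambda>r. then_signal s \<alpha> \<beta> (r + s)) t = flow A N \<beta> t"
    by (rule flow_cong[OF signal_shift[OF assms(3)] assms(2) negligible_empty assms(5)]) (auto simp: then_signal_def)
  show ?thesis using flow_add[OF assms(3), of A N s t] by (simp add: 1 2)
qed

text \<open>Periodic extension of the signal \<open>\<alpha>\<close> on \<open>[0, t0)\<close> followed by 1 for a time \<open>T\<close>, by \<open>\<eta>\<close>
  for a time \<open>R\<close>, and again by 1 for a time \<open>T\<close>. A window of length \<open>T\<close> cannot meet both a copy of
  the block \<open>\<alpha>\<close> and a copy of the block \<open>\<eta>\<close>, which is why the extension is persistently exciting.\<close>

lemma periodic_PE_signal:
  assumes \<mu>: "0 < \<mu>" "\<mu> \<le> T" and \<alpha>: "\<alpha> \<in> PE T \<mu>" and "0 \<le> t0" "0 \<le> R"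
    and \<eta>: "\<eta> \<in> borel_measurable borel" "\<And>s. \<mu> / T \<le> \<eta> s \<and> \<eta> s \<le> 1"
  obtains \<gamma> where "\<gamma> \<in> PE T \<mu>" "\<And>s. \<gamma> (s + (t0 + 2 * T + R)) = \<gamma> s"
    "flow A N \<gamma> (t0 + 2 * T + R) =
      flow A N (\<lambda>_. 1) T o\<^sub>L flow A N \<eta> R o\<^sub>L flow A N (\<lambda>_. 1) T o\<^sub>L flow A N \<alpha> t0"
proof -
  have T: "T > 0" using \<mu> by simp
  obtain \<beta> Z where \<beta>: "\<beta> \<in> borel_measurable borel" "\<And>t. 0 \<le> \<beta> t \<and> \<beta> t \<le> 1"
    and Z: "negligible Z" "\<And>t. t \<notin> Z \<Longrightarrow> \<alpha> t = \<beta> t"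
    using signal_borel_version[OF PE_signal[OF \<alpha>]] by blast
  have s\<beta>: "signal \<beta>" by (rule borel_signal[OF \<beta>])
  have flow\<beta>: "flow A N \<beta> t0 = flow A N \<alpha> t0"
    by (rule flow_cong[OF s\<beta> PE_signal[OF \<alpha>] Z(1) \<open>0 \<le> t0\<close>]) (use Z(2) in auto)
  have \<beta>PE: "\<mu> \<le> integral {t..t + T} \<beta>" for t
  proof -
    have "integral {t..t + T} \<beta> = integral {t..t + T} \<alpha>"
      by (rule integral_spike[OF Z(1)]) (use Z(2) in auto)
    then show ?thesis using \<alpha> by (simp add: PE_iff)
  qed
  have \<eta>0: "0 \<le> \<eta> s" for s using \<eta>(2)[of s] \<mu> by (meson divide_nonneg_nonneg less_imp_le order_trans)
  have s\<eta>: "signal \<eta>" using \<eta> \<eta>0 by (intro borel_signal) auto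
  have s1: "signal (\<lambda>_. 1)" by (simp add: signal_def)
  define \<gamma>2 where "\<gamma>2 = then_signal R \<eta> (\<lambda>_. 1)"
  define \<gamma>1 where "\<gamma>1 = then_signal T (\<lambda>_. 1) \<gamma>2"
  define \<gamma>0 where "\<gamma>0 = then_signal t0 \<beta> \<gamma>1"
  have m: "\<gamma>2 \<in> borel_measurable borel" "\<gamma>1 \<in> borel_measurable borel" "\<gamma>0 \<in> borel_measurable borel"
    unfolding \<gamma>0_def \<gamma>1_def \<gamma>2_def by (intro borel_then_signal \<beta> \<eta> borel_measurable_const)+
  have r2: "0 \<le> \<gamma>2 s \<and> \<gamma>2 s \<le> 1" and r1: "0 \<le> \<gamma>1 s \<and> \<gamma>1 s \<le> 1" and r0: "0 \<le> \<gamma>0 s \<and> \<gamma>0 s \<le> 1" for s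
    using \<beta>(2) \<eta>(2) \<eta>0 by (auto simp: \<gamma>0_def \<gamma>1_def \<gamma>2_def then_signal_def)
  have s: "signal \<gamma>2" "signal \<gamma>1" "signal \<gamma>0"
    using m r0 r1 r2 by (auto intro: borel_signal)
  define \<tau> where "\<tau> = t0 + 2 * T + R"
  have \<tau>: "\<tau> > 0" using T assms by (simp add: \<tau>_def)
  define \<gamma> where "\<gamma> s = \<gamma>0 (s - \<tau> * of_int \<lfloor>s / \<tau>\<rfloor>)" for s
  have s\<gamma>: "signal \<gamma>"
  proof (rule borel_signal)
    show "\<gamma> \<in> borel_measurable borel"
      unfolding \<gamma>_def by (rule measurable_compose[OF _ m(3)]) measurable
  qed (simp add: \<gamma>_def r0)
  have \<gamma>_eq: "\<gamma> s = \<gamma>0 (s - of_int m * \<tau>)" if "of_int m * \<tau> \<le> s" "s < of_int m * \<tau> + \<tau>" for s m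
  proof -
    have "\<lfloor>s / \<tau>\<rfloor> = m"
      using that \<tau> by (intro floor_unique) (auto simp: field_simps)
    then show ?thesis by (simp add: \<gamma>_def mult.commute)
  qed
  have periodic: "\<gamma> (s + \<tau>) = \<gamma> s" for s
  proof -
    have "(s + \<tau>) / \<tau> = s / \<tau> + 1" using \<tau> by (simp add: field_simps)
    then have "\<lfloor>(s + \<tau>) / \<tau>\<rfloor> = \<lfloor>s / \<tau>\<rfloor> + 1" by simp
    then show ?thesis by (simp add: \<gamma>_def algebra_simps)
  qed
  have PE: "\<mu> \<le> integral {t..t + T} \<gamma>" for t
  \<comment> \<open>If the window meets a copy of the block, \<open>\<gamma>\<close> dominates the
    corresponding translate of all of \<open>\<beta>\<close> there: they agree on the block, and the
    paddings make \<open>\<gamma>\<close> equal to 1 on the rest of the window. Otherwise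
    \<open>\<gamma>\<close> is at least \<mu> / T at every point of the window.\<close>
  proof (cases "\<exists>m::int. t < of_int m * \<tau> + t0 \<and> of_int m * \<tau> \<le> t + T")
    case True
    then obtain m :: int where m: "t < of_int m * \<tau> + t0" "of_int m * \<tau> \<le> t + T" by blast
    define c where "c = - (of_int m * \<tau>)"
    have "\<mu> \<le> integral {t + c..t + c + T} \<beta>" by (rule \<beta>PE)
    also have "\<dots> = integral {t..t + T} (\<lambda>r. \<beta> (r + c))"
      using integral_shift_signal[OF s\<beta>, of t "t + T" c] by (simp add: algebra_simps)
    also have "\<dots> \<le> integral {t..t + T} \<gamma>"
    proof (rule integral_le)
      fix s assume s: "s \<in> {t..t + T}"
      consider "s + c < 0" | "0 \<le> s + c" "s + c < t0" | "t0 \<le> s + c" by linarith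
      then show "\<beta> (s + c) \<le> \<gamma> s"
      proof cases
        case 1
        have "\<gamma> s = \<gamma>0 (s - of_int (m - 1) * \<tau>)"
          by (rule \<gamma>_eq) (use 1 s m T assms in \<open>auto simp: c_def \<tau>_def algebra_simps\<close>)
        moreover have "s - of_int (m - 1) * \<tau> \<ge> t0 + T + R"
          using s m by (simp add: c_def algebra_simps \<tau>_def)
        ultimately show ?thesis
          using \<beta>(2) assms T by (auto simp: \<gamma>0_def \<gamma>1_def \<gamma>2_def then_signal_def)
      next
        case 2
        have "\<gamma> s = \<gamma>0 (s - of_int m * \<tau>)"
          by (rule \<gamma>_eq) (use 2 T assms in \<open>auto simp: c_def \<tau>_def\<close>)
        then show ?thesis using 2 by (simp add: c_def \<gamma>0_def then_signal_def)
      next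
        case 3
        have "\<gamma> s = \<gamma>0 (s - of_int m * \<tau>)"
          by (rule \<gamma>_eq) (use 3 s m T assms in \<open>auto simp: c_def \<tau>_def\<close>)
        moreover have "s + c < t0 + T" using s m by (simp add: c_def)
        ultimately show ?thesis using 3 \<beta>(2) by (auto simp: c_def \<gamma>0_def \<gamma>1_def then_signal_def)
      qed
    qed (intro signal_integrable signal_shift s\<beta> s\<gamma>)+
    finally show ?thesis .
  next
    case False
    have "\<mu> = integral {t..t + T} (\<lambda>_. \<mu> / T)" using T by simp
    also have "\<dots> \<le> integral {t..t + T} \<gamma>"
    proof (rule integral_le)
      fix s assume s: "s \<in> {t..t + T}"
      define m where "m = \<lfloor>s / \<tau>\<rfloor>"
      have m: "of_int m * \<tau> \<le> s" "s < of_int m * \<tau> + \<tau>"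
        using floor_correct[of "s / \<tau>"] \<tau> pos_le_divide_eq[OF \<tau>, of "of_int m" s] pos_divide_less_eq[OF \<tau>, of s "of_int m + 1"]
        by (auto simp: m_def distrib_right)
      have "s - of_int m * \<tau> \<ge> t0"
        using False s m(1) by (metis (no_types, opaque_lifting) add.commute atLeastAtMost_iff diff_ge_0_iff_ge
          le_diff_eq linorder_not_le order_trans order_le_less_trans)
      then show "\<mu> / T \<le> \<gamma> s"
        using \<gamma>_eq[OF m] \<eta>(2) \<mu> T by (auto simp: \<gamma>0_def \<gamma>1_def \<gamma>2_def then_signal_def)
    qed (intro signal_integrable s\<gamma> integrable_const_ivl)+
    finally show ?thesis .
  qed
  show ?thesis
  proof
    show "\<gamma> \<in> PE T \<mu>" using s\<gamma> PE by (simp add: PE_iff)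
    show "\<gamma> (s + (t0 + 2 * T + R)) = \<gamma> s" for s using periodic by (simp add: \<tau>_def)
    have "flow A N \<gamma> \<tau> = flow A N \<gamma>0 \<tau>"
      by (rule flow_cong[OF s\<gamma> s(3) negligible_sing[of \<tau>]]) (use \<tau> \<gamma>_eq[of 0] in auto)
    also have "\<dots> = flow A N \<gamma>0 (t0 + (T + (R + T)))" by (simp add: \<tau>_def algebra_simps)
    also have "\<dots> = (flow A N (\<lambda>_. 1) T o\<^sub>L flow A N \<eta> R) o\<^sub>L flow A N (\<lambda>_. 1) T o\<^sub>L flow A N \<beta> t0"
      unfolding \<gamma>0_def
      apply (subst flow_then_signal[OF s\<beta> s(2) s(3)[unfolded \<gamma>0_def] \<open>0 \<le> t0\<close>], use T assms in simp)
      unfolding \<gamma>1_def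
      apply (subst flow_then_signal[OF s1 s(1) s(2)[unfolded \<gamma>1_def] less_imp_le[OF T]], use T assms in simp)
      unfolding \<gamma>2_def
      apply (subst flow_then_signal[OF s\<eta> s1 s(1)[unfolded \<gamma>2_def] \<open>0 \<le> R\<close>], use T in simp)
      by simp
    finally show "flow A N \<gamma> (t0 + 2 * T + R) =
      flow A N (\<lambda>_. 1) T o\<^sub>L flow A N \<eta> R o\<^sub>L flow A N (\<lambda>_. 1) T o\<^sub>L flow A N \<alpha> t0"
      by (simp add: flow\<beta> \<tau>_def)
  qed
qed

lemma flow_unexcited:
  fixes A N :: "'a::euclidean_space \<Rightarrow>\<^sub>L 'a"
  assumes \<alpha>: "signal \<alpha>" and N: "\<And>t. N (expflow A t x) = 0"
  shows "flow A N \<alpha> t x = expflow A t x"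
proof -
  have "sol_on A N \<alpha> UNIV (\<lambda>t. expflow A t x)"
    unfolding sol_on_def
  proof (intro conjI allI impI)
    show "continuous_on UNIV (\<lambda>t. expflow A t x)"
      by (intro continuous_at_imp_continuous_on ballI has_vector_derivative_continuous[OF expflow_deriv])
    fix s t :: real assume st: "s \<le> t"
    show "((\<lambda>r. vf A N (\<alpha> r) (expflow A r x)) has_integral (expflow A t x - expflow A s x)) {s..t}"
      unfolding vf_def N scaleR_zero_right add_0_right
      by (rule fundamental_theorem_of_calculus[OF st]) (use expflow_deriv has_vector_derivative_at_within in blast)
  qed
  from flow_eqI[OF \<alpha> this, of x t] show ?thesis by simp
qed

lemma flow_surj: assumes "signal \<alpha>" obtains y where "flow A N \<alpha> t y = x"
proof -
  have "flow A N \<alpha> t o\<^sub>L flow A N (\<lambda>r. \<alpha> (r + t)) (- t) = id_blinfun"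
    using flow_inverse[OF signal_shift[OF assms, of t], of A N "- t"] by simp
  from arg_cong[OF this, of "\<lambda>f. blinfun_apply f x"]
  have "flow A N \<alpha> t (flow A N (\<lambda>r. \<alpha> (r + t)) (- t) x) = x" by simp
  then show ?thesis by (rule that)
qed

text \<open>A crude bound on the solution is integrated twice. The constant does not depend on
  \<open>c\<close>, so it serves both generators \<open>B i\<close>.\<close>

lemma flow_const_taylor:
  assumes c: "0 \<le> c" "c \<le> 1" and t: "0 \<le> t" "t \<le> 1"
  shows "norm (flow A N (\<lambda>_. c) t x - x - t *\<^sub>R (A + c *\<^sub>R N) x)
    \<le> (norm A + norm N)\<^sup>2 * exp (norm A + norm N) * t\<^sup>2 * norm x"
proof (cases "t = 0")
  case False
  define L where "L = norm A + norm N"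
  define B where "B = A + c *\<^sub>R N"
  define y where "y s = flow A N (\<lambda>_. c) s x" for s
  have s: "signal (\<lambda>_. c)" using c by (simp add: signal_def)
  have y0: "y 0 = x" by (simp add: y_def flow_0[OF s])
  have y': "(y has_vector_derivative B (y s)) (at s)" for s
    unfolding y_def B_def by (rule flow_ode[OF c])
  have L: "L \<ge> 0" by (simp add: L_def)
  have "norm B \<le> norm A + norm (c *\<^sub>R N)" unfolding B_def by (rule norm_triangle_ineq)
  also have "\<dots> \<le> L" using c by (simp add: L_def mult_left_le_one_le)
  finally have BL: "norm B \<le> L" .
  have Bv: "norm (B v) \<le> L * norm v" for v
    by (rule order_trans[OF norm_blinfun mult_right_mono[OF BL]]) simp
  have ybd: "norm (y s) \<le> exp L * norm x" if "0 \<le> s" "s \<le> 1" for s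
  proof -
    have "norm (y s) \<le> norm (flow A N (\<lambda>_. c) s) * norm x" unfolding y_def by (rule norm_blinfun)
    also have "\<dots> \<le> exp (L * \<bar>s\<bar>) * norm x" unfolding L_def by (intro mult_right_mono norm_flow_le s) simp
    also have "\<dots> \<le> exp L * norm x" using that L by (intro mult_right_mono) (auto simp: mult_left_le)
    finally show ?thesis .
  qed
  have cy: "continuous_on S y" for S
    by (intro continuous_at_imp_continuous_on ballI has_vector_derivative_continuous[OF y'])
  have 1: "norm (y s - x) \<le> L * exp L * norm x * s" if "0 \<le> s" "s \<le> 1" for s
  proof (cases "s = 0")
    case False
    have "norm (y s - y 0) \<le> L * exp L * norm x * s - L * exp L * norm x * 0"
    proof (rule differentiable_bound_general[where f' = "\<lambda>s. B (y s)" and \<phi>' = "\<lambda>_. L * exp L * norm x"])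
      fix r assume r: "0 < r" "r < s"
      show "norm (B (y r)) \<le> L * exp L * norm x"
        using order_trans[OF Bv mult_left_mono[OF ybd L]] r that by (simp add: mult.assoc)
      show "((*) (L * exp L * norm x) has_vector_derivative L * exp L * norm x) (at r)"
        by (auto intro!: derivative_eq_intros simp flip: has_real_derivative_iff_has_vector_derivative)
    qed (use False that y' in \<open>auto intro!: cy continuous_intros\<close>)
    then show ?thesis by (simp add: y0)
  qed (simp add: y0)
  define f where "f s = y s - s *\<^sub>R B x" for s
  define K where "K = L * (L * exp L * norm x * t)"
  have "norm (f t - f 0) \<le> K * t - K * 0"
  proof (rule differentiable_bound_general[where f' = "\<lambda>s. B (y s) - B x" and \<phi>' = "\<lambda>_. K"])
    fix r assume r: "0 < r" "r < t"
    show "(f has_vector_derivative B (y r) - B x) (at r)"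
      unfolding f_def by (auto intro!: derivative_eq_intros y')
    have "norm (B (y r - x)) \<le> L * (L * exp L * norm x * r)"
      by (rule order_trans[OF Bv mult_left_mono[OF 1 L]]) (use r t in auto)
    also have "\<dots> \<le> K" unfolding K_def using r L by (intro mult_left_mono) auto
    finally show "norm (B (y r) - B x) \<le> K" by (simp add: blinfun.diff_right)
    show "((*) K has_vector_derivative K) (at r)"
      by (auto intro!: derivative_eq_intros simp flip: has_real_derivative_iff_has_vector_derivative)
  qed (use False t in \<open>auto simp: f_def intro!: cy continuous_intros\<close>)
  then show ?thesis
    by (simp add: f_def y0 y_def[symmetric] K_def L_def[symmetric] B_def[symmetric] power2_eq_square algebra_simps)
qed (simp add: flow_0 c signal_def)

lemma rank_le_one_form:
  fixes X :: "'a::euclidean_space \<Rightarrow>\<^sub>L 'a"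
  assumes "X \<noteq> 0" "dim (range (blinfun_apply X)) \<le> 1"
  obtains p q where "p \<in> range (blinfun_apply X)" "p \<noteq> 0" "\<forall>x. X x = (q \<bullet> x) *\<^sub>R p"
proof -
  have lin: "linear (blinfun_apply X)" by (rule linear_blinfun)
  obtain x0 where x0: "X x0 \<noteq> 0" using blinfun_nonzeroE[OF assms(1)] .
  define p where "p = X x0"
  have "span {p} = range (blinfun_apply X)"
  proof (rule subspace_dim_equal)
    show "subspace (range (blinfun_apply X))" using linear_subspace_image[OF lin subspace_UNIV] .
    then show "span {p} \<subseteq> range (blinfun_apply X)" by (intro span_minimal) (auto simp: p_def)
    show "dim (range (blinfun_apply X)) \<le> dim (span {p})"
      using assms(2) x0 by (simp add: p_def dim_span dim_insert)
  qed (rule subspace_span)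
  then have "\<exists>c. X x = c *\<^sub>R p" for x
    by (metis (no_types, lifting) rangeI span_breakdown_eq span_empty singletonD right_minus_eq)
  then obtain c where c: "\<And>x. X x = c x *\<^sub>R p" by metis
  define q where "q = (1 / (p \<bullet> p)) *\<^sub>R adjoint (blinfun_apply X) p"
  have "q \<bullet> x = c x" for x
  proof -
    have "adjoint (blinfun_apply X) p \<bullet> x = p \<bullet> X x"
      using adjoint_works[OF lin, of x p] by (simp add: inner_commute)
    then show ?thesis using x0 by (simp add: q_def c p_def[symmetric])
  qed
  with c have "X x = (q \<bullet> x) *\<^sub>R p" for x by simp
  moreover have "p \<noteq> 0" "p \<in> range (blinfun_apply X)" using x0 by (simp_all add: p_def)
  ultimately show ?thesis using that by blast
qed

section \<open>The quotient by the unobservable subspace\<close>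

text \<open>\<open>cyclic\<close> is the Kalman form of controllability; \<open>k\<close> is the
  feedback row, and \<open>N\<close> below is the rank-one operator formed from \<open>b\<close> and
  \<open>k\<close>.\<close>

locale pe_system =
  fixes A :: "'a::euclidean_space \<Rightarrow>\<^sub>L 'a" and b k :: 'a and T \<mu> :: real
  assumes \<mu>: "0 < \<mu>" "\<mu> \<le> T"
    and cyclic: "span (range (\<lambda>j. (blinfun_apply A ^^ j) b)) = UNIV"
begin

lemma T_pos: "T > 0" using \<mu> by simp

definition N :: "'a \<Rightarrow>\<^sub>L 'a" where "N = Blinfun (\<lambda>x. (k \<bullet> x) *\<^sub>R b)"

lemma N_apply [simp]: "N x = (k \<bullet> x) *\<^sub>R b"
proof -
  have "bounded_linear (\<lambda>x. (k \<bullet> x) *\<^sub>R b)"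
    by (intro bounded_linear_scaleR_const bounded_linear_inner_right)
  then show ?thesis by (simp add: N_def bounded_linear_Blinfun_apply)
qed

lemma cyclic_invariant:
  assumes "subspace Z" "b \<in> Z" "\<And>x. x \<in> Z \<Longrightarrow> A x \<in> Z"
  shows "Z = UNIV"
proof -
  have "(blinfun_apply A ^^ j) b \<in> Z" for j by (induction j) (auto simp: assms)
  then have "span (range (\<lambda>j. (blinfun_apply A ^^ j) b)) \<subseteq> Z" by (intro span_minimal assms) auto
  then show ?thesis using cyclic by auto
qed

text \<open>The unobservable subspace of the pair \<open>(k\<^sup>T, A)\<close>. On it the signal has no effect, and the
  system induced on the quotient is irreducible; \<open>P\<close> represents the quotient map.\<close>

definition V0 :: "'a set" where "V0 = {x. \<forall>j. k \<bullet> (blinfun_apply A ^^ j) x = 0}"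

lemma subspace_V0: "subspace V0"
proof -
  have "linear (blinfun_apply A ^^ j)" for j
    by (induction j) (auto simp: linear_id[unfolded id_def] blinfun.add_right blinfun.scaleR_right linear_iff)
  then show ?thesis
    by (auto simp: subspace_def V0_def linear_0 linear_add linear_cmul inner_add_right)
qed

lemma V0_A: "x \<in> V0 \<Longrightarrow> A x \<in> V0"
proof -
  assume x: "x \<in> V0"
  have "k \<bullet> (blinfun_apply A ^^ Suc j) x = 0" for j using x unfolding V0_def by blast
  moreover have "(blinfun_apply A ^^ j) (A x) = (blinfun_apply A ^^ Suc j) x" for j
    by (simp only: funpow_Suc_right comp_apply)
  ultimately show ?thesis by (simp only: V0_def mem_Collect_eq) blast
qed

lemma V0_k: "x \<in> V0 \<Longrightarrow> k \<bullet> x = 0"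
proof -
  assume "x \<in> V0"
  then have "k \<bullet> (blinfun_apply A ^^ 0) x = 0" unfolding V0_def by blast
  then show ?thesis by simp
qed

definition P :: "'a \<Rightarrow>\<^sub>L 'a" where
  "P = (SOME P. (\<forall>x. blinfun_apply P x = 0 \<longleftrightarrow> x \<in> V0) \<and> P o\<^sub>L P = P)"

lemma P: "P x = 0 \<longleftrightarrow> x \<in> V0" "P o\<^sub>L P = P"
proof -
  have "\<exists>P :: 'a \<Rightarrow>\<^sub>L 'a. (\<forall>x. blinfun_apply P x = 0 \<longleftrightarrow> x \<in> V0) \<and> P o\<^sub>L P = P"
    by (rule subspace_projection_exists[OF subspace_V0]) blast
  from someI_ex[OF this, folded P_def]
  have "(\<forall>x. P x = 0 \<longleftrightarrow> x \<in> V0) \<and> P o\<^sub>L P = P" .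
  then show "P x = 0 \<longleftrightarrow> x \<in> V0" "P o\<^sub>L P = P" by simp_all
qed

lemma P_idem: "P (P x) = P x"
  using P(2) by (metis blinfun_apply_blinfun_compose)

lemma P_compl: "x - P x \<in> V0"
  by (simp add: P(1)[symmetric] blinfun.diff_right P_idem)

text \<open>Since \<open>P\<close> after \<open>A\<close> factors through \<open>P\<close>, the
  image of the trajectory under \<open>P\<close> solves a linear equation of its own and stays 0 if
  it starts at 0.\<close>

lemma expflow_V0:
  assumes "x \<in> V0"
  shows "expflow A t x \<in> V0"
proof -
  have "P (A x) = P (A (P x))" for x
    using V0_A[OF P_compl[of x]] by (simp add: P(1)[symmetric] blinfun.diff_right)
  then have "((\<lambda>t. P (expflow A t x)) has_vector_derivative (P o\<^sub>L A) (P (expflow A t x))) (at t)" for t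
    using bounded_linear.has_vector_derivative[OF blinfun.bounded_linear_right expflow_deriv, of P A x t] by simp
  from expflow_eqI[OF this, of t] show ?thesis
    using assms by (simp add: P(1)[symmetric] blinfun.zero_right)
qed

lemma flow_V0: "signal \<alpha> \<Longrightarrow> x \<in> V0 \<Longrightarrow> flow A N \<alpha> t x = expflow A t x"
  by (rule flow_unexcited) (simp_all add: V0_k expflow_V0)

lemma flow_in_V0_iff:
  assumes "signal \<alpha>"
  shows "flow A N \<alpha> t x \<in> V0 \<longleftrightarrow> x \<in> V0"
proof
  assume "flow A N \<alpha> t x \<in> V0"
  then have "flow A N (\<lambda>r. \<alpha> (r + t)) (- t) (flow A N \<alpha> t x) \<in> V0"
    using flow_V0[OF signal_shift[OF assms]] expflow_V0 by simp
  moreover have "flow A N (\<lambda>r. \<alpha> (r + t)) (- t) (flow A N \<alpha> t x) = x"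
    using arg_cong[OF flow_inverse[OF assms], of "\<lambda>f. blinfun_apply f x"] by simp
  ultimately show "x \<in> V0" by simp
qed (use flow_V0[OF assms] expflow_V0 in auto)

text \<open>The least constant whose integral over a window of length \<open>T\<close> reaches
  \<open>\<mu>\<close>.\<close>

definition a0 :: real where "a0 = \<mu> / T"

lemma a0: "0 < a0" "a0 \<le> 1"
  using \<mu> by (auto simp: a0_def)

text \<open>The pointwise lower bound gives every window enough excitation and survives
  concatenation, so these operators form a semigroup.\<close>

definition H :: "('a \<Rightarrow>\<^sub>L 'a) set" where
  "H = {flow A N \<eta> R | \<eta> R. 0 \<le> R \<and> \<eta> \<in> borel_measurable borel \<and> (\<forall>s. a0 \<le> \<eta> s \<and> \<eta> s \<le> 1)}"

lemma H_I: "0 \<le> R \<Longrightarrow> \<eta> \<in> borel_measurable borel \<Longrightarrow> (\<And>s. a0 \<le> \<eta> s \<and> \<eta> s \<le> 1) \<Longrightarrow> flow A N \<eta> R \<in> H"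
  unfolding H_def by blast

lemma H_D:
  assumes "h \<in> H"
  shows "\<exists>\<eta> R. h = flow A N \<eta> R \<and> 0 \<le> R \<and> \<eta> \<in> borel_measurable borel \<and> (\<forall>s. a0 \<le> \<eta> s \<and> \<eta> s \<le> 1) \<and> signal \<eta>"
proof -
  obtain \<eta> R where h: "h = flow A N \<eta> R" "0 \<le> R" "\<eta> \<in> borel_measurable borel" "\<forall>s. a0 \<le> \<eta> s \<and> \<eta> s \<le> 1"
    using assms unfolding H_def by blast
  moreover have "signal \<eta>"
    using h(4) a0(1) by (intro borel_signal h(3)) (auto intro: order_trans[of 0 a0])
  ultimately show ?thesis by blast
qed

lemma H_comp:
  assumes "g \<in> H" "h \<in> H"
  shows "g o\<^sub>L h \<in> H"
proof -
  obtain \<beta> R where g: "g = flow A N \<beta> R" "0 \<le> R" "\<beta> \<in> borel_measurable borel" "\<forall>s. a0 \<le> \<beta> s \<and> \<beta> s \<le> 1" "signal \<beta>"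
    using H_D[OF assms(1)] by blast
  obtain \<alpha> S where h: "h = flow A N \<alpha> S" "0 \<le> S" "\<alpha> \<in> borel_measurable borel" "\<forall>s. a0 \<le> \<alpha> s \<and> \<alpha> s \<le> 1" "signal \<alpha>"
    using H_D[OF assms(2)] by blast
  have c: "then_signal S \<alpha> \<beta> \<in> borel_measurable borel" "a0 \<le> then_signal S \<alpha> \<beta> s \<and> then_signal S \<alpha> \<beta> s \<le> 1" for s
    using g h by (auto simp: then_signal_def intro: borel_then_signal)
  then have "signal (then_signal S \<alpha> \<beta>)"
    using a0(1) by (intro borel_signal) (auto intro: order_trans[of 0 a0])
  from flow_then_signal[OF h(5) g(5) this h(2) g(2), of A N] H_I[OF _ c, of "S + R"] show ?thesis
    using g(1,2) h(1,2) by simp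
qed

definition F :: "bool \<Rightarrow> real \<Rightarrow> 'a \<Rightarrow>\<^sub>L 'a" where
  "F i t = flow A N (\<lambda>_. if i then 1 else a0) t"

definition B :: "bool \<Rightarrow> 'a \<Rightarrow>\<^sub>L 'a" where
  "B i = A + (if i then 1 else a0) *\<^sub>R N"

lemma F_H: "0 \<le> t \<Longrightarrow> F i t \<in> H"
  unfolding F_def by (rule H_I) (use a0 in auto)

lemma id_H: "id_blinfun \<in> H"
  using F_H[of 0 True] by (simp add: F_def flow_0 signal_def)

lemma H_surj: assumes "h \<in> H" obtains y where "h y = x"
proof -
  obtain \<eta> R where "h = flow A N \<eta> R" "signal \<eta>" using H_D[OF assms] by metis
  with flow_surj that show ?thesis by metis
qed

lemma H_V0_iff: "h \<in> H \<Longrightarrow> h x \<in> V0 \<longleftrightarrow> x \<in> V0"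
  by (metis H_D flow_in_V0_iff)

lemma P_H: "h \<in> H \<Longrightarrow> P (h (P x)) = P (h x)"
  using H_V0_iff[of h "x - P x"] P_compl[of x] by (simp add: P(1)[symmetric] blinfun.diff_right)

lemma F_deriv: "((\<lambda>t. F i t x) has_vector_derivative B i (F i t x)) (at t)"
  unfolding F_def B_def by (rule flow_ode) (use a0 in auto)

lemma F_0: "F i 0 = id_blinfun"
  using a0 by (simp add: F_def flow_0 signal_def)

text \<open>With \<open>a0 < 1\<close>, a closed subspace invariant under the semigroup \<open>H\<close> is invariant under \<open>A\<close>
  and \<open>N\<close>; unless it is contained in \<open>V0\<close> it contains \<open>b\<close>.\<close>

lemma irreducible:
  assumes a1: "a0 < 1" and y: "P y \<noteq> 0" and X: "X \<noteq> 0"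
  shows "\<exists>h\<in>H. blinfun_apply (X :: 'a \<Rightarrow>\<^sub>L 'a) (h y) \<noteq> 0"
proof (rule ccontr)
  assume "\<not> ?thesis"
  then have 0: "X (h y) = 0" if "h \<in> H" for h using that by blast
  \<comment> \<open>The largest subspace of the kernel of \<open>X\<close> that is invariant under
    \<open>H\<close>.\<close>
  define Z where "Z = {x. \<forall>h\<in>H. X (h x) = 0}"
  have Z: "subspace Z"
    by (auto simp: subspace_def Z_def blinfun.zero_right blinfun.add_right blinfun.scaleR_right)
  have yZ: "y \<in> Z" using 0 by (simp add: Z_def)
  have ZH: "h x \<in> Z" if "x \<in> Z" "h \<in> H" for x h
    using that H_comp[of _ h] unfolding Z_def by fastforce
  \<comment> \<open>The generators are limits of difference quotients of elements of
    \<open>H\<close>, and a finite-dimensional subspace is closed.\<close>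
  have ZB: "B i x \<in> Z" if x: "x \<in> Z" for x i
  proof -
    let ?t = "\<lambda>n. inverse (real (Suc n))"
    define s where "s n = (1 / ?t n) *\<^sub>R (F i (?t n) x - x)" for n
    let ?K = "(norm A + norm N)\<^sup>2 * exp (norm A + norm N)"
    have le: "norm (s n - B i x) \<le> ?t n * (?K * norm x)" for n
    proof -
      have t: "0 \<le> ?t n" "?t n \<le> 1" "?t n > 0" by (auto simp: field_simps)
      have "s n - B i x = (1 / ?t n) *\<^sub>R (F i (?t n) x - x - ?t n *\<^sub>R B i x)"
        unfolding s_def scaleR_diff_right using t(3) by simp
      then have "norm (s n - B i x) = norm (F i (?t n) x - x - ?t n *\<^sub>R B i x) / ?t n"
        using t(3) by (simp add: divide_inverse)
      also have "\<dots> \<le> (?K * (?t n)\<^sup>2 * norm x) / ?t n"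
        unfolding F_def B_def
        by (rule divide_right_mono[OF flow_const_taylor]) (use a0 t in auto)
      also have "\<dots> = ?t n * (?K * norm x)" using t(3) by (simp add: power2_eq_square)
      finally show ?thesis .
    qed
    have "(\<lambda>n. s n - B i x) \<longlonglongrightarrow> 0"
    proof (rule Lim_null_comparison)
      show "\<forall>\<^sub>F n in sequentially. norm (s n - B i x) \<le> ?t n * (?K * norm x)" using le by simp
      show "(\<lambda>n. ?t n * (?K * norm x)) \<longlonglongrightarrow> 0"
        using tendsto_mult_right[OF LIMSEQ_inverse_real_of_nat, of "?K * norm x"] by simp
    qed
    then have lim: "s \<longlonglongrightarrow> B i x" by (simp add: LIM_zero_iff)
    have "s n \<in> Z" for n
      unfolding s_def by (intro subspace_scale[OF Z] subspace_diff[OF Z] ZH F_H x) simp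
    then show ?thesis using closed_sequentially[OF closed_subspace[OF Z] _ lim] by blast
  qed
  have ZN: "N x \<in> Z" if "x \<in> Z" for x
  proof -
    have "B True x - B False x = (1 - a0) *\<^sub>R N x"
      by (simp add: B_def blinfun.add_left blinfun.scaleR_left scaleR_diff_left left_diff_distrib)
    then have "N x = (1 / (1 - a0)) *\<^sub>R (B True x - B False x)" using a1 by simp
    then show ?thesis using ZB[OF that] Z by (metis subspace_diff subspace_scale)
  qed
  have ZA: "A x \<in> Z" if "x \<in> Z" for x
  proof -
    have "A x = B True x - N x" by (simp add: B_def blinfun.add_left)
    then show ?thesis using ZB[OF that] ZN[OF that] Z by (metis subspace_diff)
  qed
  obtain j where j: "k \<bullet> (blinfun_apply A ^^ j) y \<noteq> 0" using y by (auto simp: P(1) V0_def)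
  have "(blinfun_apply A ^^ j) y \<in> Z" by (induction j) (auto simp: yZ ZA)
  from ZN[OF this] have "(1 / (k \<bullet> (blinfun_apply A ^^ j) y)) *\<^sub>R N ((blinfun_apply A ^^ j) y) \<in> Z"
    by (rule subspace_scale[OF Z])
  then have "b \<in> Z" using j by simp
  from cyclic_invariant[OF Z this ZA] have "Z = UNIV" by blast
  then have "X x = 0" for x using id_H unfolding Z_def by force
  then show False using X by (metis blinfun.zero_left blinfun_eqI)
qed

text \<open>Vanishing on an interval kills all derivatives, and letting the time tend to 0 gives
  \<open>X (Bp j b) = 0\<close> for the powers \<open>Bp j\<close> of \<open>B False\<close>. The
  common kernel of these operators contains \<open>b\<close>; as \<open>B False\<close> differs from
  \<open>A\<close> by multiples of \<open>b\<close>, it is invariant under \<open>A\<close>, hence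
  the whole space.\<close>

lemma cyclic_flow:
  assumes X: "X \<noteq> 0" and \<eta>: "\<eta> > 0"
  shows "\<exists>t. 0 < t \<and> t < \<eta> \<and> blinfun_apply (X :: 'a \<Rightarrow>\<^sub>L 'a) (F False t b) \<noteq> 0"
proof (rule ccontr)
  assume "\<not> ?thesis"
  then have 0: "X (F False t b) = 0" if "0 < t" "t < \<eta>" for t using that by blast
  define Bp where "Bp j = ((\<lambda>Y. B False o\<^sub>L Y) ^^ j) id_blinfun" for j
  have Bp0: "Bp 0 = id_blinfun" by (simp add: Bp_def)
  have BpS: "Bp (Suc j) x = Bp j (B False x)" for j x
    by (induction j arbitrary: x) (auto simp: Bp_def)
  have all: "X (Bp j (F False t b)) = 0" if "0 < t" "t < \<eta>" for j t
    using that
  proof (induction j arbitrary: t)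
    case (Suc j)
    have "((\<lambda>t. (X o\<^sub>L Bp j) (F False t b)) has_vector_derivative (X o\<^sub>L Bp j) (B False (F False t b))) (at t)"
      by (rule bounded_linear.has_vector_derivative[OF blinfun.bounded_linear_right F_deriv])
    moreover have "((\<lambda>t. (X o\<^sub>L Bp j) (F False t b)) has_vector_derivative 0) (at t)"
    proof (rule has_vector_derivative_transform_within_open[of "\<lambda>_. 0" 0 t "{0<..<\<eta>}"])
      show "((\<lambda>_. 0) has_vector_derivative 0) (at t)" by simp
    qed (use Suc in auto)
    ultimately show ?case using vector_derivative_unique_at by (fastforce simp: BpS)
  qed (simp add: Bp0 0)
  have at0: "X (Bp j b) = 0" for j
  proof -
    have "isCont (\<lambda>t. F False t b) 0" by (rule has_vector_derivative_continuous[OF F_deriv])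
    then have "((\<lambda>t. F False t b) \<longlongrightarrow> F False 0 b) (at_right 0)"
      by (simp add: isCont_def filterlim_at_split)
    then have "((\<lambda>t. X (Bp j (F False t b))) \<longlongrightarrow> X (Bp j b)) (at_right 0)"
      by (intro tendsto_intros) (simp add: F_0)
    moreover have "((\<lambda>t. X (Bp j (F False t b))) \<longlongrightarrow> 0) (at_right 0)"
    proof (rule tendsto_eventually)
      show "\<forall>\<^sub>F t in at_right 0. X (Bp j (F False t b)) = 0"
        using all \<eta> unfolding eventually_at_right_field by blast
    qed
    ultimately show ?thesis using tendsto_unique trivial_limit_at_right_real by blast
  qed
  define Z where "Z = {x. \<forall>j. X (Bp j x) = 0}"
  have Z: "subspace Z"
    by (auto simp: subspace_def Z_def blinfun.zero_right blinfun.add_right blinfun.scaleR_right)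
  have bZ: "b \<in> Z" using at0 by (simp add: Z_def)
  have "A x \<in> Z" if "x \<in> Z" for x
  proof -
    have "B False x \<in> Z" using that by (simp add: Z_def flip: BpS)
    moreover have "A x = B False x - (a0 * (k \<bullet> x)) *\<^sub>R b"
      by (simp add: B_def blinfun.add_left blinfun.scaleR_left)
    ultimately show ?thesis using bZ Z by (metis subspace_diff subspace_scale)
  qed
  from cyclic_invariant[OF Z bZ this] have "x \<in> Z" for x by simp
  then have "X x = 0" for x using Bp0 unfolding Z_def by (metis (mono_tags, lifting) blinfun_apply_id_blinfun id_apply mem_Collect_eq)
  then show False using X by (metis blinfun.zero_left blinfun_eqI)
qed

lemma irreducible_system:
  assumes a1: "a0 < 1" and P0: "P \<noteq> 0"
  shows "irreducible_system H P F B ((norm A + norm N)\<^sup>2 * exp (norm A + norm N)) b k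
    (\<lambda>i. if i then a0 - 1 else 1 - a0)"
proof
  show "P (h x) \<noteq> 0" if "h \<in> H" "P x \<noteq> 0" for h x
    using that H_V0_iff P(1) by blast
  \<comment> \<open>Irreducibility applied to \<open>N\<close>, which is nonzero because
    \<open>b\<close> and \<open>k\<close> are; its value at a vector is the functional
    \<open>k\<close> times \<open>b\<close>.\<close>
  show "\<exists>h\<in>H. k \<bullet> blinfun_apply h y \<noteq> 0" if y: "P y \<noteq> 0" for y
  proof -
    obtain j where j: "k \<bullet> (blinfun_apply A ^^ j) y \<noteq> 0" using y by (auto simp: P(1) V0_def)
    have "b \<noteq> 0"
    proof
      assume "b = 0"
      then have "V0 = UNIV"
        by (intro cyclic_invariant subspace_V0 V0_A) (simp_all add: subspace_0[OF subspace_V0])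
      then show False using y by (simp add: P(1))
    qed
    moreover have "k \<noteq> 0" using j by auto
    ultimately have "N k \<noteq> 0" by simp
    then have "N \<noteq> 0" by (metis blinfun.zero_left)
    from irreducible[OF a1 y this] show ?thesis by auto
  qed
  show "norm (F i t x - x - t *\<^sub>R B i x) \<le> (norm A + norm N)\<^sup>2 * exp (norm A + norm N) * t\<^sup>2 * norm x"
    if "0 \<le> t" "t \<le> 1" for t i x
    unfolding F_def B_def by (rule flow_const_taylor) (use a0 that in auto)
  show "B (\<not> i) x - B i x = ((if i then a0 - 1 else 1 - a0) * (k \<bullet> x)) *\<^sub>R b" for i x
    by (simp add: B_def blinfun.add_left blinfun.scaleR_left algebra_simps)
qed (use a1 P0 in \<open>auto intro: H_comp id_H P P_H F_H irreducible cyclic_flow\<close>)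

end

section \<open>Growth of the excited system\<close>

lemma expflow_add: "expflow A (s + t) = expflow A s o\<^sub>L expflow A t"
  using flow_add[of "\<lambda>_. 0" A 0 t s] by (simp add: expflow_def signal_def add.commute)

lemma linear_le_exp: "\<epsilon> > 0 \<Longrightarrow> real n \<le> exp (\<epsilon> * n) / \<epsilon>"
proof -
  assume "\<epsilon> > 0"
  have "\<epsilon> * n \<le> exp (\<epsilon> * n)" using exp_ge_add_one_self[of "\<epsilon> * n"] by linarith
  then show ?thesis using \<open>\<epsilon> > 0\<close> by (simp add: field_simps)
qed

context pe_system
begin

text \<open>The pivot for comparing all rates: if the bound fails there is a sharp-admissible pair
  for each time direction, and if it holds there is a growth bound uniform over the signals.\<close>

definition eigenvalue_bound :: "real \<Rightarrow> bool" where
  "eigenvalue_bound \<rho> \<longleftrightarrow> (\<forall>\<gamma> \<tau> x z. \<gamma> \<in> PE T \<mu> \<longrightarrow> 0 < \<tau> \<longrightarrow> (\<forall>s. \<gamma> (s + \<tau>) = \<gamma> s) \<longrightarrow>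
     x \<noteq> 0 \<longrightarrow> flow A N \<gamma> \<tau> x = z *\<^sub>R x \<longrightarrow> \<bar>z\<bar> \<le> exp (\<rho> * \<tau>))"

lemma eigenvalue_boundD:
  "eigenvalue_bound \<rho> \<Longrightarrow> \<gamma> \<in> PE T \<mu> \<Longrightarrow> 0 < \<tau> \<Longrightarrow> (\<And>s. \<gamma> (s + \<tau>) = \<gamma> s) \<Longrightarrow> x \<noteq> 0 \<Longrightarrow>
    flow A N \<gamma> \<tau> x = z *\<^sub>R x \<Longrightarrow> \<bar>z\<bar> \<le> exp (\<rho> * \<tau>)"
  unfolding eigenvalue_bound_def by blast

lemma one_in_PE: "(\<lambda>_. 1) \<in> PE T \<mu>"
  using \<mu> by (simp add: PE_iff signal_def)

text \<open>Every positive number is a period of the constant signal. Choosing 2 pi / |c| removes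
  the rotation of an eigenvalue a + i c and leaves a real eigenvalue. \<open>A'\<close> stands for
  \<open>A\<close> on \<open>V0\<close>, or for \<open>A + N\<close> on the whole space.\<close>

lemma constant_growth:
  fixes A' :: "'a \<Rightarrow>\<^sub>L 'a"
  assumes eb: "eigenvalue_bound \<rho>" and V: "subspace V" "\<And>v. v \<in> V \<Longrightarrow> A' v \<in> V"
    and flow: "\<And>v t. v \<in> V \<Longrightarrow> flow A N (\<lambda>_. 1) t v = expflow A' t v" and \<epsilon>: "\<epsilon> > 0"
  shows "\<exists>C\<ge>0. \<forall>v\<in>V. \<forall>t\<ge>0. norm (expflow A' t v) \<le> C * exp ((\<rho> + \<epsilon>) * t) * norm v"
proof (rule expflow_growth[OF V _ \<epsilon>])
  fix a c x y assume xy: "x \<in> V" "y \<in> V" "x \<noteq> 0" "A' x = a *\<^sub>R x - c *\<^sub>R y" "A' y = c *\<^sub>R x + a *\<^sub>R y"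
  define \<tau> where "\<tau> = (if c = 0 then 1 else 2 * pi / \<bar>c\<bar>)"
  have \<tau>: "\<tau> > 0" by (simp add: \<tau>_def)
  have "cos (c * \<tau>) = 1 \<and> sin (c * \<tau>) = 0"
    by (cases "c = 0"; cases "c > 0") (auto simp: \<tau>_def)
  then have "expflow A' \<tau> x = exp (a * \<tau>) *\<^sub>R x"
    using expflow_eigenvector[OF xy(4,5), of \<tau>] by simp
  then have "\<bar>exp (a * \<tau>)\<bar> \<le> exp (\<rho> * \<tau>)"
    using flow[OF xy(1)] by (intro eigenvalue_boundD[OF eb one_in_PE \<tau> _ xy(3)]) auto
  then show "a \<le> \<rho>" using \<tau> by simp
qed

text \<open>If \<Psi> - z were injective, it would map the invariant subspace \<open>V0\<close> onto
  itself; a vector sent into \<open>V0\<close> would then lie in \<open>V0\<close>, against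
  \<open>P x \<noteq> 0\<close>.\<close>

lemma eigenvalue_lift:
  fixes \<Psi> :: "'a \<Rightarrow>\<^sub>L 'a"
  assumes V0: "\<And>v. v \<in> V0 \<Longrightarrow> \<Psi> v \<in> V0" and x: "P x \<noteq> 0" "P (\<Psi> x) = z *\<^sub>R P x"
  shows "\<exists>y. y \<noteq> 0 \<and> \<Psi> y = z *\<^sub>R y"
proof (rule ccontr)
  assume no: "\<not> ?thesis"
  define Q where "Q = \<Psi> - z *\<^sub>R id_blinfun"
  have Q: "Q y = \<Psi> y - z *\<^sub>R y" for y by (simp add: Q_def blinfun.diff_left blinfun.scaleR_left)
  have lin: "linear (blinfun_apply Q)" by (rule linear_blinfun)
  have inj: "inj (blinfun_apply Q)"
    unfolding linear_injective_0[OF lin] using no by (auto simp: Q)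
  have sub: "blinfun_apply Q ` V0 \<subseteq> V0"
    by (auto simp: Q intro!: subspace_diff[OF subspace_V0] subspace_scale[OF subspace_V0] V0)
  have "blinfun_apply Q ` V0 = V0"
  proof (rule subspace_dim_equal[OF linear_subspace_image[OF lin subspace_V0] subspace_V0 sub])
    show "dim V0 \<le> dim (blinfun_apply Q ` V0)"
      using dim_image_eq[OF lin inj_on_subset[OF inj subset_UNIV], of V0] by simp
  qed
  moreover have "Q x \<in> V0" using x by (simp add: P(1)[symmetric] Q blinfun.diff_right blinfun.scaleR_right)
  ultimately obtain v where "v \<in> V0" "Q x = Q v" by blast
  then have "x \<in> V0" using inj by (simp add: inj_eq)
  then show False using x by (simp add: P(1))
qed

text \<open>There is no loss in the exponent on the quotient: closing a signal up to a periodic one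
  changes the eigenvalue only by a factor that does not depend on the signal.\<close>

lemma quotient_growth:
  assumes a1: "a0 < 1" and eb: "eigenvalue_bound \<rho>"
  shows "\<exists>C. \<forall>\<alpha>\<in>PE T \<mu>. \<forall>t\<ge>0. norm (P o\<^sub>L flow A N \<alpha> t o\<^sub>L P) \<le> C * exp (\<rho> * t)"
proof (rule ccontr)
  assume "\<not> ?thesis"
  then have "\<exists>\<alpha> t. \<alpha> \<in> PE T \<mu> \<and> 0 \<le> t \<and> real n * exp (\<rho> * t) < norm (P o\<^sub>L flow A N \<alpha> t o\<^sub>L P)" for n :: nat
    by (metis linorder_not_le)
  then obtain \<alpha> t where \<alpha>: "\<And>n. \<alpha> n \<in> PE T \<mu>" and t: "\<And>n. 0 \<le> t n"
    and big: "\<And>n::nat. real n * exp (\<rho> * t n) < norm (P o\<^sub>L flow A N (\<alpha> n) (t n) o\<^sub>L P)"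
    by metis
  define Ln where "Ln n = P o\<^sub>L flow A N (\<alpha> n) (t n) o\<^sub>L P" for n
  have Ln_pos: "norm (Ln n) > 0" for n
    using big[of n] by (simp only: Ln_def[symmetric]) (meson exp_ge_zero mult_nonneg_nonneg of_nat_0_le_iff order_le_less_trans)
  define un where "un n = (1 / norm (Ln n)) *\<^sub>R Ln n" for n
  have un1: "norm (un n) = 1" for n using Ln_pos[of n] by (simp add: un_def)
  then have "bounded (range un)" by (intro boundedI[of _ 1]) auto
  from bounded_imp_convergent_subsequence[OF this] obtain L r where
    r: "strict_mono (r :: nat \<Rightarrow> nat)" and lim: "(\<lambda>n. un (r n)) \<longlonglongrightarrow> L" by (auto simp: o_def)
  have "(\<lambda>n. 1) \<longlonglongrightarrow> norm L" using tendsto_norm[OF lim] un1 by simp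
  from LIMSEQ_unique[OF this tendsto_const] have "norm L = 1" .
  then have L0: "L \<noteq> 0" by auto
  have limx: "(\<lambda>n. un (r n) x) \<longlonglongrightarrow> L x" for x using lim by (intro tendsto_intros)
  have PL: "P (L x) = L x" for x
  proof -
    have "(\<lambda>n. P (un (r n) x)) \<longlonglongrightarrow> P (L x)" by (intro tendsto_intros limx)
    moreover have "P (un (r n) x) = un (r n) x" for n
      by (simp add: un_def Ln_def blinfun.scaleR_left blinfun.scaleR_right P_idem)
    ultimately have "(\<lambda>n. un (r n) x) \<longlonglongrightarrow> P (L x)" by (simp only:)
    from LIMSEQ_unique[OF this limx] show ?thesis .
  qed
  have LP: "L (P x) = L x" for x
  proof -
    have "un (r n) (P x) = un (r n) x" for n
      by (simp add: un_def Ln_def blinfun.scaleR_left P_idem)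
    with limx[of "P x"] have "(\<lambda>n. un (r n) x) \<longlonglongrightarrow> L (P x)" by (simp only:)
    from LIMSEQ_unique[OF this limx] show ?thesis .
  qed
  have P0: "P \<noteq> 0"
  proof
    assume "P = 0"
    then have "L = 0" using PL by (intro blinfun_eqI) (metis blinfun.zero_left)
    with L0 show False by simp
  qed
  interpret I: irreducible_system H P F B "(norm A + norm N)\<^sup>2 * exp (norm A + norm N)" b k
    "\<lambda>i. if i then a0 - 1 else 1 - a0"
    by (rule irreducible_system[OF a1 P0])
  obtain X where X: "X \<in> I.S" "X \<noteq> 0" "dim (range (blinfun_apply X)) \<le> 1" by (rule I.rank_one_element)
  obtain p q where p: "p \<in> range (blinfun_apply X)" "p \<noteq> 0" and Xpq': "\<forall>x. X x = (q \<bullet> x) *\<^sub>R p"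
    by (rule rank_le_one_form[OF X(2,3)])
  note Xpq = Xpq'[rule_format]
  have Pp: "P p \<noteq> 0" using p I.S_P(1)[OF X(1)] by auto
  \<comment> \<open>The operator of each of the two padding blocks in
    \<open>periodic_PE_signal\<close>.\<close>
  define J where "J = F True T"
  have J: "J \<in> H" unfolding J_def using T_pos by (intro F_H) simp
  have LJ: "L o\<^sub>L J \<noteq> 0"
  proof
    assume 0: "L o\<^sub>L J = 0"
    obtain x where "L x \<noteq> 0" using blinfun_nonzeroE[OF L0] .
    moreover obtain y where "J y = x" using H_surj[OF J] .
    ultimately show False using arg_cong[OF 0, of "\<lambda>f. blinfun_apply f y"] by simp
  qed
  \<comment> \<open>\<open>h1\<close> and \<open>h2\<close> are chosen so that the cyclic product of
    \<open>X\<close>, \<open>L\<close>, the paddings and themselves does not vanish; it gives the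
    nonzero eigenvalue \<open>\<nu>\<close> of the rank-one operator \<open>N0\<close>.\<close>
  obtain h1 where h1: "h1 \<in> H" "L (J (h1 p)) \<noteq> 0" using irreducible[OF a1 Pp LJ] by auto
  have "P (J (L (J (h1 p)))) \<noteq> 0" by (rule I.H_inj[OF J]) (simp add: PL h1)
  from irreducible[OF a1 this X(2)] obtain h2 where h2: "h2 \<in> H" "X (h2 (J (L (J (h1 p))))) \<noteq> 0" by auto
  define \<nu> where "\<nu> = q \<bullet> h2 (J (L (J (h1 p))))"
  have \<nu>: "\<nu> \<noteq> 0" using h2(2) by (auto simp: Xpq \<nu>_def)
  define p' where "p' = P (J (h1 p))"
  define g' where "g' = adjoint (blinfun_apply (h2 o\<^sub>L J o\<^sub>L L)) q"
  have g': "g' \<bullet> x = q \<bullet> h2 (J (L x))" for x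
    using adjoint_works[of "blinfun_apply (h2 o\<^sub>L J o\<^sub>L L)" x q]
    by (simp add: g'_def linear_blinfun inner_commute)
  have g'p': "g' \<bullet> p' = \<nu>" by (simp add: g' p'_def LP \<nu>_def)
  then have p'0: "p' \<noteq> 0" using \<nu> by auto
  define N0 where "N0 = P o\<^sub>L J o\<^sub>L h1 o\<^sub>L X o\<^sub>L h2 o\<^sub>L J o\<^sub>L L"
  have N0: "N0 x = ((norm p' *\<^sub>R g') \<bullet> x) *\<^sub>R ((1 / norm p') *\<^sub>R p')" for x
    using p'0 by (simp add: N0_def Xpq g' p'_def[symmetric] blinfun.scaleR_right)
  have np: "norm ((1 / norm p') *\<^sub>R p') = 1" using p'0 by simp
  have \<nu>': "(norm p' *\<^sub>R g') \<bullet> ((1 / norm p') *\<^sub>R p') = \<nu>" using p'0 g'p' by simp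
  from rank_one_perturbation[OF N0 np] \<nu> obtain \<eta> where \<eta>: "\<eta> > 0"
    and pert: "\<And>Y. norm (Y - N0) < \<eta> \<Longrightarrow> \<exists>x z. x \<noteq> 0 \<and> Y x = z *\<^sub>R x \<and> \<bar>z\<bar> \<ge> \<bar>\<nu>\<bar> / 4"
    unfolding \<nu>' by blast
  obtain c hs where hs: "\<And>n. hs n \<in> H" and Xlim: "(\<lambda>n::nat. c n *\<^sub>R (P o\<^sub>L hs n o\<^sub>L P)) \<longlonglongrightarrow> X"
    using I.S_seq[OF X(1)] by blast
  define M where "M Y L' = P o\<^sub>L J o\<^sub>L h1 o\<^sub>L Y o\<^sub>L h2 o\<^sub>L J o\<^sub>L L'" for Y L' :: "'a \<Rightarrow>\<^sub>L 'a"
  have "(\<lambda>n. M (c n *\<^sub>R (P o\<^sub>L hs n o\<^sub>L P)) L) \<longlonglongrightarrow> M X L"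
    unfolding M_def by (intro tendsto_intros Xlim)
  then have "\<forall>\<^sub>F n in sequentially. dist (M (c n *\<^sub>R (P o\<^sub>L hs n o\<^sub>L P)) L) N0 < \<eta> / 2"
    unfolding N0_def M_def[symmetric] using \<eta> by (intro tendstoD) auto
  \<comment> \<open>The approximation of \<open>X\<close> is fixed first and that of
    \<open>L\<close> second, so the connecting signal, its length \<open>R\<close> and the factor
    \<open>c j\<close> do not depend on \<open>n\<close>.\<close>
  then obtain j where j: "dist (M (c j *\<^sub>R (P o\<^sub>L hs j o\<^sub>L P)) L) N0 < \<eta> / 2"
    unfolding eventually_sequentially by blast
  define Y where "Y = c j *\<^sub>R (P o\<^sub>L hs j o\<^sub>L P)"
  have "(\<lambda>n. M Y (un (r n))) \<longlonglongrightarrow> M Y L"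
    unfolding M_def by (intro tendsto_intros lim)
  then have "\<forall>\<^sub>F n in sequentially. dist (M Y (un (r n))) (M Y L) < \<eta> / 2"
    using \<eta> by (intro tendstoD) auto
  then obtain n0 where n0: "\<And>n. n \<ge> n0 \<Longrightarrow> dist (M Y (un (r n))) (M Y L) < \<eta> / 2"
    unfolding eventually_sequentially by blast
  define h where "h = h1 o\<^sub>L hs j o\<^sub>L h2"
  have hH: "h \<in> H" unfolding h_def by (intro H_comp h1 h2 hs)
  obtain \<eta>' R where hR: "h = flow A N \<eta>' R" "0 \<le> R" "\<eta>' \<in> borel_measurable borel" "\<forall>s. a0 \<le> \<eta>' s \<and> \<eta>' s \<le> 1"
    using H_D[OF hH] by blast
  \<comment> \<open>The eigenvalue of the periodic flow is at least \<bar>\<nu>\<bar> / (4 \<bar>c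
    j\<bar>) times the norm of \<open>Ln (r n)\<close>, which exceeds
    \<open>real (r n) * exp (\<rho> * t (r n))\<close>; the eigenvalue bound allows only a fixed
    multiple of the exponential.\<close>
  have bound: "\<bar>\<nu>\<bar> / 4 * real (r n) \<le> \<bar>c j\<bar> * exp (\<rho> * (2 * T + R))" if n: "n \<ge> n0" for n
  proof -
    have "dist (M Y (un (r n))) N0 < \<eta>"
      using n0[OF n] j dist_triangle_half_l[of "M Y (un (r n))" "M Y L" \<eta> N0]
      unfolding Y_def by (metis dist_commute dist_triangle_half_r)
    then obtain x z where x: "x \<noteq> 0" "M Y (un (r n)) x = z *\<^sub>R x" "\<bar>z\<bar> \<ge> \<bar>\<nu>\<bar> / 4"
      using pert[of "M Y (un (r n))"] by (auto simp: dist_norm)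
    have z0: "z \<noteq> 0" using x(3) \<nu> by auto
    define \<Psi> where "\<Psi> = J o\<^sub>L h o\<^sub>L J o\<^sub>L flow A N (\<alpha> (r n)) (t (r n))"
    have Ph: "P (h' (P v)) = P (h' v)" if "h' \<in> H" for h' v by (rule P_H[OF that])
    have Mx: "M Y (un (r n)) v = (c j / norm (Ln (r n))) *\<^sub>R P (\<Psi> (P v))" for v
    proof -
      let ?w = "flow A N (\<alpha> (r n)) (t (r n)) (P v)"
      have "M Y (un (r n)) v = (c j / norm (Ln (r n))) *\<^sub>R P (J (h1 (P (hs j (P (h2 (J (P ?w))))))))"
        by (simp add: M_def Y_def un_def Ln_def blinfun.scaleR_left blinfun.scaleR_right)
      also have "P (h2 (J (P ?w))) = P (h2 (J ?w))"
        using Ph[OF H_comp[OF h2(1) J], of ?w] by simp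
      also have "P (hs j (P (h2 (J ?w)))) = P (hs j (h2 (J ?w)))" by (rule Ph[OF hs])
      also have "P (J (h1 (P (hs j (h2 (J ?w)))))) = P (J (h1 (hs j (h2 (J ?w)))))"
        using Ph[OF H_comp[OF J h1(1)]] by simp
      finally show ?thesis by (simp add: \<Psi>_def h_def)
    qed
    have Px: "P x = x"
    proof -
      have "P (z *\<^sub>R x) = z *\<^sub>R x"
        unfolding x(2)[symmetric] Mx by (simp add: blinfun.scaleR_right P_idem)
      then show ?thesis using z0 by (simp add: blinfun.scaleR_right)
    qed
    have c0: "c j \<noteq> 0" using Mx[of x] x(1,2) z0 by auto
    define z' where "z' = z * norm (Ln (r n)) / c j"
    have "P (\<Psi> x) = z' *\<^sub>R P x"
    proof -
      have "z *\<^sub>R x = (c j / norm (Ln (r n))) *\<^sub>R P (\<Psi> x)" using Mx[of x] x(2) Px by simp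
      then have "(norm (Ln (r n)) / c j) *\<^sub>R (z *\<^sub>R x) = P (\<Psi> x)" using c0 Ln_pos[of "r n"] by simp
      then show ?thesis by (simp add: z'_def Px mult.commute)
    qed
    moreover have "\<Psi> v \<in> V0" if "v \<in> V0" for v
      using that J hH by (simp add: \<Psi>_def H_V0_iff flow_in_V0_iff[OF PE_signal[OF \<alpha>]])
    ultimately obtain y where y: "y \<noteq> 0" "\<Psi> y = z' *\<^sub>R y"
      using eigenvalue_lift[of \<Psi> x z'] x(1) Px by auto
    obtain \<gamma> where \<gamma>: "\<gamma> \<in> PE T \<mu>" "\<And>s. \<gamma> (s + (t (r n) + 2 * T + R)) = \<gamma> s"
      "flow A N \<gamma> (t (r n) + 2 * T + R) = flow A N (\<lambda>_. 1) T o\<^sub>L flow A N \<eta>' R o\<^sub>L flow A N (\<lambda>_. 1) T o\<^sub>L flow A N (\<alpha> (r n)) (t (r n))"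
      by (rule periodic_PE_signal[OF \<mu> \<alpha>[of "r n"] t[of "r n"] hR(2,3), of A N]) (use hR(4) in \<open>auto simp: a0_def\<close>)
    have "flow A N \<gamma> (t (r n) + 2 * T + R) = \<Psi>"
      unfolding \<gamma>(3) \<Psi>_def J_def F_def hR(1) by simp
    then have "\<bar>z'\<bar> \<le> exp (\<rho> * (t (r n) + 2 * T + R))"
      using y T_pos t[of "r n"] hR(2) by (intro eigenvalue_boundD[OF eb \<gamma>(1) _ \<gamma>(2) y(1)]) auto
    then have le: "\<bar>z\<bar> * norm (Ln (r n)) \<le> \<bar>c j\<bar> * (exp (\<rho> * t (r n)) * exp (\<rho> * (2 * T + R)))"
      using c0 by (simp add: z'_def abs_mult field_simps exp_add[symmetric])
    have "\<bar>\<nu>\<bar> / 4 * (real (r n) * exp (\<rho> * t (r n))) \<le> \<bar>z\<bar> * norm (Ln (r n))"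
      using x(3) big[of "r n"] by (intro mult_mono) (auto simp: Ln_def)
    from order_trans[OF this le]
    have "exp (\<rho> * t (r n)) * (\<bar>\<nu>\<bar> / 4 * real (r n)) \<le> exp (\<rho> * t (r n)) * (\<bar>c j\<bar> * exp (\<rho> * (2 * T + R)))"
      by (simp only: mult_ac)
    then show ?thesis by (simp only: mult_le_cancel_left_pos[OF exp_gt_zero])
  qed
  define K where "K = \<bar>c j\<bar> * exp (\<rho> * (2 * T + R)) / (\<bar>\<nu>\<bar> / 4)"
  obtain n where n: "real n > K" using reals_Archimedean2 by blast
  have "n \<le> r (max n n0)" using strict_mono_imp_increasing[OF r, of "max n n0"] by simp
  moreover have "real (r (max n n0)) \<le> K"
    using bound[of "max n n0"] \<nu> by (simp add: K_def field_simps)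
  ultimately show False using n by linarith
qed

text \<open>A discrete variation of constants: \<open>e i\<close> is what one step from the quotient
  representative \<open>w i\<close> leaks into \<open>V0\<close>, where it evolves by the free flow.
  All contributions up to time \<open>n\<close> have the same exponential order, whence the factor n
  + 1.\<close>

lemma growth_integer_times:
  assumes C1: "C1 \<ge> 0" "\<And>v t. v \<in> V0 \<Longrightarrow> t \<ge> 0 \<Longrightarrow> norm (expflow A t v) \<le> C1 * exp (\<rho> * t) * norm v"
    and C2: "C2 \<ge> 0" "\<And>\<alpha> t. \<alpha> \<in> PE T \<mu> \<Longrightarrow> t \<ge> 0 \<Longrightarrow> norm (P o\<^sub>L flow A N \<alpha> t o\<^sub>L P) \<le> C2 * exp (\<rho> * t)"
  shows "\<exists>K\<ge>0. \<forall>\<alpha>\<in>PE T \<mu>. \<forall>n x. norm (flow A N \<alpha> (real n) x) \<le> K * real (Suc n) * exp (\<rho> * n) * norm x"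
proof -
  define L where "L = norm A + norm N"
  define K where "K = C2 + C1 * (1 + norm P) + C1 * exp (- \<rho>) * ((1 + norm P) * exp L * C2)"
  have L0: "L \<ge> 0" by (simp add: L_def)
  have K0: "K \<ge> 0" using C1 C2 by (simp add: K_def)
  show ?thesis
  proof (intro exI[of _ K] conjI K0 ballI allI)
    fix \<alpha> n x assume \<alpha>: "\<alpha> \<in> PE T \<mu>"
    have s\<alpha>: "signal \<alpha>" by (rule PE_signal[OF \<alpha>])
    define y where "y j = flow A N \<alpha> (real j) x" for j :: nat
    define w where "w j = P (y j)" for j
    define G where "G j = flow A N (\<lambda>r. \<alpha> (r + real j)) 1" for j :: nat
    define e where "e j = G j (w j) - P (G j (w j))" for j
    have yS: "y (Suc j) = G j (y j)" for j
      using flow_add[OF s\<alpha>, of A N "real j" 1] by (simp add: y_def G_def add.commute)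
    have eV: "e j \<in> V0" for j unfolding e_def by (rule P_compl)
    have wle: "norm (w j) \<le> C2 * exp (\<rho> * j) * norm x" for j
    proof -
      have "w j = (P o\<^sub>L flow A N \<alpha> (real j) o\<^sub>L P) x"
      proof -
        have "flow A N \<alpha> (real j) (x - P x) \<in> V0"
          using flow_in_V0_iff[OF s\<alpha>] P_compl by blast
        then show ?thesis by (simp add: w_def y_def P(1)[symmetric] blinfun.diff_right)
      qed
      also have "norm \<dots> \<le> norm (P o\<^sub>L flow A N \<alpha> (real j) o\<^sub>L P) * norm x" by (rule norm_blinfun)
      also have "\<dots> \<le> C2 * exp (\<rho> * j) * norm x"
        by (intro mult_right_mono C2(2)[OF \<alpha>]) auto
      finally show ?thesis .
    qed
    have ele: "norm (e j) \<le> (1 + norm P) * exp L * (C2 * exp (\<rho> * j) * norm x)" for j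
    proof -
      have "norm (e j) \<le> norm (G j (w j)) + norm (P (G j (w j)))" unfolding e_def by (rule norm_triangle_ineq4)
      also have "\<dots> \<le> (1 + norm P) * norm (G j (w j))"
        using norm_blinfun[of P "G j (w j)"] by (simp add: distrib_right)
      also have "norm (G j (w j)) \<le> exp L * (C2 * exp (\<rho> * j) * norm x)"
      proof -
        have "norm (G j) \<le> exp L"
          using norm_flow_le[OF signal_shift[OF s\<alpha>], of A N "real j" 1] by (simp add: G_def L_def)
        then show ?thesis
          by (intro order_trans[OF norm_blinfun] mult_mono wle) auto
      qed
      finally show ?thesis by (simp add: mult.assoc mult_left_mono)
    qed
    have repr: "y j - w j = expflow A (real j) (x - P x) + (\<Sum>i<j. expflow A (real (j - 1 - i)) (e i))" for j
    proof (induction j)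
      case 0
      show ?case by (simp add: y_def w_def flow_0[OF s\<alpha>])
    next
      case (Suc j)
      have v: "y j - w j \<in> V0" unfolding w_def by (rule P_compl)
      have Gv: "G j (y j - w j) = expflow A 1 (y j - w j)"
        unfolding G_def by (rule flow_V0[OF signal_shift[OF s\<alpha>] v])
      have "P (G j (y j - w j)) = 0" unfolding Gv P(1) by (rule expflow_V0[OF v])
      then have "y (Suc j) - w (Suc j) = expflow A 1 (y j - w j) + e j"
        unfolding w_def[of "Suc j"] yS e_def
        using Gv by (simp add: blinfun.diff_right algebra_simps)
      also have "\<dots> = expflow A 1 (expflow A (real j) (x - P x)) +
          (\<Sum>i<j. expflow A 1 (expflow A (real (j - 1 - i)) (e i))) + e j"
        unfolding Suc by (simp add: blinfun.add_right blinfun.sum_right)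
      also have "(\<Sum>i<j. expflow A 1 (expflow A (real (j - 1 - i)) (e i))) = (\<Sum>i<j. expflow A (real (j - i)) (e i))"
      proof (rule sum.cong)
        fix i assume "i \<in> {..<j}"
        then have eq: "real (j - i) = 1 + real (j - 1 - i)" by (simp add: of_nat_diff)
        show "expflow A 1 (expflow A (real (j - 1 - i)) (e i)) = expflow A (real (j - i)) (e i)"
          unfolding eq expflow_add blinfun_apply_blinfun_compose ..
      qed simp
      also have "expflow A 1 (expflow A (real j) (x - P x)) = expflow A (real (Suc j)) (x - P x)"
        using expflow_add[of A 1 "real j"] by simp
      finally show ?case by simp
    qed
    have term_le: "norm (expflow A (real (n - 1 - i)) (e i)) \<le> C1 * exp (- \<rho>) * ((1 + norm P) * exp L * C2) * exp (\<rho> * n) * norm x"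
      if "i < n" for i
    proof -
      have "norm (expflow A (real (n - 1 - i)) (e i)) \<le> C1 * exp (\<rho> * real (n - 1 - i)) * norm (e i)"
        by (rule C1(2)[OF eV]) simp
      also have "\<dots> \<le> C1 * exp (\<rho> * real (n - 1 - i)) * ((1 + norm P) * exp L * (C2 * exp (\<rho> * i) * norm x))"
        by (intro mult_left_mono ele) (simp add: C1)
      also have "\<dots> = C1 * (exp (\<rho> * real (n - 1 - i)) * exp (\<rho> * i)) * ((1 + norm P) * exp L * C2) * norm x"
        by (simp add: mult_ac)
      \<comment> \<open>The leak is created during the step from i to i + 1, so the two times add up
        to n - 1; this leaves \<open>exp (- \<rho>)\<close> in the constant.\<close>
      also have "exp (\<rho> * real (n - 1 - i)) * exp (\<rho> * i) = exp (- \<rho>) * exp (\<rho> * n)"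
        using that by (simp add: exp_add[symmetric] of_nat_diff algebra_simps)
      finally show ?thesis by (simp add: mult_ac)
    qed
    have "y n = w n + expflow A (real n) (x - P x) + (\<Sum>i<n. expflow A (real (n - 1 - i)) (e i))"
      using repr[of n] by (simp add: diff_eq_eq add.commute add.left_commute)
    then have "norm (y n) \<le> norm (w n) + norm (expflow A (real n) (x - P x)) + norm (\<Sum>i<n. expflow A (real (n - 1 - i)) (e i))"
      using order_trans[OF norm_triangle_ineq add_right_mono[OF norm_triangle_ineq]] by metis
    also have "norm (w n) \<le> C2 * exp (\<rho> * n) * norm x" by (rule wle)
    also have "norm (expflow A (real n) (x - P x)) \<le> C1 * exp (\<rho> * n) * ((1 + norm P) * norm x)"
    proof (rule order_trans[OF C1(2)[OF P_compl]])
      have "norm (x - P x) \<le> (1 + norm P) * norm x"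
        using norm_triangle_ineq4[of x "P x"] norm_blinfun[of P x] by (simp add: distrib_right)
      then show "C1 * exp (\<rho> * real n) * norm (x - P x) \<le> C1 * exp (\<rho> * n) * ((1 + norm P) * norm x)"
        by (intro mult_left_mono) (simp_all add: C1)
    qed simp
    also have "norm (\<Sum>i<n. expflow A (real (n - 1 - i)) (e i))
        \<le> (\<Sum>i<n. C1 * exp (- \<rho>) * ((1 + norm P) * exp L * C2) * exp (\<rho> * n) * norm x)"
      by (rule sum_norm_le) (use term_le in auto)
    finally have "norm (y n) \<le> (C2 + C1 * (1 + norm P)) * (exp (\<rho> * n) * norm x) +
        real n * (C1 * exp (- \<rho>) * ((1 + norm P) * exp L * C2)) * (exp (\<rho> * n) * norm x)"
      by (simp add: algebra_simps)
    also have "\<dots> \<le> real (Suc n) * (C2 + C1 * (1 + norm P)) * (exp (\<rho> * n) * norm x) +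
        real (Suc n) * (C1 * exp (- \<rho>) * ((1 + norm P) * exp L * C2)) * (exp (\<rho> * n) * norm x)"
    proof (intro add_mono mult_right_mono)
      have "1 * (C2 + C1 * (1 + norm P)) \<le> real (Suc n) * (C2 + C1 * (1 + norm P))"
        using C1(1) C2(1) by (intro mult_right_mono) auto
      then show "C2 + C1 * (1 + norm P) \<le> real (Suc n) * (C2 + C1 * (1 + norm P))" by simp
    qed (use C1(1) C2(1) in auto)
    also have "\<dots> = K * real (Suc n) * exp (\<rho> * n) * norm x"
      by (simp only: K_def distrib_left distrib_right mult_ac)
    finally show "norm (flow A N \<alpha> (real n) x) \<le> K * real (Suc n) * exp (\<rho> * n) * norm x"
      by (simp add: y_def)
  qed
qed

text \<open>The nonnegative function 1 - \<alpha> has integral at most 0 over every window of length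
  \<open>T\<close>, and countably many windows cover the half-line.\<close>

lemma PE_full_AE:
  assumes "\<mu> = T" and \<alpha>: "\<alpha> \<in> PE T \<mu>" and "0 \<le> t"
  shows "flow A N \<alpha> t = flow A N (\<lambda>_. 1) t"
proof -
  note s\<alpha> = PE_signal[OF \<alpha>]
  have Z: "negligible {r \<in> {s..s + T}. 1 - \<alpha> r \<noteq> 0}" for s
  proof -
    have int: "(\<lambda>r. 1 - \<alpha> r) absolutely_integrable_on {s..s + T}"
      by (intro set_integral_diff absolutely_integrable_continuous_real continuous_intros signal_absolutely_integrable s\<alpha>)
    define f where "f r = indicator {s..s + T} r *\<^sub>R (1 - \<alpha> r)" for r
    have fi: "integrable lebesgue f" using int unfolding set_integrable_def f_def .
    have f0: "0 \<le> f r" for r by (simp add: f_def signalD[OF s\<alpha>] indicator_def)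
    have "integral\<^sup>L lebesgue f = integral {s..s + T} (\<lambda>r. 1 - \<alpha> r)"
      using set_lebesgue_integral_eq_integral(2)[OF int] unfolding set_lebesgue_integral_def f_def .
    also have "\<dots> = T - integral {s..s + T} \<alpha>"
      using T_pos by (subst Henstock_Kurzweil_Integration.integral_diff)
        (auto intro: signal_integrable s\<alpha> integrable_const_ivl)
    also have "\<dots> \<le> 0" using \<alpha> assms(1) by (simp add: PE_iff)
    finally have "integral\<^sup>L lebesgue f \<le> 0" .
    moreover have "0 \<le> integral\<^sup>L lebesgue f" by (rule integral_nonneg_AE) (simp add: f0)
    ultimately have "integral\<^sup>L lebesgue f = 0" by simp
    then have "AE r in lebesgue. f r = 0"
      using integral_nonneg_eq_0_iff_AE[OF fi] f0 by simp
    then have "negligible {r. f r \<noteq> 0}"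
      by (simp add: completion.AE_iff_null_sets negligible_iff_null_sets)
    then show ?thesis
      by (rule negligible_subset) (auto simp: f_def)
  qed
  define Z where "Z = (\<Union>n::nat. {r \<in> {n * T..n * T + T}. 1 - \<alpha> r \<noteq> 0})"
  have nZ: "negligible Z"
    unfolding Z_def by (rule negligible_countable_Union) (use Z in auto)
  show ?thesis
  proof (rule flow_cong[OF s\<alpha> _ nZ \<open>0 \<le> t\<close>])
    fix r assume r: "r \<in> {0..t} - Z"
    define n where "n = nat \<lfloor>r / T\<rfloor>"
    have "0 \<le> r / T" using r T_pos by simp
    then have "real n \<le> r / T" "r / T \<le> real n + 1"
      unfolding n_def by linarith+
    then have "r \<in> {n * T..n * T + T}" using T_pos by (auto simp: field_simps)
    then show "\<alpha> r = 1" using r by (auto simp: Z_def)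
  qed (simp add: signal_def)
qed

theorem growth:
  assumes eb: "eigenvalue_bound \<rho>" and \<epsilon>: "\<epsilon> > 0"
  shows "\<exists>C. \<forall>\<alpha>\<in>PE T \<mu>. \<forall>t\<ge>0. norm (flow A N \<alpha> t) \<le> C * exp ((\<rho> + \<epsilon>) * t)"
proof (cases "a0 < 1")
  case True
  have \<epsilon>2: "\<epsilon> / 2 > 0" using \<epsilon> by simp
  \<comment> \<open>One half of \<open>\<epsilon>\<close> pays for polynomial growth on
    \<open>V0\<close>, the other for the factor n + 1; between integer times
    \<open>norm_flow_le\<close> bounds the flow by a constant.\<close>
  define \<rho>' where "\<rho>' = \<rho> + \<epsilon> / 2"
  obtain C1 where C1: "C1 \<ge> 0" "\<And>v t. v \<in> V0 \<Longrightarrow> t \<ge> 0 \<Longrightarrow> norm (expflow A t v) \<le> C1 * exp (\<rho>' * t) * norm v"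
    using constant_growth[OF eb subspace_V0 V0_A flow_V0[of "\<lambda>_. 1"] \<epsilon>2] unfolding \<rho>'_def
    by (auto simp: signal_def)
  obtain C where C: "\<And>\<alpha> t. \<alpha> \<in> PE T \<mu> \<Longrightarrow> t \<ge> 0 \<Longrightarrow> norm (P o\<^sub>L flow A N \<alpha> t o\<^sub>L P) \<le> C * exp (\<rho> * t)"
    using quotient_growth[OF True eb] by blast
  have C2: "norm (P o\<^sub>L flow A N \<alpha> t o\<^sub>L P) \<le> max C 0 * exp (\<rho>' * t)" if "\<alpha> \<in> PE T \<mu>" "t \<ge> 0" for \<alpha> t
  proof -
    have "C * exp (\<rho> * t) \<le> max C 0 * exp (\<rho>' * t)"
      using \<epsilon> that by (intro mult_mono) (auto simp: \<rho>'_def mult_right_mono)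
    then show ?thesis using C[OF that] by linarith
  qed
  obtain K where K: "K \<ge> 0"
    "\<And>\<alpha> n x. \<alpha> \<in> PE T \<mu> \<Longrightarrow> norm (flow A N \<alpha> (real n) x) \<le> K * real (Suc n) * exp (\<rho>' * n) * norm x"
    using growth_integer_times[OF C1 _ C2] by auto
  define \<kappa> where "\<kappa> = \<rho> + \<epsilon>"
  define K' where "K' = K * (1 + 2 / \<epsilon>)"
  have K': "K' \<ge> 0" using K \<epsilon> by (simp add: K'_def)
  define L where "L = norm A + norm N"
  have int: "norm (flow A N \<alpha> (real n) x) \<le> K' * exp (\<kappa> * n) * norm x" if "\<alpha> \<in> PE T \<mu>" for \<alpha> n x
  proof -
    have "real (Suc n) \<le> exp (\<epsilon> / 2 * n) + exp (\<epsilon> / 2 * n) / (\<epsilon> / 2)"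
      using linear_le_exp[OF \<epsilon>2, of n] \<epsilon> one_le_exp_iff[of "\<epsilon> / 2 * n"] by (simp only: of_nat_Suc) (intro add_mono, auto)
    also have "\<dots> = (1 + 2 / \<epsilon>) * exp (\<epsilon> / 2 * n)" by (simp add: algebra_simps)
    finally have "K * real (Suc n) * exp (\<rho>' * n) * norm x \<le> K * ((1 + 2 / \<epsilon>) * exp (\<epsilon> / 2 * n)) * exp (\<rho>' * n) * norm x"
      using K by (intro mult_right_mono mult_left_mono) auto
    also have "\<dots> = K' * (exp (\<epsilon> / 2 * n) * exp (\<rho>' * n)) * norm x" by (simp add: K'_def mult_ac)
    also have "exp (\<epsilon> / 2 * n) * exp (\<rho>' * n) = exp (\<kappa> * n)"
      by (simp add: exp_add[symmetric] \<kappa>_def \<rho>'_def algebra_simps)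
    finally show ?thesis using K(2)[OF that, of n x] by linarith
  qed
  show ?thesis
  proof (intro exI[of _ "exp L * K' * exp \<bar>\<kappa>\<bar>"] ballI allI impI)
    fix \<alpha> and t :: real assume \<alpha>: "\<alpha> \<in> PE T \<mu>" and t: "0 \<le> t"
    define n where "n = nat \<lfloor>t\<rfloor>"
    define s where "s = t - n"
    have s: "0 \<le> s" "s \<le> 1" using t unfolding s_def n_def by linarith+
    have L: "L \<ge> 0" by (simp add: L_def)
    have fl: "flow A N \<alpha> t = flow A N (\<lambda>r. \<alpha> (r + n)) s o\<^sub>L flow A N \<alpha> n"
      using flow_add[OF PE_signal[OF \<alpha>], of A N "real n" s] by (simp add: s_def)
    have "norm (flow A N (\<lambda>r. \<alpha> (r + n)) s) \<le> exp (L * \<bar>s\<bar>)"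
      unfolding L_def by (rule norm_flow_le[OF signal_shift[OF PE_signal[OF \<alpha>]]])
    also have "\<dots> \<le> exp L" using s L by (simp add: mult_left_le)
    finally have 1: "norm (flow A N (\<lambda>r. \<alpha> (r + n)) s) \<le> exp L" .
    have 2: "norm (flow A N \<alpha> n) \<le> K' * exp (\<kappa> * n)"
      by (rule norm_blinfun_bound) (use K' int[OF \<alpha>] in auto)
    have "\<bar>\<kappa> * s\<bar> \<le> \<bar>\<kappa>\<bar>" using s by (simp add: abs_mult mult_left_le)
    then have "\<kappa> * n \<le> \<bar>\<kappa>\<bar> + \<kappa> * t" by (simp add: s_def algebra_simps abs_le_iff)
    then have 3: "exp (\<kappa> * n) \<le> exp \<bar>\<kappa>\<bar> * exp (\<kappa> * t)" by (simp add: exp_add[symmetric])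
    have "norm (flow A N \<alpha> t) \<le> norm (flow A N (\<lambda>r. \<alpha> (r + n)) s) * norm (flow A N \<alpha> n)"
      unfolding fl by (rule norm_blinfun_compose)
    also have "\<dots> \<le> exp L * (K' * exp (\<kappa> * n))" by (intro mult_mono 1 2) auto
    also have "\<dots> \<le> exp L * (K' * (exp \<bar>\<kappa>\<bar> * exp (\<kappa> * t)))"
      by (intro mult_left_mono 3 K') auto
    finally show "norm (flow A N \<alpha> t) \<le> exp L * K' * exp \<bar>\<kappa>\<bar> * exp ((\<rho> + \<epsilon>) * t)"
      by (simp add: \<kappa>_def mult_ac)
  qed
next
  case False
  \<comment> \<open>Now the constants \<open>a0\<close> and 1 coincide and the two generators give
    no perturbation direction, but every exciting signal has the flow of \<open>A + N\<close>, whose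
    growth follows from its eigenvectors.\<close>
  then have "\<mu> = T" using \<mu> T_pos by (simp add: a0_def field_simps)
  have one: "flow A N (\<lambda>_. 1) t = expflow (A + N) t" for t
    using flow_const[of 1 A N t] by simp
  from constant_growth[OF eb subspace_UNIV _ _ \<epsilon>, of "A + N"]
  obtain C where C: "C \<ge> 0" "\<And>v t. t \<ge> 0 \<Longrightarrow> norm (expflow (A + N) t v) \<le> C * exp ((\<rho> + \<epsilon>) * t) * norm v"
    by (auto simp: one)
  show ?thesis
  proof (intro exI[of _ C] ballI allI impI)
    fix \<alpha> and t :: real assume \<alpha>: "\<alpha> \<in> PE T \<mu>" and t: "0 \<le> t"
    show "norm (flow A N \<alpha> t) \<le> C * exp ((\<rho> + \<epsilon>) * t)"
      unfolding PE_full_AE[OF \<open>\<mu> = T\<close> \<alpha> t] one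
      by (rule norm_blinfun_bound) (use C t in auto)
  qed
qed

end

section \<open>Rates of convergence and divergence\<close>

definition mat_blinfun :: "real^'d^'d \<Rightarrow> (real^'d) \<Rightarrow>\<^sub>L (real^'d)" where
  "mat_blinfun M = Blinfun ((*v) M)"

lemma mat_blinfun_apply [simp]: "mat_blinfun M x = M *v x"
  by (simp add: mat_blinfun_def bounded_linear_Blinfun_apply matrix_vector_mul_bounded_linear)

lemma mat_blinfun_minus: "mat_blinfun (- M) = - mat_blinfun M"
  by (rule blinfun_eqI) (simp add: blinfun.minus_left matrix_vector_mult_def vec_eq_iff sum_negf)

lemma matrix_mult_minus_right: "b ** (- K) = - (b ** K)" for b :: "real^'m^'n" and K :: "real^'l^'m"
  by (simp add: matrix_matrix_mult_def vec_eq_iff sum_negf)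

lemma rank_one_mat_blinfun:
  fixes b :: "real^1^'d" and K :: "real^'d^1"
  shows "mat_blinfun (b ** K) x = (K $ 1 \<bullet> x) *\<^sub>R column 1 b"
  by (simp add: matrix_matrix_mult_def matrix_vector_mult_def vec_eq_iff column_def inner_vec_def
      sum_distrib_left mult_ac UNIV_1)

lemma absolutely_integrable_open_Icc:
  fixes f :: "real \<Rightarrow> 'a::euclidean_space"
  shows "f absolutely_integrable_on {a<..<b} \<longleftrightarrow> f absolutely_integrable_on {a..b}"
proof -
  have n: "negligible ({a..b} - {a<..<b})"
    by (rule negligible_subset[of "{a, b}"]) auto
  show ?thesis
    by (rule iffI; erule absolutely_integrable_spike_set; rule negligible_subset[OF n]) auto
qed

lemma interval_integral_lebesgue:
  fixes f :: "real \<Rightarrow> 'a::euclidean_space"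
  assumes "a \<le> b"
  shows "interval_lebesgue_integrable lebesgue (ereal a) (ereal b) f \<longleftrightarrow> f absolutely_integrable_on {a..b}"
    "interval_lebesgue_integrable lebesgue (ereal b) (ereal a) f \<longleftrightarrow> f absolutely_integrable_on {a..b}"
    "f absolutely_integrable_on {a..b} \<Longrightarrow> (LINT s=ereal a..ereal b|lebesgue. f s) = integral {a..b} f"
    "f absolutely_integrable_on {a..b} \<Longrightarrow> (LINT s=ereal b..ereal a|lebesgue. f s) = - integral {a..b} f"
proof -
  have e: "einterval (ereal a) (ereal b) = {a<..<b}" by (auto simp: einterval_def)
  have e': "einterval (ereal a) (ereal a) = {}" by (auto simp: einterval_def)
  have sing: "f absolutely_integrable_on {a}"
    using absolutely_integrable_open_Icc[where f = f and a = a and b = a] by (simp add: set_integrable_def)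
  show i: "interval_lebesgue_integrable lebesgue (ereal a) (ereal b) f \<longleftrightarrow> f absolutely_integrable_on {a..b}"
    "interval_lebesgue_integrable lebesgue (ereal b) (ereal a) f \<longleftrightarrow> f absolutely_integrable_on {a..b}"
    using assms sing by (auto simp: interval_lebesgue_integrable_def e absolutely_integrable_open_Icc)
  assume f: "f absolutely_integrable_on {a..b}"
  then have "(LINT s:{a<..<b}|lebesgue. f s) = integral {a<..<b} f"
    by (intro set_lebesgue_integral_eq_integral(2)) (simp add: absolutely_integrable_open_Icc)
  also have "\<dots> = integral {a..b} f" by (rule integral_open_interval_real[symmetric])
  finally have "(LINT s:{a<..<b}|lebesgue. f s) = integral {a..b} f" .
  then show "(LINT s=ereal a..ereal b|lebesgue. f s) = integral {a..b} f"
    "(LINT s=ereal b..ereal a|lebesgue. f s) = - integral {a..b} f"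
    using assms by (auto simp: interval_lebesgue_integral_def e e')
qed

lemma solves_from_iff:
  fixes A :: "real^'d^'d" and b :: "real^1^'d" and K :: "real^'d^1"
  assumes \<alpha>: "signal \<alpha>"
  shows "solves_from (\<lambda>t y. (A + \<alpha> t *\<^sub>R (b ** K)) *v y) 0 x0 UNIV x \<longleftrightarrow>
    sol_on (mat_blinfun A) (mat_blinfun (b ** K)) \<alpha> UNIV x \<and> x 0 = x0"
proof (cases "continuous_on UNIV x")
  case True
  define f where "f s = vf (mat_blinfun A) (mat_blinfun (b ** K)) (\<alpha> s) (x s)" for s
  have F: "(A + \<alpha> s *\<^sub>R (b ** K)) *v x s = f s" for s
    by (simp add: f_def vf_def matrix_vector_mult_add_rdistrib scaleR_matrix_vector_assoc)
  have ai: "f absolutely_integrable_on {s..t}" for s t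
    unfolding f_def by (rule vf_absolutely_integrable[OF \<alpha>]) (use True continuous_on_subset in blast)
  then have int: "f integrable_on {s..t}" for s t using absolutely_integrable_on_def by blast
  have L: "interval_lebesgue_integrable lebesgue (ereal 0) (ereal t) f \<and>
      (LINT s=ereal 0..ereal t|lebesgue. f s) = oint f t" for t
  proof (cases "0 \<le> t")
    case True
    then have "integral {t..0} f = 0" by (cases "t = 0") auto
    then show ?thesis using interval_integral_lebesgue[OF True, of f] ai by (simp add: oint_def)
  next
    case False
    then show ?thesis using interval_integral_lebesgue[of t 0 f] ai by (simp add: oint_def)
  qed
  have o0: "oint f 0 = 0" by (simp add: oint_def)
  have "solves_from (\<lambda>t y. (A + \<alpha> t *\<^sub>R (b ** K)) *v y) 0 x0 UNIV x \<longleftrightarrow> (\<forall>t. x t = x0 + oint f t)"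
    unfolding solves_from_def F using True L by (simp only:) blast
  also have "\<dots> \<longleftrightarrow> sol_on (mat_blinfun A) (mat_blinfun (b ** K)) \<alpha> UNIV x \<and> x 0 = x0"
  proof
    assume x: "\<forall>t. x t = x0 + oint f t"
    have "(f has_integral (x t - x s)) {s..t}" if "s \<le> t" for s t
      using oint_diff[OF int that] integrable_integral[OF int[of s t]] x by simp
    then have "sol_on (mat_blinfun A) (mat_blinfun (b ** K)) \<alpha> UNIV x"
      using True unfolding sol_on_def f_def[symmetric] by blast
    moreover have "x 0 = x0" using x o0 by simp
    ultimately show "sol_on (mat_blinfun A) (mat_blinfun (b ** K)) \<alpha> UNIV x \<and> x 0 = x0" by blast
  next
    assume x: "sol_on (mat_blinfun A) (mat_blinfun (b ** K)) \<alpha> UNIV x \<and> x 0 = x0"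
    have d: "integral {s..t} f = x t - x s" if "s \<le> t" for s t
      using x that unfolding sol_on_def f_def[symmetric] by (simp add: integral_unique)
    have "x t - x 0 = oint f t" for t
    proof (cases "0 \<le> t")
      case True
      then show ?thesis using oint_diff[OF int True] d[OF True] o0 by simp
    next
      case False
      then show ?thesis using oint_diff[of f t 0] int d[of t 0] o0 by (simp add: algebra_simps)
    qed
    then show "\<forall>t. x t = x0 + oint f t" using x by (metis add.commute diff_add_cancel)
  qed
  finally show ?thesis .
qed (simp add: solves_from_def sol_on_def)

lemma traj_eq_flow:
  assumes "signal \<alpha>"
  shows "traj 0 x0 A b K \<alpha> t = flow (mat_blinfun A) (mat_blinfun (b ** K)) \<alpha> t x0"
proof -
  have "traj 0 x0 A b K \<alpha> = (\<lambda>t. flow (mat_blinfun A) (mat_blinfun (b ** K)) \<alpha> t x0)"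
    unfolding traj_def solves_from_iff[OF assms]
  proof (rule the_equality)
    show "sol_on (mat_blinfun A) (mat_blinfun (b ** K)) \<alpha> UNIV (\<lambda>t. flow (mat_blinfun A) (mat_blinfun (b ** K)) \<alpha> t x0) \<and>
        flow (mat_blinfun A) (mat_blinfun (b ** K)) \<alpha> 0 x0 = x0"
      using sol_flow[OF assms] by blast
    show "x = (\<lambda>t. flow (mat_blinfun A) (mat_blinfun (b ** K)) \<alpha> t x0)"
      if "sol_on (mat_blinfun A) (mat_blinfun (b ** K)) \<alpha> UNIV x \<and> x 0 = x0" for x
      using that by (intro ext flow_eqI[OF assms]) auto
  qed
  then show ?thesis by simp
qed

lemma solves_from_interval:
  fixes F :: "real \<Rightarrow> 'a::euclidean_space \<Rightarrow> 'a"
  assumes "0 \<le> S"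
  shows "solves_from F 0 x0 {0..S} x \<longleftrightarrow> continuous_on {0..S} x \<and>
    (\<lambda>s. F s (x s)) absolutely_integrable_on {0..S} \<and>
    (\<forall>t\<in>{0..S}. x t = x0 + integral {0..t} (\<lambda>s. F s (x s)))"
    (is "?l \<longleftrightarrow> ?r")
proof
  assume l: ?l
  then have "(\<lambda>s. F s (x s)) absolutely_integrable_on {0..t}" if "t \<in> {0..S}" for t
    using that unfolding solves_from_def by (auto simp: interval_integral_lebesgue)
  then show ?r using l assms unfolding solves_from_def by (auto simp: interval_integral_lebesgue)
next
  assume r: ?r
  have "(\<lambda>s. F s (x s)) absolutely_integrable_on {0..t}" if "t \<in> {0..S}" for t
    by (rule set_integrable_subset[of _ "{0..S}"]) (use r that in auto)
  then show ?l using r unfolding solves_from_def by (auto simp: interval_integral_lebesgue)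
qed

text \<open>Modulo the Krylov subspace \<open>V\<close> the control disappears. A trajectory from 0
  is therefore kept at 0 in the quotient by Gronwall, and only points of \<open>V\<close> are
  reachable from 0.\<close>

lemma controllable_imp_cyclic:
  fixes A :: "real^'d^'d" and b :: "real^1^'d"
  assumes "controllable A b"
  shows "span (range (\<lambda>j. (blinfun_apply (mat_blinfun A) ^^ j) (column 1 b))) = UNIV"
proof (rule ccontr)
  define V where "V = span (range (\<lambda>j. (blinfun_apply (mat_blinfun A) ^^ j) (column 1 b)))"
  assume "\<not> ?thesis"
  then obtain x1 where x1: "x1 \<notin> V" by (auto simp: V_def)
  have V: "subspace V" by (simp add: V_def)
  have bV: "b *v u \<in> V" for u
  proof -
    have "b *v u = (u $ 1) *\<^sub>R column 1 b"
      by (simp add: matrix_vector_mult_def column_def vec_eq_iff UNIV_1)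
    moreover have "column 1 b \<in> V"
      unfolding V_def by (rule span_base) (auto intro: image_eqI[of _ _ 0])
    ultimately show ?thesis by (simp add: subspace_scale[OF V])
  qed
  have AV: "A *v v \<in> V" if "v \<in> V" for v
  proof -
    let ?S = "range (\<lambda>j. (blinfun_apply (mat_blinfun A) ^^ j) (column 1 b))"
    have "(*v) A ` span ?S = span ((*v) A ` ?S)"
      by (rule linear_span_image[symmetric]) (rule matrix_vector_mul_linear)
    also have "\<dots> \<subseteq> span ?S"
    proof (rule span_mono, clarify)
      fix j
      have "A *v (blinfun_apply (mat_blinfun A) ^^ j) (column 1 b) = (blinfun_apply (mat_blinfun A) ^^ Suc j) (column 1 b)"
        by simp
      then show "A *v (blinfun_apply (mat_blinfun A) ^^ j) (column 1 b) \<in> ?S" by (metis rangeI)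
    qed
    finally show ?thesis using that by (auto simp: V_def)
  qed
  obtain P :: "(real^'d) \<Rightarrow>\<^sub>L (real^'d)" where P: "\<And>x. P x = 0 \<longleftrightarrow> x \<in> V" "P o\<^sub>L P = P"
    using subspace_projection_exists[OF V] by blast
  have PA: "P (A *v v) = (P o\<^sub>L mat_blinfun A) (P v)" for v
  proof -
    have "P (v - P v) = 0" using arg_cong[OF P(2), of "\<lambda>f. blinfun_apply f v"] by (simp add: blinfun.diff_right)
    then have "P (A *v (v - P v)) = 0" using AV P(1) by blast
    then show ?thesis by (simp add: matrix_vector_mult_diff_distrib blinfun.diff_right)
  qed
  obtain S u x where S: "S > 0" and sol: "solves_from (\<lambda>t y. A *v y + b *v u t) 0 0 {0..S} x" and xS: "x S = x1"
    using assms unfolding controllable_def by blast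
  define f where "f s = A *v x s + b *v u s" for s
  have "continuous_on {0..S} x \<and> f absolutely_integrable_on {0..S} \<and> (\<forall>t\<in>{0..S}. x t = 0 + integral {0..t} f)"
    using sol unfolding solves_from_interval[OF less_imp_le[OF S]] f_def[abs_def] .
  then have sol': "continuous_on {0..S} x" "f absolutely_integrable_on {0..S}" "\<And>t. t \<in> {0..S} \<Longrightarrow> x t = integral {0..t} f"
    by simp_all
  have Pf: "P (f s) = (P o\<^sub>L mat_blinfun A) (P (x s))" for s
  proof -
    have "P (b *v u s) = 0" using bV P(1) by blast
    then show ?thesis unfolding f_def blinfun.add_right PA by simp
  qed
  have "norm (P (x S)) \<le> 0 * exp (norm (P o\<^sub>L mat_blinfun A) * (S - 0))"
  proof (rule gronwall)
    show "continuous_on {0..S} (\<lambda>t. norm (P (x t)))" by (intro continuous_intros sol')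
    fix t assume t: "t \<in> {0..S}"
    have ct: "continuous_on {0..t} x" using sol'(1) t by (auto intro: continuous_on_subset)
    have fi: "f integrable_on {0..t}"
      using integrable_on_subinterval[of f "{0..S}" 0 t] sol'(2) t by (simp add: absolutely_integrable_on_def)
    have "P (x t) = integral {0..t} (\<lambda>s. P (f s))"
      using integral_linear[OF fi blinfun.bounded_linear_right[of P]] sol'(3)[OF t] by (simp add: o_def)
    also have "\<dots> = integral {0..t} (\<lambda>s. (P o\<^sub>L mat_blinfun A) (P (x s)))" by (simp only: Pf)
    also have "norm \<dots> \<le> integral {0..t} (\<lambda>s. norm (P o\<^sub>L mat_blinfun A) * norm (P (x s)))"
      by (intro integral_norm_bound_integral integrable_continuous_interval continuous_intros ct norm_blinfun)
    finally show "norm (P (x t)) \<le> 0 + norm (P o\<^sub>L mat_blinfun A) * integral {0..t} (\<lambda>s. norm (P (x s)))"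
      by simp
  qed (use S in auto)
  then have "P x1 = 0" using xS by simp
  then show False using P(1) x1 by blast
qed

lemma has_integral_flip:
  fixes f :: "real \<Rightarrow> 'a::euclidean_space"
  assumes "(f has_integral I) {S - b..S - a}"
  shows "((\<lambda>s. f (S - s)) has_integral I) {a..b}"
proof -
  have "((\<lambda>s. f (- s)) has_integral I) {- (S - a)..- (S - b)}"
    using assms by (simp only: has_integral_reflect_real)
  then have "((\<lambda>s. f (- s)) has_integral I) (cbox (a - S) (b - S))" by (simp add: box_real)
  from has_integral_affinity'[OF this, of 1 "- S"] show ?thesis by (simp add: box_real)
qed

lemma absolutely_integrable_flip:
  fixes f :: "real \<Rightarrow> 'a::euclidean_space"
  assumes "f absolutely_integrable_on {0..S}"
  shows "(\<lambda>s. f (S - s)) absolutely_integrable_on {0..S}"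
proof -
  have eq: "indicator {0..S} (S - s) = (indicator {0..S} s :: real)" for s
    by (auto simp: indicator_def)
  have "integrable lebesgue (\<lambda>s. indicator {0..S} (S + (-1) * s) *\<^sub>R f (S + (-1) * s))"
    using lebesgue_integrable_real_affine[of "\<lambda>s. indicator {0..S} s *\<^sub>R f s" "-1" S] assms
    unfolding set_integrable_def by simp
  then show ?thesis unfolding set_integrable_def by (simp add: eq)
qed

text \<open>A trajectory from \<open>x1\<close> to \<open>x0\<close>, run backwards with the control
  negated, steers the system of \<open>- A\<close> from \<open>x0\<close> to \<open>x1\<close>.
  Hence the common values for \<open>A\<close> and \<open>- A\<close> range over the same vectors
  \<open>b\<close>.\<close>

lemma controllable_uminus:
  assumes "controllable A b"
  shows "controllable (- A) b"
  unfolding controllable_def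
proof (intro allI)
  fix x0 x1
  obtain S u x where S: "S > 0" and u: "set_integrable lebesgue {0..S} u"
    and sol: "solves_from (\<lambda>t y. A *v y + b *v u t) 0 x1 {0..S} x" and xS: "x S = x0"
    using assms unfolding controllable_def by blast
  define f where "f s = A *v x s + b *v u s" for s
  have "continuous_on {0..S} x \<and> f absolutely_integrable_on {0..S} \<and> (\<forall>t\<in>{0..S}. x t = x1 + integral {0..t} f)"
    using sol unfolding solves_from_interval[OF less_imp_le[OF S]] f_def[abs_def] .
  then have sol': "continuous_on {0..S} x" "f absolutely_integrable_on {0..S}"
    "\<And>t. t \<in> {0..S} \<Longrightarrow> x t = x1 + integral {0..t} f"
    by simp_all
  have fi: "f integrable_on {0..S}" using sol'(2) by (simp add: absolutely_integrable_on_def)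
  have g: "- A *v x (S - s) + b *v (- u (S - s)) = - f (S - s)" for s
    by (simp add: f_def matrix_vector_mult_def vec_eq_iff sum_negf)
  have "solves_from (\<lambda>t y. - A *v y + b *v (- u (S - t))) 0 x0 {0..S} (\<lambda>t. x (S - t))"
    unfolding solves_from_interval[OF less_imp_le[OF S]] g
  proof (intro conjI ballI)
    show "continuous_on {0..S} (\<lambda>t. x (S - t))"
      by (rule continuous_on_compose2[OF sol'(1)]) (auto intro!: continuous_intros)
    show "(\<lambda>s. - f (S - s)) absolutely_integrable_on {0..S}"
      using absolutely_integrable_flip[OF sol'(2)] unfolding set_integrable_def by simp
    fix t assume t: "t \<in> {0..S}"
    have i: "f integrable_on {S - t..S}" "f integrable_on {0..S - t}"
      using fi t by (auto intro: integrable_on_subinterval)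
    have "integral {0..S - t} f + integral {S - t..S} f = integral {0..S} f"
      by (rule Henstock_Kurzweil_Integration.integral_combine) (use t fi in auto)
    then have "integral {S - t..S} f = x0 - x (S - t)"
      using sol'(3)[of "S - t"] sol'(3)[of S] t S xS by (simp add: algebra_simps)
    then have "(f has_integral (x0 - x (S - t))) {S - t..S - 0}"
      using integrable_integral[OF i(1)] by simp
    from integral_unique[OF has_integral_neg[OF has_integral_flip[OF this]]]
    show "x (S - t) = x0 + integral {0..t} (\<lambda>s. - f (S - s))" by simp
  qed
  moreover have "set_integrable lebesgue {0..S} (\<lambda>t. - u (S - t))"
    using absolutely_integrable_flip[OF u] unfolding set_integrable_def by simp
  moreover have "x (S - S) = x1" using sol'(3)[of 0] S by simp
  ultimately show "\<exists>S>0. \<exists>u. \<exists>x. set_integrable lebesgue {0..S} u \<and>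
      solves_from (\<lambda>t y. - A *v y + b *v u t) 0 x0 {0..S} x \<and> x S = x1"
    using S by (intro exI[of _ S] conjI exI[of _ "\<lambda>t. - u (S - t)"] exI[of _ "\<lambda>t. x (S - t)"])
qed

lemma controllable_uminus_iff: "controllable (- A) b \<longleftrightarrow> controllable A b"
  using controllable_uminus[of A b] controllable_uminus[of "- A" b] by auto

lemma is_norm_equivalent:
  fixes N :: "'a::euclidean_space \<Rightarrow> real"
  assumes N: "is_norm N"
  obtains c C where "c > 0" "C > 0" "\<And>x. c * norm x \<le> N x" "\<And>x. N x \<le> C * norm x"
proof -
  have N0: "N x = 0 \<longleftrightarrow> x = 0" and Nsc: "N (a *\<^sub>R x) = \<bar>a\<bar> * N x" and Ntri: "N (x + y) \<le> N x + N y" for a x y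
    using N by (auto simp: is_norm_def)
  have Nz: "N 0 = 0" using N0 by blast
  have Npos: "0 \<le> N x" for x
    using Ntri[of x "(-1) *\<^sub>R x"] Nsc[of "-1" x] Nz by simp
  define C where "C = (\<Sum>i\<in>Basis. N i) + 1"
  have Nsum: "N (\<Sum>i\<in>I. g i) \<le> (\<Sum>i\<in>I. N (g i))" if "finite I" for I and g :: "'a \<Rightarrow> 'a"
    using that
  proof (induction I rule: finite_induct)
    case (insert i I)
    then show ?case using Ntri[of "g i" "\<Sum>i\<in>I. g i"] by simp
  qed (simp add: Nz)
  have C: "C > 0" using Npos by (simp add: C_def add_nonneg_pos sum_nonneg)
  have upper: "N x \<le> C * norm x" for x
  proof -
    have "N x = N (\<Sum>i\<in>Basis. (x \<bullet> i) *\<^sub>R i)" by (simp add: euclidean_representation)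
    also have "\<dots> \<le> (\<Sum>i\<in>Basis. \<bar>x \<bullet> i\<bar> * N i)"
      using Nsum[of Basis "\<lambda>i. (x \<bullet> i) *\<^sub>R i"] by (simp add: Nsc)
    also have "\<dots> \<le> (\<Sum>i\<in>Basis. norm x * N i)"
      by (intro sum_mono mult_right_mono Basis_le_norm Npos)
    also have "\<dots> = norm x * (\<Sum>i\<in>Basis. N i)" by (simp only: sum_distrib_left)
    also have "\<dots> \<le> C * norm x" by (simp add: C_def algebra_simps)
    finally show ?thesis .
  qed
  have "\<bar>N x - N y\<bar> \<le> C * norm (x - y)" for x y
    using Ntri[of "x - y" y] Ntri[of "y - x" x] upper[of "x - y"] upper[of "y - x"]
    by (simp add: norm_minus_commute)
  then have "C-lipschitz_on UNIV N"
    using C by (intro lipschitz_onI) (auto simp: dist_norm)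
  then have cont: "continuous_on (sphere 0 1) N"
    using lipschitz_on_continuous_on continuous_on_subset by blast
  have "sphere (0::'a) 1 \<noteq> {}" by simp
  from continuous_attains_inf[OF compact_sphere this cont]
  obtain x0 where x0: "x0 \<in> sphere 0 1" "\<And>y. y \<in> sphere 0 1 \<Longrightarrow> N x0 \<le> N y" by blast
  show ?thesis
  proof
    show "N x0 > 0" using x0(1) Npos[of x0] N0[of x0] by (cases "N x0 = 0") auto
    show "C > 0" by (rule C)
    show "N x \<le> C * norm x" for x by (rule upper)
    show "N x0 * norm x \<le> N x" for x
    proof (cases "x = 0")
      case False
      then have "N x0 \<le> N ((1 / norm x) *\<^sub>R x)" by (intro x0(2)) simp
      then show ?thesis using False by (simp add: Nsc field_simps)
    qed (simp add: Nz)
  qed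
qed

section \<open>Exponential rates of positive functions\<close>

lemma Limsup_le_of_exp_bound:
  assumes "C > 0" and pos: "\<And>t. y t > 0" and le: "\<And>t. t \<ge> 0 \<Longrightarrow> y t \<le> C * exp (\<rho> * t)"
  shows "Limsup at_top (\<lambda>t. ereal (1 / t * ln (y t))) \<le> ereal \<rho>"
proof -
  have "\<forall>\<^sub>F t in at_top. ereal (1 / t * ln (y t)) \<le> ereal (\<rho> + ln C / t)"
    using eventually_gt_at_top[of "0::real"]
  proof eventually_elim
    case (elim t)
    have "ln (y t) \<le> ln (C * exp (\<rho> * t))"
      using pos[of t] le[of t] elim by simp
    also have "\<dots> = ln C + \<rho> * t" using \<open>C > 0\<close> by (simp add: ln_mult)
    finally show ?case using elim by (simp add: field_simps)
  qed
  then have "Limsup at_top (\<lambda>t. ereal (1 / t * ln (y t))) \<le> Limsup at_top (\<lambda>t. ereal (\<rho> + ln C / t))"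
    by (rule Limsup_mono)
  also have "((\<lambda>t. \<rho> + ln C / t) \<longlongrightarrow> \<rho> + 0) at_top"
    by (intro tendsto_add tendsto_const tendsto_divide_0[OF tendsto_const] filterlim_at_top_imp_at_infinity filterlim_ident)
  then have "Limsup at_top (\<lambda>t. ereal (\<rho> + ln C / t)) = ereal \<rho>"
    by (intro lim_imp_Limsup) auto
  finally show ?thesis .
qed

lemma Liminf_ge_of_exp_bound:
  assumes "C > 0" and pos: "\<And>t. y t > 0" and le: "\<And>t. t \<ge> 0 \<Longrightarrow> C * exp (- \<rho> * t) \<le> y t"
  shows "ereal (- \<rho>) \<le> Liminf at_top (\<lambda>t. ereal (1 / t * ln (y t)))"
proof -
  have "Limsup at_top (\<lambda>t. ereal (1 / t * ln (1 / y t))) \<le> ereal \<rho>"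
  proof (rule Limsup_le_of_exp_bound[of "1 / C"])
    show "1 / y t \<le> 1 / C * exp (\<rho> * t)" if "t \<ge> 0" for t
      using le[OF that] pos[of t] \<open>C > 0\<close> by (simp add: exp_minus field_simps)
  qed (use \<open>C > 0\<close> pos in auto)
  moreover have "ln (1 / y t) = - ln (y t)" for t using pos[of t] by (simp add: ln_div)
  then have "(\<lambda>t. ereal (1 / t * ln (1 / y t))) = (\<lambda>t. - ereal (1 / t * ln (y t)))" by simp
  ultimately have "- Liminf at_top (\<lambda>t. ereal (1 / t * ln (y t))) \<le> ereal \<rho>"
    by (simp only: ereal_Limsup_uminus)
  then show ?thesis by (simp add: ereal_uminus_le_reorder)
qed

text \<open>Each period gains \<delta> = ln \<zeta> - \<rho> \<tau> > 0 over the rate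
  \<open>\<rho>\<close>, and after enough periods the gain exceeds the constant \<bar>ln
  c\<bar>.\<close>

lemma Limsup_ge_of_multiples:
  assumes "\<tau> > 0" "c > 0" and pos: "\<And>n. y (real n * \<tau>) = \<zeta> ^ n * c" and \<zeta>: "\<zeta> > exp (\<rho> * \<tau>)"
  shows "ereal \<rho> \<le> Limsup at_top (\<lambda>t. ereal (1 / t * ln (y t)))"
proof (rule ccontr)
  assume "\<not> ?thesis"
  then have "\<forall>\<^sub>F t in at_top. ereal (1 / t * ln (y t)) < ereal \<rho>"
    by (intro Limsup_lessD) auto
  then obtain t0 where t0: "\<And>t. t \<ge> t0 \<Longrightarrow> 1 / t * ln (y t) < \<rho>"
    by (auto simp: eventually_at_top_linorder)
  have z0: "\<zeta> > 0" using \<zeta> exp_gt_zero less_trans by blast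
  define \<delta> where "\<delta> = ln \<zeta> - \<rho> * \<tau>"
  have "ln (exp (\<rho> * \<tau>)) < ln \<zeta>" using \<zeta> z0 by (simp only: ln_less_cancel_iff exp_gt_zero)
  then have \<delta>: "\<delta> > 0" by (simp add: \<delta>_def)
  obtain n where n: "real n > max 1 (max (t0 / \<tau>) (\<bar>ln c\<bar> / \<delta>))" using reals_Archimedean2 by blast
  have n1: "real n > 0" "real n * \<tau> \<ge> t0" "\<bar>ln c\<bar> < real n * \<delta>"
    using n \<delta> \<open>\<tau> > 0\<close> by (auto simp: field_simps)
  have "1 / (real n * \<tau>) * ln (y (real n * \<tau>)) < \<rho>" by (rule t0[OF n1(2)])
  then have "ln (y (real n * \<tau>)) < \<rho> * (real n * \<tau>)"
    using n1(1) \<open>\<tau> > 0\<close> by (simp add: field_simps)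
  then have "ln (\<zeta> ^ n * c) < \<rho> * (real n * \<tau>)" by (simp only: pos)
  then have "real n * ln \<zeta> + ln c < \<rho> * (real n * \<tau>)"
    using z0 \<open>c > 0\<close> by (simp add: ln_mult ln_realpow)
  then have "real n * \<delta> + ln c < 0" by (simp add: \<delta>_def algebra_simps)
  then show False using n1(3) by linarith
qed

lemma Liminf_le_of_multiples:
  assumes "\<tau> > 0" "c > 0" and pos: "\<And>t. y t > 0"
    and eq: "\<And>n. y (real n * \<tau>) = c / \<zeta> ^ n" and \<zeta>: "\<zeta> > exp (\<rho> * \<tau>)"
  shows "Liminf at_top (\<lambda>t. ereal (1 / t * ln (y t))) \<le> ereal (- \<rho>)"
proof -
  have "ereal \<rho> \<le> Limsup at_top (\<lambda>t. ereal (1 / t * ln (1 / y t)))"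
    by (rule Limsup_ge_of_multiples[OF assms(1) _ _ \<zeta>, of "1 / c"]) (use assms in \<open>auto simp: eq\<close>)
  moreover have "ln (1 / y t) = - ln (y t)" for t using pos[of t] by (simp add: ln_div)
  then have "(\<lambda>t. ereal (1 / t * ln (1 / y t))) = (\<lambda>t. - ereal (1 / t * ln (y t)))" by simp
  ultimately have "ereal \<rho> \<le> - Liminf at_top (\<lambda>t. ereal (1 / t * ln (y t)))"
    by (simp only: ereal_Limsup_uminus)
  then have "- ereal (- \<rho>) \<le> - Liminf at_top (\<lambda>t. ereal (1 / t * ln (y t)))" by simp
  then show ?thesis by (simp only: ereal_minus_le_minus)
qed

lemma proj_line_scaleR: "z \<noteq> 0 \<Longrightarrow> proj_line (z *\<^sub>R v) = proj_line v"
proof -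
  assume z: "z \<noteq> 0"
  have "z *\<^sub>R v \<in> span {v}" by (intro span_scale span_base) simp
  moreover have "(1 / z) *\<^sub>R (z *\<^sub>R v) \<in> span {z *\<^sub>R v}" by (intro span_scale span_base) simp
  ultimately show ?thesis
    unfolding proj_line_def using z by (intro subset_antisym span_minimal) auto
qed

lemma rc_le_rc_sharp: "rc N T \<mu> A b K \<le> rc_sharp N T \<mu> A b K"
proof -
  have "rc N T \<mu> A b K \<le> - lambda_plus N x A b K \<alpha>" if "(\<alpha>, x) \<in> sharp_admissible T \<mu> A b K" for \<alpha> x
  proof -
    have "\<alpha> \<in> PE T \<mu>" "x \<noteq> 0" using that by (auto simp: sharp_admissible_def)
    then show ?thesis
      unfolding rc_def Lambda_plus_def
      by (intro INF_lower2[of \<alpha>]) (auto intro!: SUP_upper2)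
  qed
  then show ?thesis unfolding rc_sharp_def by (auto intro!: INF_greatest)
qed

lemma rd_le_rd_sharp: "rd N T \<mu> A b K \<le> rd_sharp N T \<mu> A b K"
proof -
  have "rd N T \<mu> A b K \<le> lambda_minus N x A b K \<alpha>" if "(\<alpha>, x) \<in> sharp_admissible T \<mu> A b K" for \<alpha> x
  proof -
    have "\<alpha> \<in> PE T \<mu>" "x \<noteq> 0" using that by (auto simp: sharp_admissible_def)
    then show ?thesis
      unfolding rd_def Lambda_minus_def
      by (intro INF_lower2[of \<alpha>]) (auto intro!: INF_lower2)
  qed
  then show ?thesis unfolding rd_sharp_def by (auto intro!: INF_greatest)
qed

section \<open>Comparison of the four rates for one feedback\<close>

context
  fixes N :: "real^'d \<Rightarrow> real" and A :: "real^'d^'d" and b :: "real^1^'d" and K :: "real^'d^1"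
    and T \<mu> :: real
  assumes N: "is_norm N" and ctrl: "controllable A b" and \<mu>: "0 < \<mu>" "\<mu> \<le> T"
begin

interpretation sys: pe_system "mat_blinfun A" "column 1 b" "K $ 1" T \<mu>
  by unfold_locales (use \<mu> controllable_imp_cyclic[OF ctrl] in auto)

lemma sys_N: "mat_blinfun (b ** K) = sys.N"
  by (rule blinfun_eqI) (simp only: rank_one_mat_blinfun sys.N_apply)

lemma traj_flow: "\<alpha> \<in> PE T \<mu> \<Longrightarrow> traj 0 x A b K \<alpha> t = flow (mat_blinfun A) sys.N \<alpha> t x"
  using traj_eq_flow[OF PE_signal, of \<alpha> T \<mu> x A b K t] by (simp only: sys_N)

lemma traj_flow_reverse:
  assumes "\<alpha> \<in> PE T \<mu>"
  shows "traj 0 x (- A) b (- K) \<alpha> t = flow (mat_blinfun A) sys.N (\<lambda>r. \<alpha> (- r)) (- t) x"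
  using traj_eq_flow[OF PE_signal[OF assms], of x "- A" b "- K" t]
    flow_reverse[OF signal_reflect[OF PE_signal[OF assms]], of "mat_blinfun A" sys.N t]
  by (simp add: mat_blinfun_minus matrix_mult_minus_right sys_N)

lemma norm_pos: "x \<noteq> 0 \<Longrightarrow> N x > 0"
proof -
  assume x: "x \<noteq> 0"
  obtain c C where c: "c > 0" "\<And>x. c * norm x \<le> N x" using is_norm_equivalent[OF N] by metis
  then have "0 < c * norm x" using x by simp
  then show "N x > 0" using c(2)[of x] by linarith
qed

text \<open>For \<open>rd\<close>, the reversed trajectory at time \<open>t\<close> is the point
  that a forward flow of duration \<open>t\<close> carries to \<open>x\<close>, so it has norm at
  least that of \<open>x\<close> divided by the bound on that flow. The signal of this flow is
  translated by an amount depending on \<open>t\<close>, so the bound must be uniform over the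
  signals.\<close>

lemma rates_lower_bound:
  assumes eb: "sys.eigenvalue_bound \<rho>" and \<epsilon>: "\<epsilon> > 0"
  shows "ereal (- (\<rho> + \<epsilon>)) \<le> rc N T \<mu> A b K" "ereal (- (\<rho> + \<epsilon>)) \<le> rd N T \<mu> (- A) b (- K)"
proof -
  let ?\<kappa> = "\<rho> + \<epsilon>"
  obtain c C where c: "c > 0" "C > 0" "\<And>x. c * norm x \<le> N x" "\<And>x. N x \<le> C * norm x"
    using is_norm_equivalent[OF N] by metis
  obtain G0 where G0: "\<And>\<alpha> t. \<alpha> \<in> PE T \<mu> \<Longrightarrow> t \<ge> 0 \<Longrightarrow> norm (flow (mat_blinfun A) sys.N \<alpha> t) \<le> G0 * exp (?\<kappa> * t)"
    using sys.growth[OF eb \<epsilon>] by blast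
  define G where "G = max G0 1"
  have G: "G > 0" by (simp add: G_def)
  have flow_le: "norm (flow (mat_blinfun A) sys.N \<alpha> t x) \<le> G * exp (?\<kappa> * t) * norm x" if "\<alpha> \<in> PE T \<mu>" "t \<ge> 0" for \<alpha> t x
  proof -
    have "G0 * exp (?\<kappa> * t) \<le> G * exp (?\<kappa> * t)" by (intro mult_right_mono) (auto simp: G_def)
    then have "norm (flow (mat_blinfun A) sys.N \<alpha> t) \<le> G * exp (?\<kappa> * t)" using G0[OF that] by linarith
    then show ?thesis by (intro order_trans[OF norm_blinfun mult_right_mono]) auto
  qed
  have "lambda_plus N x A b K \<alpha> \<le> ereal ?\<kappa>" if \<alpha>: "\<alpha> \<in> PE T \<mu>" and x: "x \<noteq> 0" for \<alpha> x
    unfolding lambda_plus_def traj_flow[OF \<alpha>]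
  proof (rule Limsup_le_of_exp_bound)
    show "0 < C * G * norm x" using c G x by simp
    show "0 < N (flow (mat_blinfun A) sys.N \<alpha> t x)" for t
      by (intro norm_pos flow_nonzero[OF PE_signal[OF \<alpha>] x])
    show "N (flow (mat_blinfun A) sys.N \<alpha> t x) \<le> C * G * norm x * exp (?\<kappa> * t)" if "t \<ge> 0" for t
      using order_trans[OF c(4) mult_left_mono[OF flow_le[OF \<alpha> that, of x]]] c(2) by (simp add: mult_ac)
  qed
  then have "Lambda_plus N A b K \<alpha> \<le> ereal ?\<kappa>" if "\<alpha> \<in> PE T \<mu>" for \<alpha>
    unfolding Lambda_plus_def using that by (intro SUP_least) auto
  then show "ereal (- ?\<kappa>) \<le> rc N T \<mu> A b K"
    unfolding rc_def uminus_ereal.simps(1)[symmetric]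
    by (intro INF_greatest) (simp only: ereal_minus_le_minus)
  have "ereal (- ?\<kappa>) \<le> lambda_minus N x (- A) b (- K) \<alpha>" if \<alpha>: "\<alpha> \<in> PE T \<mu>" and x: "x \<noteq> 0" for \<alpha> x
    unfolding lambda_minus_def traj_flow_reverse[OF \<alpha>]
  proof (rule Liminf_ge_of_exp_bound)
    let ?\<beta> = "\<lambda>r. \<alpha> (- r)"
    have \<beta>: "?\<beta> \<in> PE T \<mu>" by (rule PE_reflect[OF \<alpha>])
    show "0 < c * norm x / G" using c G x by simp
    show "0 < N (flow (mat_blinfun A) sys.N ?\<beta> (- t) x)" for t
      by (intro norm_pos flow_nonzero[OF PE_signal[OF \<beta>] x])
    show "c * norm x / G * exp (- ?\<kappa> * t) \<le> N (flow (mat_blinfun A) sys.N ?\<beta> (- t) x)" if "t \<ge> 0" for t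
    proof -
      let ?y = "flow (mat_blinfun A) sys.N ?\<beta> (- t) x"
      have "flow (mat_blinfun A) sys.N (\<lambda>r. ?\<beta> (r + - t)) t ?y = x"
        using arg_cong[OF flow_inverse[OF PE_signal[OF \<beta>], of _ _ "- t"], of "\<lambda>f. blinfun_apply f x"] by simp
      with flow_le[OF PE_shift[OF \<beta>, of "- t"] that, of ?y] have "norm x \<le> G * exp (?\<kappa> * t) * norm ?y" by simp
      then have "norm x * exp (- ?\<kappa> * t) \<le> G * exp (?\<kappa> * t) * norm ?y * exp (- ?\<kappa> * t)"
        by (intro mult_right_mono) auto
      also have "\<dots> = G * norm ?y * (exp (?\<kappa> * t) * exp (- ?\<kappa> * t))" by (simp only: mult_ac)
      also have "exp (?\<kappa> * t) * exp (- ?\<kappa> * t) = 1" by (simp add: exp_add[symmetric] algebra_simps)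
      finally have "norm x / G * exp (- ?\<kappa> * t) \<le> norm ?y" using G by (simp add: field_simps)
      then have "c * (norm x / G * exp (- ?\<kappa> * t)) \<le> c * norm ?y" using c(1) by (intro mult_left_mono) auto
      then show ?thesis using c(3)[of ?y] by simp
    qed
  qed
  then have "ereal (- ?\<kappa>) \<le> Lambda_minus N (- A) b (- K) \<alpha>" if "\<alpha> \<in> PE T \<mu>" for \<alpha>
    unfolding Lambda_minus_def using that by (intro INF_greatest) auto
  then show "ereal (- ?\<kappa>) \<le> rd N T \<mu> (- A) b (- K)"
    unfolding rd_def by (intro INF_greatest)
qed

text \<open>With a period of the signal and a real eigenvector,
  \<open>y (t + \<tau>) = z *\<^sub>R y t\<close> holds at all real times, so the line is periodic.
  Read backwards, the same trajectory serves \<open>- A\<close>, with the factor \<open>z\<close>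
  inverted.\<close>

lemma sharp_rates_upper_bound:
  assumes "\<not> sys.eigenvalue_bound \<rho>"
  shows "rc_sharp N T \<mu> A b K \<le> ereal (- \<rho>)" "rd_sharp N T \<mu> (- A) b (- K) \<le> ereal (- \<rho>)"
proof -
  obtain \<gamma> \<tau> x z where \<gamma>: "\<gamma> \<in> PE T \<mu>" and \<tau>: "0 < \<tau>" and per: "\<forall>s. \<gamma> (s + \<tau>) = \<gamma> s" and x: "x \<noteq> 0"
    and eig: "flow (mat_blinfun A) sys.N \<gamma> \<tau> x = z *\<^sub>R x" and z: "\<not> \<bar>z\<bar> \<le> exp (\<rho> * \<tau>)"
    using assms unfolding sys.eigenvalue_bound_def by blast
  have z': "\<bar>z\<bar> > exp (\<rho> * \<tau>)" using z by simp
  then have z0: "z \<noteq> 0" using exp_gt_zero[of "\<rho> * \<tau>"] by auto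
  define y where "y t = flow (mat_blinfun A) sys.N \<gamma> t x" for t
  have y0: "y 0 = x" by (simp add: y_def flow_0[OF PE_signal[OF \<gamma>]])
  have step: "y (t + \<tau>) = z *\<^sub>R y t" for t
  proof -
    have "(\<lambda>r. \<gamma> (r + \<tau>)) = \<gamma>" using per by auto
    then show ?thesis
      using flow_add[OF PE_signal[OF \<gamma>], of "mat_blinfun A" sys.N \<tau> t] eig
      by (simp add: y_def add.commute blinfun.scaleR_right)
  qed
  have fwd: "y (real n * \<tau>) = z ^ n *\<^sub>R x" for n
  proof (induction n)
    case (Suc n)
    have "y (real (Suc n) * \<tau>) = y (real n * \<tau> + \<tau>)" by (simp add: algebra_simps)
    then show ?case by (simp add: step Suc)
  qed (simp add: y0)
  have bwd: "z ^ n *\<^sub>R y (- (real n * \<tau>)) = x" for n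
  proof (induction n)
    case (Suc n)
    have "z *\<^sub>R y (- (real (Suc n) * \<tau>)) = y (- (real n * \<tau>))"
      unfolding step[symmetric] by (simp add: algebra_simps)
    then have "z ^ Suc n *\<^sub>R y (- (real (Suc n) * \<tau>)) = z ^ n *\<^sub>R y (- (real n * \<tau>))"
      by (metis power_Suc2 scaleR_scaleR)
    then show ?case by (simp only: Suc)
  qed (simp add: y0)
  have Nsc: "N (a *\<^sub>R v) = \<bar>a\<bar> * N v" for a v using N by (simp add: is_norm_def)
  have ypos: "N (y t) > 0" for t
    unfolding y_def by (intro norm_pos flow_nonzero[OF PE_signal[OF \<gamma>] x])
  have "(\<gamma>, x) \<in> sharp_admissible T \<mu> A b K"
    unfolding sharp_admissible_def periodic_with_def
    using \<gamma> x \<tau> per by (auto intro!: exI[of _ \<tau>] simp: traj_flow[OF \<gamma>] y_def[symmetric] step proj_line_scaleR[OF z0])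
  moreover have "ereal \<rho> \<le> lambda_plus N x A b K \<gamma>"
    unfolding lambda_plus_def traj_flow[OF \<gamma>] y_def[symmetric]
    by (rule Limsup_ge_of_multiples[OF \<tau> norm_pos[OF x] _ z']) (simp add: fwd Nsc power_abs)
  then have "- lambda_plus N x A b K \<gamma> \<le> ereal (- \<rho>)"
    unfolding uminus_ereal.simps(1)[symmetric] by (simp only: ereal_minus_le_minus)
  ultimately show "rc_sharp N T \<mu> A b K \<le> ereal (- \<rho>)"
    unfolding rc_sharp_def by (intro INF_lower2[of "(\<gamma>, x)"]) auto
  define \<beta> where "\<beta> r = \<gamma> (- r)" for r
  have \<beta>: "\<beta> \<in> PE T \<mu>" unfolding \<beta>_def by (rule PE_reflect[OF \<gamma>])
  have traj\<beta>: "traj 0 x (- A) b (- K) \<beta> t = y (- t)" for t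
    unfolding traj_flow_reverse[OF \<beta>] y_def by (simp add: \<beta>_def)
  have "(\<beta>, x) \<in> sharp_admissible T \<mu> (- A) b (- K)"
  proof -
    have "\<beta> (t + \<tau>) = \<beta> t" for t
      using per[rule_format, of "- t - \<tau>"] by (simp add: \<beta>_def)
    moreover have "proj_line (y (- (t + \<tau>))) = proj_line (y (- t))" for t
      using step[of "- t - \<tau>"] proj_line_scaleR[OF z0, of "y (- t - \<tau>)"] by simp
    ultimately show ?thesis
      unfolding sharp_admissible_def periodic_with_def using \<beta> x \<tau> by (auto intro!: exI[of _ \<tau>] simp: traj\<beta>)
  qed
  moreover have "lambda_minus N x (- A) b (- K) \<beta> \<le> ereal (- \<rho>)"
    unfolding lambda_minus_def traj\<beta>
  proof (rule Liminf_le_of_multiples[OF \<tau> norm_pos[OF x] ypos _ z'])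
    fix n
    have "\<bar>z\<bar> ^ n * N (y (- (real n * \<tau>))) = N x"
      using arg_cong[OF bwd[of n], of N] by (simp add: Nsc power_abs)
    then show "N (y (- (real n * \<tau>))) = N x / \<bar>z\<bar> ^ n" using z0 by (simp add: field_simps)
  qed
  ultimately show "rd_sharp N T \<mu> (- A) b (- K) \<le> ereal (- \<rho>)"
    unfolding rd_sharp_def by (intro INF_lower2[of "(\<beta>, x)"]) auto
qed

lemma rates_equal:
  shows "rc N T \<mu> A b K = rc_sharp N T \<mu> A b K"
    "rc_sharp N T \<mu> A b K = rd_sharp N T \<mu> (- A) b (- K)"
    "rd_sharp N T \<mu> (- A) b (- K) = rd N T \<mu> (- A) b (- K)"
proof -
  \<comment> \<open>Between two distinct values there is room for r < s. Testing the eigenvalue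
    bound at - s, one alternative puts \<open>Y\<close> above r and the other puts \<open>X\<close>
    below s, so no gap can occur.\<close>
  have eq: "X \<le> Y"
    if lower: "\<And>\<rho> \<epsilon>. sys.eigenvalue_bound \<rho> \<Longrightarrow> \<epsilon> > 0 \<Longrightarrow> ereal (- (\<rho> + \<epsilon>)) \<le> Y"
      and upper: "\<And>\<rho>. \<not> sys.eigenvalue_bound \<rho> \<Longrightarrow> X \<le> ereal (- \<rho>)" for X Y :: ereal
  proof (rule ccontr)
    assume "\<not> X \<le> Y"
    then have "Y < X" by simp
    then obtain r where r: "Y < ereal r" "ereal r < X" using ereal_dense2[of Y X] by auto
    then obtain s where s: "ereal r < ereal s" "ereal s < X" using ereal_dense2[of "ereal r" X] by auto
    show False
    proof (cases "sys.eigenvalue_bound (- s)")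
      case True
      from lower[OF True, of "s - r"] s have "ereal r \<le> Y" by simp
      then show False using r by simp
    next
      case False
      from upper[OF this] s show False by simp
    qed
  qed
  show "rc N T \<mu> A b K = rc_sharp N T \<mu> A b K"
    by (rule antisym[OF rc_le_rc_sharp eq[OF rates_lower_bound(1) sharp_rates_upper_bound(1)]])
  show "rc_sharp N T \<mu> A b K = rd_sharp N T \<mu> (- A) b (- K)"
    by (rule antisym[OF eq[OF order_trans[OF rates_lower_bound(2) rd_le_rd_sharp] sharp_rates_upper_bound(1)]
          eq[OF order_trans[OF rates_lower_bound(1) rc_le_rc_sharp] sharp_rates_upper_bound(2)]])
  show "rd_sharp N T \<mu> (- A) b (- K) = rd N T \<mu> (- A) b (- K)"
    by (rule antisym[OF eq[OF rates_lower_bound(2) sharp_rates_upper_bound(2)] rd_le_rd_sharp])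
qed

end

text \<open>The supremum over all feedbacks absorbs the sign change that time reversal imposes on
  \<open>K\<close>.\<close>

lemma SUP_uminus_reindex: "(SUP K. f (- K)) = (SUP K. f K)" for f :: "'a::group_add \<Rightarrow> ereal"
proof -
  have "range (\<lambda>K. f (- K)) = f ` range uminus" by (simp only: image_image)
  moreover have "range (uminus :: 'a \<Rightarrow> 'a) = UNIV" by (metis minus_minus surjI)
  ultimately show ?thesis by (simp only:)
qed

lemma pair_rates_equal:
  fixes N :: "real^'d \<Rightarrow> real" and A :: "real^'d^'d"
  assumes "is_norm N" "controllable A b" "0 < \<mu>" "\<mu> \<le> T"
  shows "RC_pair N T \<mu> A b = RC_sharp_pair N T \<mu> A b"
    "RC_sharp_pair N T \<mu> A b = RD_sharp_pair N T \<mu> (- A) b"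
    "RD_sharp_pair N T \<mu> (- A) b = RD_pair N T \<mu> (- A) b"
proof -
  note eq = rates_equal[OF assms]
  have "rc N T \<mu> A b = rc_sharp N T \<mu> A b" by (rule ext) (rule eq(1))
  then show "RC_pair N T \<mu> A b = RC_sharp_pair N T \<mu> A b"
    by (simp only: RC_pair_def RC_sharp_pair_def)
  have "rc_sharp N T \<mu> A b = (\<lambda>K. rd_sharp N T \<mu> (- A) b (- K))" by (rule ext) (rule eq(2))
  then show "RC_sharp_pair N T \<mu> A b = RD_sharp_pair N T \<mu> (- A) b"
    by (simp only: RC_sharp_pair_def RD_sharp_pair_def SUP_uminus_reindex[of "rd_sharp N T \<mu> (- A) b"])
  have "rd_sharp N T \<mu> (- A) b K = rd N T \<mu> (- A) b K" for K
    using eq(3)[of "- K"] by simp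
  then have "rd_sharp N T \<mu> (- A) b = rd N T \<mu> (- A) b" by (rule ext)
  then show "RD_sharp_pair N T \<mu> (- A) b = RD_pair N T \<mu> (- A) b"
    by (simp only: RD_pair_def RD_sharp_pair_def)
qed

text \<open>Both sides are the same \<open>THE\<close> term; it does not matter whether the families are constant
  on the controllable pairs.\<close>

lemma common_value_cong:
  assumes "\<And>b. controllable A b \<longleftrightarrow> controllable A' b" "\<And>b. controllable A b \<Longrightarrow> f b = g b"
  shows "common_value A f = common_value A' g"
proof -
  have "(\<forall>b. controllable A b \<longrightarrow> f b = r) \<longleftrightarrow> (\<forall>b. controllable A' b \<longrightarrow> g b = r)" for r
    using assms by auto
  then show ?thesis by (simp add: common_value_def)
qed

theorem theorem6p5:
  fixes N :: "real^'d \<Rightarrow> real" and A :: "real^'d^'d"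
  assumes "is_norm N"
    and "CARD('d) \<ge> 2"
    and "\<exists>b. controllable A b"
  shows "(\<forall>T \<mu>. T \<ge> \<mu> \<and> \<mu> > 0 \<longrightarrow>
            RC N T \<mu> A = RD N T \<mu> (- A) \<and>
            (RC N T \<mu> A = \<infinity> \<longleftrightarrow> RD N T \<mu> (- A) = \<infinity>)) \<and>
         (\<exists>c::real. c > 0 \<and>
            (\<forall>T \<mu>. T \<ge> \<mu> \<and> \<mu> > 0 \<longrightarrow>
               RC N T \<mu> A > ereal c \<or> RD N T \<mu> A > ereal c \<longrightarrow>
               RC N T \<mu> A = RC_sharp N T \<mu> A \<and>
               RC_sharp N T \<mu> A = RD_sharp N T \<mu> (- A) \<and>
               RD_sharp N T \<mu> (- A) = RD N T \<mu> (- A)))"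
proof -
  \<comment> \<open>The chain is obtained for each controllable \<open>b\<close> and carried over to
    the common values. Both parts are read off from it, with the witness 1 for the constant,
    independent of T and \<mu>.\<close>
  have eq: "RC N T \<mu> A = RC_sharp N T \<mu> A \<and> RC_sharp N T \<mu> A = RD_sharp N T \<mu> (- A) \<and>
      RD_sharp N T \<mu> (- A) = RD N T \<mu> (- A)" if "T \<ge> \<mu> \<and> \<mu> > 0" for T \<mu>
    unfolding RC_def RC_sharp_def RD_sharp_def RD_def
    using that pair_rates_equal[OF assms(1), of A _ \<mu> T]
    by (intro conjI common_value_cong) (auto simp: controllable_uminus_iff)
  then show ?thesis by (intro conjI exI[of _ "1::real"]) auto
qed

end
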